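(* For every integer $n\ge 0$, the map $\widetilde\Phi\circ\alpha^{-1}:\mathcal{M}_n\to\mathrm{SYT}_{\le3}(n)$ is bijective, and its restriction to $\mathcal{R}_n$ provides a bijection between $\mathcal{R}_n$ and $\mathrm{SYT}^{\equiv}_{\le 3}(n)$.
   Context: Permutations and paths. For a permutation $\pi=\pi_1\cdots\pi_n$ of $[n]=\{1,\dots,n\}$, an entry $\pi_i$ is a left-to-right (LR) maximum if $\pi_i>\pi_j$ for all $j<i$; $\mathrm{LR}(\pi)$ is the set of LR maxima (as values). $\mathfrak{M}_n$ is the set of $321$-avoiding permutations $\pi$ of $[n]$ such that every LR maximum $\pi_i$ is a descent ($i<n$ and $\pi_i>\pi_{i+1}$) or a fixed point ($\pi_i=i$). $\mathfrak{R}_n$ is the set of fixed-point-free permutations in $\mathfrak{M}_n$. A Motzkin path of length $n$ is a lattice path from $(0,0)$ to $(n,0)$ with steps $\mathsf{U}=(1,1)$, $\mathsf{H}=(1,0)$, $\mathsf{D}=(1,-1)$ never going below the $x$-axis, identified with its word of steps; a Riordan path is a Motzkin path with no $\mathsf{H}$-step on the $x$-axis. $\mathcal{M}_n$ and $\mathcal{R}_n$ denote the sets of Motzkin and Riordan paths of length $n$. The bijection $\alpha:\mathfrak{M}_n\to\mathcal{M}_n$ (which maps $\mathfrak{R}_n$ onto $\mathcal{R}_n$). For $\pi\in\mathfrak{M}_n$ let $D(\pi)=\{\pi_i:\pi_i\in\mathrm{LR}(\pi),\ \pi_i\ne i\}$ and $U(\pi)=\{\pi_{i+1}:\pi_i\in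 D(\pi)\}$. Then $\alpha(\pi)=w_1\cdots w_n$ with $w_v=\mathsf{D}$ if $v\in D(\pi)$, $w_v=\mathsf{U}$ if $v\in U(\pi)$, and $w_v=\mathsf{H}$ otherwise. The map $\hat\gamma$. Each $w\in\mathcal{M}_n\setminus\mathcal{R}_n$ is uniquely $w=w_0\,\mathsf{H}\,w_1$ where the displayed $\mathsf{H}$ is the first $\mathsf{H}$-step on the $x$-axis. Define $\gamma:\mathcal{M}_n\setminus\mathcal{R}_n\to\mathcal{R}_{n+1}$ by $\gamma(w_0\,\mathsf{H}\,w_1)=w_0\,\mathsf{U}\,w_1\,\mathsf{D}$, and $\hat\gamma=\alpha^{-1}\circ\gamma\circ\alpha:\mathfrak{M}_n\setminus\mathfrak{R}_n\to\mathfrak{R}_{n+1}$ (inner $\alpha$ on $\mathfrak{M}_n$, outer $\alpha^{-1}$ on $\mathcal{M}_{n+1}$). Tableaux. $\mathrm{SYT}_{\le3}(n)$ is the set of standard Young tableaux with $n$ cells and at most three rows, of shape $(\lambda_1,\lambda_2,\lambda_3)$ with $\lambda_1\ge\lambda_2\ge\lambda_3\ge0$. $\mathrm{SYT}^{\equiv}_{\le 3}(n)$ is the subset with $\lambda_1\equiv\lambda_2\equiv\lambda_3\pmod 2$ (empty rows included and counted as even). The map $\varrho:\mathrm{SYT}^{\equiv}_{\le 3}(n+1)\to\mathrm{SYT}_{\le3}(n)\setminus\mathrm{SYT}^{\equiv}_{\le 3}(n)$ removes the entry $n+1$. The map $\Phi:\mathfrak{R}_N\to\mathrm{SYT}^{\equiv}_{\le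 3}(N)$ (for every $N$). Let $\pi\in\mathfrak{R}_N$ have LR maxima $m_1<\cdots<m_k=N$. For $1\le j\le k-1$ let $a_j$ be the largest entry of $\pi$ located strictly between $m_j$ and $m_{j+1}$, and let $a_k=\pi_N$. Let $b_1<\cdots<b_{N-2k}$ be the elements of $\{1,\dots,N\}$ that are not among the $m_j$ and $a_j$. Let $\theta(\pi)=m_1\,a_1\,m_2\,a_2\cdots m_k\,a_k\,b_1\cdots b_{N-2k}$ and let $P(\theta(\pi))$ be its Robinson–Schensted insertion tableau (row insertion), which has at most three rows. On tableaux with $N$ cells of shape $(\lambda_1,\lambda_2,\lambda_3)$ consider the moves: (M1) (applied when $\lambda_3>0$ and $\lambda_3\not\equiv N\pmod 2$) Let $y$ be the last entry of row 3 and $x$ the largest entry of row 2 with $x<y$; remove $y$ from row 3, replace $x$ by $y$ in row 2, and append $x$ to the end of row 1. (M2) (applied when $\lambda_2>0$ and $\lambda_2\not\equiv N\pmod 2$) Move the last entry of row 2 to the end of row 1. A nonempty row of length $\not\equiv N\pmod 2$ is called defective. $\Psi(T)$ is obtained by applying (M1) if row 3 is defective, and then (M2) if the resulting row 2 is defective. Set $\Phi(\pi)=P(\theta(\pi))$ if its three row lengths have equal parity, and $\Phi(\pi)=\Psi(P(\theta(\pi)))$ otherwise. The map $\widetilde\Phi:\mathfrak{M}_n\to\mathrm{SYT}_{\le3}(n)$. For $\pi\in\mathfrak{M}_n$, $\widetilde\Phi(\pi)=\Phi(\pi)$ if $\pi\in\mathfrak{R}_n$, and $\widetilde\Phi(\pi)=(\varrho\circ\Phi\circ\hat\gamma)(\pi)$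 if $\pi\in\mathfrak{M}_n\setminus\mathfrak{R}_n$. *)

theory Defs
  imports Main "HOL-Combinatorics.Multiset_Permutations"
begin

section \<open>Permutations\<close>

text \<open>
  A permutation \<open>\<pi>\<^sub>1 \<dots> \<pi>\<^sub>n\<close> of \<open>{1..n}\<close> is the list of its values (an element of
  \<^term>\<open>permutations_of_set {1..n}\<close>).  List positions start at 0, so \<open>\<pi>\<^sub>i\<close> is \<open>\<pi> ! (i - 1)\<close>.
\<close>

definition lr_max_at :: "nat list \<Rightarrow> nat \<Rightarrow> bool" where
  "lr_max_at \<pi> i \<longleftrightarrow> i < length \<pi> \<and> (\<forall>j<i. \<pi> ! j < \<pi> ! i)"

definition fixed_point_at :: "nat list \<Rightarrow> nat \<Rightarrow> bool" where
  "fixed_point_at \<pi> i \<longleftrightarrow> i < length \<pi> \<and> \<pi> ! i = Suc i"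

definition descent_at :: "nat list \<Rightarrow> nat \<Rightarrow> bool" where
  "descent_at \<pi> i \<longleftrightarrow> Suc i < length \<pi> \<and> \<pi> ! i > \<pi> ! Suc i"

definition avoids_321 :: "nat list \<Rightarrow> bool" where
  "avoids_321 \<pi> \<longleftrightarrow>
     \<not> (\<exists>i j k. i < j \<and> j < k \<and> k < length \<pi> \<and> \<pi> ! i > \<pi> ! j \<and> \<pi> ! j > \<pi> ! k)"

definition motzkin_perms :: "nat \<Rightarrow> nat list set" where
  "motzkin_perms n =
     {\<pi> \<in> permutations_of_set {1..n}.
        avoids_321 \<pi> \<and> (\<forall>i. lr_max_at \<pi> i \<longrightarrow> descent_at \<pi> i \<or> fixed_point_at \<pi> i)}"

definition riordan_perms :: "nat \<Rightarrow> nat list set" where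
  "riordan_perms n = {\<pi> \<in> motzkin_perms n. \<forall>i. \<not> fixed_point_at \<pi> i}"

section \<open>Motzkin and Riordan paths\<close>

datatype step = Up | Hor | Down

fun rise :: "step \<Rightarrow> int" where
  "rise Up = 1"
| "rise Hor = 0"
| "rise Down = -1"

definition height :: "step list \<Rightarrow> int" where
  "height w = sum_list (map rise w)"

definition motzkin_paths :: "nat \<Rightarrow> step list set" where
  "motzkin_paths n =
     {w. length w = n \<and> height w = 0 \<and> (\<forall>i\<le>n. 0 \<le> height (take i w))}"

definition axis_hor_at :: "step list \<Rightarrow> nat \<Rightarrow> bool" where
  "axis_hor_at w i \<longleftrightarrow> i < length w \<and> w ! i = Hor \<and> height (take i w) = 0"

definition riordan_paths :: "nat \<Rightarrow> step list set" where
  "riordan_paths n = {w \<in> motzkin_paths n. \<forall>i. \<not> axis_hor_at w i}"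

section \<open>The maps \<open>\<alpha>\<close>, \<open>\<gamma>\<close> and their composite\<close>

definition Dset :: "nat list \<Rightarrow> nat set" where
  "Dset \<pi> = {\<pi> ! i |i. lr_max_at \<pi> i \<and> \<not> fixed_point_at \<pi> i}"

definition Uset :: "nat list \<Rightarrow> nat set" where
  "Uset \<pi> = {\<pi> ! Suc i |i. Suc i < length \<pi> \<and> \<pi> ! i \<in> Dset \<pi>}"

definition alpha :: "nat list \<Rightarrow> step list" where
  "alpha \<pi> =
     map (\<lambda>v. if v \<in> Dset \<pi> then Down else if v \<in> Uset \<pi> then Up else Hor) [1..<Suc (length \<pi>)]"

text \<open>
  The inverse of the bijection \<open>alpha\<close> from \<open>motzkin_perms n\<close> onto \<open>motzkin_paths n\<close>;
  \<open>inv_into\<close> is arbitrary outside the image.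
\<close>

definition alpha_inv :: "nat \<Rightarrow> step list \<Rightarrow> nat list" where
  "alpha_inv n = inv_into (motzkin_perms n) alpha"

definition gamma :: "step list \<Rightarrow> step list" where
  "gamma w = (let i = (LEAST i. axis_hor_at w i)
              in take i w @ [Up] @ drop (Suc i) w @ [Down])"

definition gamma_hat :: "nat \<Rightarrow> nat list \<Rightarrow> nat list" where
  "gamma_hat n = alpha_inv (Suc n) \<circ> gamma \<circ> alpha"

section \<open>Tableaux\<close>

text \<open>
  A tableau is the list of its nonempty rows, top row first.  A missing row has length 0;
  operations that may empty a row are followed by \<open>drop_empty\<close>.
\<close>

type_synonym tableau = "nat list list"

definition row_len :: "tableau \<Rightarrow> nat \<Rightarrow> nat" where
  "row_len T r = (if r < length T then length (T ! r) else 0)"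

definition drop_empty :: "tableau \<Rightarrow> tableau" where
  "drop_empty T = filter (\<lambda>r. r \<noteq> []) T"

definition SYT :: "nat \<Rightarrow> tableau set" where
  "SYT n =
     {T. [] \<notin> set T \<and>
         concat T \<in> permutations_of_set {1..n} \<and>
         (\<forall>i. Suc i < length T \<longrightarrow> length (T ! Suc i) \<le> length (T ! i)) \<and>
         (\<forall>r\<in>set T. sorted_wrt (<) r) \<and>
         (\<forall>i c. Suc i < length T \<and> c < length (T ! Suc i) \<longrightarrow> T ! i ! c < T ! Suc i ! c)}"

definition SYT3 :: "nat \<Rightarrow> tableau set" where
  "SYT3 n = {T \<in> SYT n. length T \<le> 3}"

definition equal_parity :: "tableau \<Rightarrow> bool" where
  "equal_parity T \<longleftrightarrow>
     row_len T 0 mod 2 = row_len T 1 mod 2 \<and> row_len T 1 mod 2 = row_len T 2 mod 2"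

definition SYT3_eq :: "nat \<Rightarrow> tableau set" where
  "SYT3_eq n = {T \<in> SYT3 n. equal_parity T}"

definition remove_entry :: "nat \<Rightarrow> tableau \<Rightarrow> tableau" where
  "remove_entry v T = drop_empty (map (removeAll v) T)"

section \<open>Robinson--Schensted row insertion\<close>

text \<open>The second component is the entry bumped out of the row, if any.\<close>

fun row_insert :: "nat \<Rightarrow> nat list \<Rightarrow> nat list \<times> nat option" where
  "row_insert x [] = ([x], None)"
| "row_insert x (y # ys) =
     (if x < y then (x # ys, Some y)
      else (case row_insert x ys of (zs, b) \<Rightarrow> (y # zs, b)))"

fun tab_insert :: "nat \<Rightarrow> tableau \<Rightarrow> tableau" where
  "tab_insert x [] = [[x]]"
| "tab_insert x (r # rs) =
     (case row_insert x r of
        (r', None) \<Rightarrow> r' # rs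
      | (r', Some y) \<Rightarrow> r' # tab_insert y rs)"

definition P_tab :: "nat list \<Rightarrow> tableau" where
  "P_tab w = fold tab_insert w []"

section \<open>The map \<open>\<Phi>\<close>\<close>

definition lr_positions :: "nat list \<Rightarrow> nat list" where
  "lr_positions \<pi> = filter (lr_max_at \<pi>) [0..<length \<pi>]"

text \<open>With 0-based \<open>j\<close>, \<open>m_val \<pi> j\<close> and \<open>a_val \<pi> j\<close> are \<open>m\<close> and \<open>a\<close> with subscript \<open>j + 1\<close>.\<close>

definition m_val :: "nat list \<Rightarrow> nat \<Rightarrow> nat" where
  "m_val \<pi> j = \<pi> ! (lr_positions \<pi> ! j)"

definition a_val :: "nat list \<Rightarrow> nat \<Rightarrow> nat" where
  "a_val \<pi> j =
     (if Suc j < length (lr_positions \<pi>)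
      then Max {\<pi> ! i |i. lr_positions \<pi> ! j < i \<and> i < lr_positions \<pi> ! Suc j}
      else last \<pi>)"

definition theta :: "nat list \<Rightarrow> nat list" where
  "theta \<pi> =
     (let k = length (lr_positions \<pi>)
      in concat (map (\<lambda>j. [m_val \<pi> j, a_val \<pi> j]) [0..<k]) @
         sorted_list_of_set ({1..length \<pi>} - (m_val \<pi> ` {..<k} \<union> a_val \<pi> ` {..<k})))"

definition defective :: "nat \<Rightarrow> tableau \<Rightarrow> nat \<Rightarrow> bool" where
  "defective N T r \<longleftrightarrow> row_len T r > 0 \<and> row_len T r mod 2 \<noteq> N mod 2"

definition move1 :: "tableau \<Rightarrow> tableau" where
  "move1 T =
     (let y = last (T ! 2); x = Max {z \<in> set (T ! 1). z < y}
      in drop_empty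
           (T[0 := T ! 0 @ [x],
              1 := map (\<lambda>z. if z = x then y else z) (T ! 1),
              2 := butlast (T ! 2)]))"

definition move2 :: "tableau \<Rightarrow> tableau" where
  "move2 T = drop_empty (T[0 := T ! 0 @ [last (T ! 1)], 1 := butlast (T ! 1)])"

definition Psi :: "nat \<Rightarrow> tableau \<Rightarrow> tableau" where
  "Psi N T =
     (let T' = (if defective N T 2 then move1 T else T)
      in if defective N T' 1 then move2 T' else T')"

definition Phi :: "nat list \<Rightarrow> tableau" where
  "Phi \<pi> =
     (let T = P_tab (theta \<pi>)
      in if equal_parity T then T else Psi (length \<pi>) T)"

definition Phi_tilde :: "nat \<Rightarrow> nat list \<Rightarrow> tableau" where
  "Phi_tilde n \<pi> =
     (if \<pi> \<in> riordan_perms n then Phi \<pi>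
      else remove_entry (Suc n) (Phi (gamma_hat n \<pi>)))"

end

theory Submission
  imports Defs
begin

text \<open>
  A standard tableau with at most three rows is the triple \<open>(A, B, C)\<close> of the contents of its rows:
  rows are increasing, and the column condition says that every initial segment of the alphabet
  contains at least as many elements of \<open>A\<close> as of \<open>B\<close>, and of \<open>B\<close> as of \<open>C\<close> (\<open>ballot\<close>).  In this
  language every map of the theorem replaces a few elements of finite sets, and all verifications
  compare the counting functions \<open>cnt\<close>.

  In a permutation \<open>\<pi>\<close> of \<open>motzkin_perms n\<close> the letters of \<open>D = Dset \<pi>\<close>
  increase, the other letters increase, and every \<open>d \<in> D\<close> is followed at once by a smaller letter of
  \<open>U = Uset \<pi>\<close>.  Hence \<open>\<pi>\<close> is recovered from \<open>(U, D)\<close> by writing the letters outside \<open>D\<close> in increasing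
  order and inserting the \<open>j\<close>-th letter of \<open>D\<close> before the \<open>j\<close>-th letter of \<open>U\<close>.  This works exactly
  if \<open>U\<close> and \<open>D\<close> have equal size and \<open>ballot U D\<close> holds, that is, if the associated word is a Motzkin
  path; its horizontal steps on the axis are the fixed points (\<open>alpha_bij\<close>, \<open>alpha_axis_hor_iff\<close>).

  For a Riordan permutation, the \<open>m\<^sub>j\<close> form \<open>D\<close> and the \<open>a\<^sub>j\<close> form the set \<open>A\<close> of the
  letters whose successor outside \<open>D\<close> lies in \<open>U\<close>, together with the last letter outside \<open>D\<close>.
  Passing from \<open>U\<close> to \<open>A\<close> delays each up-step, and the Riordan condition on \<open>(U, D)\<close> becomes the plain
  ballot condition on \<open>(A, D)\<close> (\<open>block_ends_bij\<close>).  So Riordan permutations correspond to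
  two-row rectangular tableaux with rows \<open>A\<close> and \<open>D\<close> in which every unused letter is smaller than
  some element of \<open>A\<close>.

  Inserting \<open>m\<^sub>1 a\<^sub>1 \<dots> m\<^sub>k a\<^sub>k\<close> produces this rectangle.  The unused letters are inserted
  in increasing order, so each of them is either appended to row 1 or bumps an entry of row 1 that bumps
  an entry of row 2 that is appended to row 3.  The second row keeps its length \<open>k\<close>, and therefore
  the insertion can be undone knowing the tableau alone (\<open>ins_step\<close>, \<open>pop_step\<close>).  Let \<open>x\<close> be the largest
  entry of row 2 below the last entry of row 3, the entry that the last bump brought there.
  The unused letters are dominated by \<open>A\<close> if and only if rows 1 and 2 have equal length or \<open>x\<close>
  exceeds all of row 1; such tableaux are called admissible (\<open>fold_ins_admissible_iff\<close>).

  Either no row or exactly two rows of a tableau with \<open>N\<close> cells have a length of the wrong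
  parity.  Each of the two moves pushes an entry of row 2 to the end of row 1, which destroys
  admissibility.  Taking the last entry of row 1 and row-inserting it into row 2 undoes either move, and
  one sees from admissibility whether a second step back is due.  So \<open>Psi\<close> exchanges
  admissible tableaux of unequal parity with inadmissible ones of equal parity (\<open>repair_bij\<close>),
  and \<open>Phi\<close> is a bijection onto the equal-parity tableaux (\<open>Phi_bij\<close>).

  Finally, the map \<open>gamma\<close> is undone at the last visit to the axis before the end
  (\<open>gamma_bij\<close>).  Deleting the largest entry from an equal-parity tableau leaves exactly one row whose
  parity differs from the other two, and this row tells where the entry has been (\<open>remove_from_bij\<close>).
  Both halves of \<open>Phi_tilde\<close> are thus bijections, with complementary images.
\<close>

section \<open>Three-row tableaux as triples of sets\<close>

definition cnt :: "nat set \<Rightarrow> nat \<Rightarrow> nat" where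
  "cnt S v = card {s \<in> S. s \<le> v}"

definition ballot :: "nat set \<Rightarrow> nat set \<Rightarrow> bool" where
  "ballot X Y \<longleftrightarrow> (\<forall>v. cnt Y v \<le> cnt X v)"

lemma cnt_empty [simp]: "cnt {} v = 0"
  by (simp add: cnt_def)

lemma cnt_insert:
  assumes "finite S" "x \<notin> S"
  shows "cnt (insert x S) v = cnt S v + (if x \<le> v then 1 else 0)"
proof -
  have "{s \<in> insert x S. s \<le> v} = (if x \<le> v then insert x {s \<in> S. s \<le> v} else {s \<in> S. s \<le> v})"
    by auto
  then show ?thesis using assms by (simp add: cnt_def)
qed

lemma cnt_remove:
  assumes "finite S" "x \<in> S"
  shows "cnt S v = cnt (S - {x}) v + (if x \<le> v then 1 else 0)"
  using cnt_insert[of "S - {x}" x v] assms by (simp add: insert_absorb)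

lemma cnt_mono: "finite S \<Longrightarrow> u \<le> v \<Longrightarrow> cnt S u \<le> cnt S v"
  unfolding cnt_def by (rule card_mono) auto

lemma cnt_cong: "(\<And>s. s \<in> S \<Longrightarrow> s \<le> u \<longleftrightarrow> s \<le> v) \<Longrightarrow> cnt S u = cnt S v"
  unfolding cnt_def by (rule arg_cong[of _ _ card]) auto

lemma cnt_all: "(\<And>s. s \<in> S \<Longrightarrow> s \<le> v) \<Longrightarrow> cnt S v = card S"
  unfolding cnt_def by (rule arg_cong[of _ _ card]) auto

lemma cnt_less:
  assumes "finite S" "s \<in> S" "u < s" "s \<le> v"
  shows "cnt S u < cnt S v"
proof -
  have "s \<in> {t \<in> S. t \<le> v} - {t \<in> S. t \<le> u}" "{t \<in> S. t \<le> u} \<subseteq> {t \<in> S. t \<le> v}"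
    using assms by auto
  then have "{t \<in> S. t \<le> u} \<subset> {t \<in> S. t \<le> v}" by blast
  then show ?thesis unfolding cnt_def using assms by (intro psubset_card_mono) auto
qed

lemma cnt_le_card: "finite S \<Longrightarrow> cnt S v \<le> card S"
  unfolding cnt_def by (rule card_mono) auto

lemma cnt_Suc: "finite S \<Longrightarrow> cnt S (Suc v) = cnt S v + (if Suc v \<in> S then 1 else 0)"
proof -
  assume f: "finite S"
  have "{s \<in> S. s \<le> Suc v} =
      (if Suc v \<in> S then insert (Suc v) {s \<in> S. s \<le> v} else {s \<in> S. s \<le> v})"
    by (auto simp: le_Suc_eq)
  then show ?thesis using f by (simp add: cnt_def)
qed

lemma cnt_0: "0 \<notin> S \<Longrightarrow> cnt S 0 = 0"
  by (auto simp: cnt_def card_eq_0_iff)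

lemma ballot_card_le:
  assumes "ballot X Y" "finite X" "finite Y"
  shows "card Y \<le> card X"
proof (cases "Y = {}")
  case False
  have "card Y = cnt Y (Max Y)"
    using assms by (intro cnt_all[symmetric]) auto
  also have "\<dots> \<le> cnt X (Max Y)" using assms by (simp add: ballot_def)
  also have "\<dots> \<le> card X" by (rule cnt_le_card) fact
  finally show ?thesis .
qed simp

lemma ballot_below:
  assumes "ballot X Y" "finite X" "finite Y" "X \<inter> Y = {}" "y \<in> Y"
  shows "\<exists>x\<in>X. x < y"
proof -
  have "0 < cnt Y y" using assms by (auto simp: cnt_def card_gt_0_iff)
  also have "\<dots> \<le> cnt X y" using assms by (simp add: ballot_def)
  finally have "{x \<in> X. x \<le> y} \<noteq> {}" unfolding cnt_def by (metis card.empty less_irrefl)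
  then obtain x where "x \<in> X" "x \<le> y" by auto
  moreover have "x \<noteq> y" using assms \<open>x \<in> X\<close> by auto
  ultimately show ?thesis by (metis le_neq_implies_less)
qed

text \<open>
  The \<open>c\<close>-th entry of the lower row exceeds the \<open>c\<close>-th entry of the upper row for all \<open>c\<close> if and only if no
  initial segment of the alphabet contains more entries of the lower row: test the count at the entry itself.
\<close>

lemma ballot_lists_iff:
  assumes xs: "sorted_wrt (<) xs" and ys: "sorted_wrt (<) (ys :: nat list)"
    and dis: "set xs \<inter> set ys = {}"
  shows "ballot (set xs) (set ys) \<longleftrightarrow>
    length ys \<le> length xs \<and> (\<forall>c < length ys. xs ! c < ys ! c)"
proof -
  have cnt: "cnt (set zs) v = card {c. c < length zs \<and> zs ! c \<le> v}"
    if z: "sorted_wrt (<) zs" for zs :: "nat list" and v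
  proof -
    have "{s \<in> set zs. s \<le> v} = (!) zs ` {c. c < length zs \<and> zs ! c \<le> v}"
      by (auto simp: in_set_conv_nth)
    moreover have "inj_on ((!) zs) {c. c < length zs \<and> zs ! c \<le> v}"
      using z unfolding strict_sorted_iff inj_on_def by (simp add: nth_eq_iff_index_eq)
    ultimately show ?thesis by (simp add: cnt_def card_image)
  qed
  have fin: "finite {c. c < length zs \<and> zs ! c \<le> v}" for zs :: "nat list" and v by simp
  show ?thesis
  proof
    assume b: "ballot (set xs) (set ys)"
    have dx: "distinct xs" "distinct ys" using xs ys by (simp_all add: strict_sorted_iff)
    have len: "length ys \<le> length xs"
      using ballot_card_le[OF b] dx by (simp add: distinct_card)
    moreover have "xs ! c < ys ! c" if c: "c < length ys" for c
    proof (rule ccontr)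
      assume nless: "\<not> xs ! c < ys ! c"
      have "xs ! c \<in> set xs" "ys ! c \<in> set ys" using c len by simp_all
      then have "xs ! c \<noteq> ys ! c" using dis by auto
      with nless have gt: "ys ! c < xs ! c" by simp
      have "i < c" if i: "i < length xs" "xs ! i \<le> ys ! c" for i
      proof (rule ccontr)
        assume "\<not> i < c"
        then have "xs ! c \<le> xs ! i"
          using sorted_wrt_nth_less[OF xs, of c i] i by (cases "i = c") simp_all
        then show False using i gt by simp
      qed
      then have "{i. i < length xs \<and> xs ! i \<le> ys ! c} \<subseteq> {..<c}" by blast
      then have "card {i. i < length xs \<and> xs ! i \<le> ys ! c} \<le> card {..<c}"
        by (rule card_mono[rotated]) simp
      then have "cnt (set xs) (ys ! c) \<le> c" by (simp add: cnt[OF xs])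
      moreover have "ys ! i \<le> ys ! c" if "i \<le> c" for i
        using sorted_wrt_nth_less[OF ys, of i c] that c by (cases "i = c") simp_all
      then have "{..c} \<subseteq> {i. i < length ys \<and> ys ! i \<le> ys ! c}"
        using c by auto
      then have "card {..c} \<le> card {i. i < length ys \<and> ys ! i \<le> ys ! c}"
        by (rule card_mono[OF fin])
      then have "Suc c \<le> cnt (set ys) (ys ! c)" by (simp add: cnt[OF ys])
      moreover have "cnt (set ys) (ys ! c) \<le> cnt (set xs) (ys ! c)"
        using b by (simp add: ballot_def)
      ultimately show False by simp
    qed
    ultimately show "length ys \<le> length xs \<and> (\<forall>c<length ys. xs ! c < ys ! c)" by blast
  next
    assume "length ys \<le> length xs \<and> (\<forall>c<length ys. xs ! c < ys ! c)"
    then have "{c. c < length ys \<and> ys ! c \<le> v} \<subseteq> {c. c < length xs \<and> xs ! c \<le> v}" for v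
      by (auto intro: less_le_trans less_imp_le order_trans)
    then show "ballot (set xs) (set ys)"
      unfolding ballot_def cnt[OF xs] cnt[OF ys] by (intro allI card_mono[OF fin])
  qed
qed

type_synonym triple = "nat set \<times> nat set \<times> nat set"

text \<open>
  Standardness without reference to the alphabet, because intermediate tableaux of an insertion use only
  some of the letters.
\<close>

definition standard :: "triple \<Rightarrow> bool" where
  "standard = (\<lambda>(A, B, C). finite A \<and> finite B \<and> finite C \<and>
     A \<inter> B = {} \<and> A \<inter> C = {} \<and> B \<inter> C = {} \<and> ballot A B \<and> ballot B C)"

definition content :: "triple \<Rightarrow> nat set" where
  "content = (\<lambda>(A, B, C). A \<union> B \<union> C)"

definition triples :: "nat \<Rightarrow> triple set" where
  "triples n = {T. standard T \<and> content T = {1..n}}"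

definition tableau_of :: "triple \<Rightarrow> tableau" where
  "tableau_of = (\<lambda>(A, B, C). drop_empty (map sorted_list_of_set [A, B, C]))"

lemma standard_empty:
  assumes "standard (A, B, C)"
  shows "A = {} \<Longrightarrow> B = {}" "B = {} \<Longrightarrow> C = {}"
  using assms ballot_card_le[of A B] ballot_card_le[of B C] by (auto simp: standard_def)

lemma tableau_of_cases:
  assumes "standard (A, B, C)"
  shows "tableau_of (A, B, C) =
    (if A = {} then [] else if B = {} then [sorted_list_of_set A]
     else if C = {} then [sorted_list_of_set A, sorted_list_of_set B]
     else [sorted_list_of_set A, sorted_list_of_set B, sorted_list_of_set C])"
  using assms standard_empty[OF assms]
  by (auto simp: tableau_of_def drop_empty_def standard_def)

lemma row_len_tableau_of:
  assumes "standard (A, B, C)"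
  shows "row_len (tableau_of (A, B, C)) 0 = card A"
    "row_len (tableau_of (A, B, C)) (Suc 0) = card B"
    "row_len (tableau_of (A, B, C)) 2 = card C"
  using standard_empty[OF assms]
  by (auto simp: tableau_of_cases[OF assms] row_len_def numeral_2_eq_2)

lemma tableau_of_mem_SYT3:
  assumes "T \<in> triples n"
  shows "tableau_of T \<in> SYT3 n"
proof -
  obtain A B C where T: "T = (A, B, C)" by (cases T)
  have st: "standard (A, B, C)" and un: "A \<union> B \<union> C = {1..n}"
    using assms by (auto simp: T triples_def content_def)
  have fin: "finite A" "finite B" "finite C" and dis: "A \<inter> B = {}" "A \<inter> C = {}" "B \<inter> C = {}"
    and bal: "ballot A B" "ballot B C"
    using st by (auto simp: standard_def)
  note AB = ballot_lists_iff[of "sorted_list_of_set A" "sorted_list_of_set B"]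
  note BC = ballot_lists_iff[of "sorted_list_of_set B" "sorted_list_of_set C"]
  have AB: "card B \<le> card A"
    "\<And>c. c < card B \<Longrightarrow> sorted_list_of_set A ! c < sorted_list_of_set B ! c"
    using AB fin dis bal by auto
  have BC: "card C \<le> card B"
    "\<And>c. c < card C \<Longrightarrow> sorted_list_of_set B ! c < sorted_list_of_set C ! c"
    using BC fin dis bal by auto
  have "concat (tableau_of T) = sorted_list_of_set A @ sorted_list_of_set B @ sorted_list_of_set C"
    by (auto simp: T tableau_of_def drop_empty_def)
  then have "concat (tableau_of T) \<in> permutations_of_set {1..n}"
    using fin dis un by (auto simp: permutations_of_set_def)
  moreover have "[] \<notin> set (tableau_of T)" by (auto simp: T tableau_of_def drop_empty_def)
  moreover have "\<forall>r\<in>set (tableau_of T). sorted_wrt (<) r"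
    by (auto simp: T tableau_of_def drop_empty_def)
  ultimately show ?thesis
    using AB BC by (auto simp: SYT3_def SYT_def T tableau_of_cases[OF st] less_Suc_eq)
qed

definition row :: "tableau \<Rightarrow> nat \<Rightarrow> nat list" where
  "row T r = (if r < length T then T ! r else [])"

lemma row_tableau_of:
  assumes "standard (A, B, C)"
  shows "row (tableau_of (A, B, C)) 0 = sorted_list_of_set A"
    "row (tableau_of (A, B, C)) 1 = sorted_list_of_set B"
    "row (tableau_of (A, B, C)) 2 = sorted_list_of_set C"
  using standard_empty[OF assms(1)]
  by (simp_all add: row_def tableau_of_cases[OF assms(1)] numeral_2_eq_2)

lemma tableau_of_inj: "inj_on tableau_of (triples n)"
proof (rule inj_onI)
  fix S T assume S: "S \<in> triples n" and T: "T \<in> triples n" and eq: "tableau_of S = tableau_of T"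
  obtain A B C where S': "S = (A, B, C)" by (cases S)
  obtain A' B' C' where T': "T = (A', B', C')" by (cases T)
  have st: "standard (A, B, C)" "standard (A', B', C')"
    using S T by (auto simp: S' T' triples_def)
  have fin: "finite A" "finite B" "finite C" "finite A'" "finite B'" "finite C'"
    using st by (auto simp: standard_def)
  have "sorted_list_of_set A = sorted_list_of_set A'" "sorted_list_of_set B = sorted_list_of_set B'"
    "sorted_list_of_set C = sorted_list_of_set C'"
    using eq row_tableau_of[OF st(1)] row_tableau_of[OF st(2)] unfolding S' T' by simp_all
  then show "S = T" using fin sorted_list_of_set_inject unfolding S' T' by blast
qed

text \<open>
  Missing rows are read as empty sets.
\<close>

lemma tableau_of_surj:
  assumes "T \<in> SYT3 n"
  shows "T \<in> tableau_of ` triples n"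
proof -
  have len: "length T \<le> 3" and ne: "[] \<notin> set T" and con: "concat T \<in> permutations_of_set {1..n}"
    and le: "\<And>i. Suc i < length T \<Longrightarrow> length (T ! Suc i) \<le> length (T ! i)"
    and srt: "\<And>r. r \<in> set T \<Longrightarrow> sorted_wrt (<) r"
    and col: "\<And>i c. Suc i < length T \<Longrightarrow> c < length (T ! Suc i) \<Longrightarrow> T ! i ! c < T ! Suc i ! c"
    using assms by (auto simp: SYT3_def SYT_def)
  have rows: "T = filter (\<lambda>r. r \<noteq> []) [row T 0, row T 1, row T 2]"
  proof -
    have "length T = 0 \<or> length T = Suc 0 \<or> length T = Suc (Suc 0) \<or> length T = Suc (Suc (Suc 0))"
      using len by linarith
    then show ?thesis using ne by (auto simp: row_def length_Suc_conv)
  qed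
  have "concat T = row T 0 @ row T 1 @ row T 2" by (subst rows) auto
  then have dist: "distinct (row T 0 @ row T 1 @ row T 2)" and
    un: "set (row T 0) \<union> set (row T 1) \<union> set (row T 2) = {1..n}"
    using con by (auto simp: permutations_of_set_def)
  have srt': "sorted_wrt (<) (row T r)" for r
    using srt by (auto simp: row_def)
  have bal: "ballot (set (row T i)) (set (row T (Suc i)))" if "set (row T i) \<inter> set (row T (Suc i)) = {}" for i
    using ballot_lists_iff[OF srt' srt' that] le[of i] col[of i] by (auto simp: row_def)
  have lst: "sorted_list_of_set (set (row T r)) = row T r" for r
    using srt'[of r] by (metis sorted_list_of_set.idem_if_sorted_distinct strict_sorted_iff)
  let ?T = "(set (row T 0), set (row T 1), set (row T 2))"
  have "standard ?T"
    using dist bal[of 0] bal[of 1] by (auto simp: standard_def numeral_2_eq_2)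
  then have "?T \<in> triples n" using un by (simp add: triples_def content_def)
  moreover have "tableau_of ?T = T"
    by (subst rows) (simp only: tableau_of_def drop_empty_def lst prod.case list.map)
  ultimately show ?thesis by (metis imageI)
qed

lemma tableau_of_bij: "bij_betw tableau_of (triples n) (SYT3 n)"
  unfolding bij_betw_def using tableau_of_inj tableau_of_mem_SYT3 tableau_of_surj by blast

text \<open>
  For the second and third row, the entry \<open>x\<close> of the first move.  After a bump through all three rows
  it is the entry that arrived in row 2, so it also records the last insertion step.
\<close>

definition link :: "nat set \<Rightarrow> nat set \<Rightarrow> nat" where
  "link B C = Max {z \<in> B. z < Max C}"

text \<open>
  The property that characterises the insertion tableaux of Riordan permutations.
\<close>

fun admissible :: "triple \<Rightarrow> bool" where
  "admissible (A, B, C) \<longleftrightarrow> card A = card B \<or> C \<noteq> {} \<and> Max A < link B C"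

lemma standardD:
  assumes "standard (A, B, C)"
  shows "finite A" "finite B" "finite C" "A \<inter> B = {}" "A \<inter> C = {}" "B \<inter> C = {}"
    "cnt B v \<le> cnt A v" "cnt C v \<le> cnt B v" "card B \<le> card A" "card C \<le> card B"
  using assms ballot_card_le[of A B] ballot_card_le[of B C] by (auto simp: standard_def ballot_def)

text \<open>
  The link exists because the ballot condition puts an entry of \<open>B\<close> below every entry of \<open>C\<close>.
\<close>

lemma link_props:
  assumes st: "standard (A, B, C)" and ne: "C \<noteq> {}"
  shows "link B C \<in> B" "link B C < Max C" "z \<in> B \<Longrightarrow> z < Max C \<Longrightarrow> z \<le> link B C"
    "link B C \<notin> A" "link B C \<notin> C"
proof -
  note d = standardD[OF st]
  have "Max C \<in> C" using d ne by simp
  then have "\<exists>z\<in>B. z < Max C"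
    using ballot_below[of B C "Max C"] d st by (auto simp: standard_def)
  then have "link B C \<in> {z \<in> B. z < Max C}"
    unfolding link_def using d by (intro Max_in) auto
  then show "link B C \<in> B" "link B C < Max C" by auto
  then show "link B C \<notin> A" "link B C \<notin> C" using d by auto
  show "z \<in> B \<Longrightarrow> z < Max C \<Longrightarrow> z \<le> link B C"
    unfolding link_def using d by (intro Max_ge) auto
qed

text \<open>
  The last entry \<open>y\<close> of row 3 replaces the link \<open>x\<close> in row 2.  Between \<open>x\<close> and \<open>y\<close>, row 2 loses an entry, but there it has
  as many entries as up to \<open>y\<close>, while row 3 has not reached \<open>y\<close>.
\<close>

lemma move_link_cnt:
  assumes st: "standard (A, B, C)" and ne: "C \<noteq> {}"
  defines "B' \<equiv> insert (Max C) (B - {link B C})" and "C' \<equiv> C - {Max C}"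
  shows "cnt B' v + (if link B C \<le> v then 1 else 0) = cnt B v + (if Max C \<le> v then 1 else 0)" (is ?B)
    and "cnt C' v \<le> cnt B' v"
proof -
  let ?x = "link B C" and ?y = "Max C"
  note d = standardD[OF st] and l = link_props[OF st ne]
  have y: "?y \<in> C" using d(3) ne by simp
  then have y': "?y \<notin> B" using d(6) by blast
  show cB: ?B
    using d l y' cnt_insert[of "B - {?x}" ?y v] cnt_remove[of B ?x v] by (simp add: B'_def)
  have cC: "cnt C v = cnt C' v + (if ?y \<le> v then 1 else 0)"
    using d y cnt_remove[of C ?y v] by (simp add: C'_def)
  consider "v < ?x" | "?x \<le> v" "v < ?y" | "?y \<le> v" by linarith
  then show "cnt C' v \<le> cnt B' v"
  proof cases
    case 2
    have "cnt C v < cnt C ?y" using 2 d y by (intro cnt_less[of _ ?y]) auto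
    also have "\<dots> \<le> cnt B ?y" by (rule d(8))
    also have "cnt B ?y = cnt B v"
      by (rule cnt_cong) (metis 2 l(3) order_trans less_imp_le nat_less_le y')
    finally have "cnt C v < cnt B v" .
    then show ?thesis using cB cC 2 by auto
  qed (use cB cC d(8)[of v] l(2) in auto)
qed

text \<open>
  An entry \<open>q\<close> bumps \<open>y\<close> from row 2, and \<open>y\<close> is appended to row 3.  Since row 3 is complete before \<open>y\<close>, row 2 has a surplus
  entry at \<open>y\<close>.
\<close>

lemma bump_into_last_cnt:
  assumes fin: "finite B" "finite C" and le: "\<And>v. cnt C v \<le> cnt B v"
    and y: "y \<in> B" "y \<notin> C" "\<And>c. c \<in> C \<Longrightarrow> c < y" and q: "q \<notin> B" "q < y"
  defines "B' \<equiv> insert q (B - {y})"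
  shows "cnt B' v + (if y \<le> v then 1 else 0) = cnt B v + (if q \<le> v then 1 else 0)" (is ?B)
    and "cnt (insert y C) v \<le> cnt B' v"
proof -
  show cB: ?B
    using fin q y cnt_insert[of "B - {y}" q v] cnt_remove[of B y v] by (simp add: B'_def)
  have cC: "cnt (insert y C) v = cnt C v + (if y \<le> v then 1 else 0)"
    using fin y(2) by (simp add: cnt_insert)
  show "cnt (insert y C) v \<le> cnt B' v"
  proof (cases "y \<le> v")
    case True
    have "card C = cnt C (y - 1)" by (rule cnt_all[symmetric]) (use y(3) in fastforce)
    also have "\<dots> \<le> cnt B (y - 1)" by (rule le)
    also have "\<dots> < cnt B v" using True fin y q(2) by (intro cnt_less[of _ y]) auto
    finally have "Suc (card C) \<le> cnt B v" by simp
    moreover have "cnt C v \<le> card C" using fin by (simp add: cnt_le_card)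
    ultimately show ?thesis using True cB cC q(2) by auto
  next
    case False
    then show ?thesis using cB cC le[of v] by auto
  qed
qed

section \<open>Interleavings and the bijection with Motzkin paths\<close>

text \<open>
  The shape of the permutations in \<open>motzkin_perms\<close>, with \<open>D\<close> and \<open>U\<close> as parameters: the letters inside
  \<open>D\<close> and the letters outside \<open>D\<close> increase, and the adjacent pairs \<open>d u\<close> with \<open>d \<in> D\<close> or with \<open>u \<in> U\<close>
  are the same pairs, all of them descents.
\<close>

definition woven :: "nat set \<Rightarrow> nat set \<Rightarrow> nat list \<Rightarrow> bool" where
  "woven D U \<pi> \<longleftrightarrow> distinct \<pi> \<and> set \<pi> = {1..length \<pi>} \<and> D \<subseteq> set \<pi> \<and> U \<subseteq> set \<pi> \<and> D \<inter> U = {} \<and>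
     (\<forall>i j. i < j \<longrightarrow> j < length \<pi> \<longrightarrow> (\<pi> ! i \<in> D \<longleftrightarrow> \<pi> ! j \<in> D) \<longrightarrow> \<pi> ! i < \<pi> ! j) \<and>
     (\<forall>i < length \<pi>. \<pi> ! i \<in> D \<longrightarrow> Suc i < length \<pi> \<and> \<pi> ! Suc i \<in> U \<and> \<pi> ! Suc i < \<pi> ! i) \<and>
     (\<forall>i < length \<pi>. \<pi> ! i \<in> U \<longrightarrow> (\<exists>j. i = Suc j \<and> \<pi> ! j \<in> D))"

lemma wovenD:
  assumes "woven D U \<pi>"
  shows "distinct \<pi>" "set \<pi> = {1..length \<pi>}" "D \<subseteq> {1..length \<pi>}" "U \<subseteq> {1..length \<pi>}" "D \<inter> U = {}"
    "\<And>i j. i < j \<Longrightarrow> j < length \<pi> \<Longrightarrow> (\<pi> ! i \<in> D \<longleftrightarrow> \<pi> ! j \<in> D) \<Longrightarrow> \<pi> ! i < \<pi> ! j"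
    "\<And>i. i < length \<pi> \<Longrightarrow> \<pi> ! i \<in> D \<Longrightarrow> Suc i < length \<pi> \<and> \<pi> ! Suc i \<in> U \<and> \<pi> ! Suc i < \<pi> ! i"
    "\<And>i. i < length \<pi> \<Longrightarrow> \<pi> ! i \<in> U \<Longrightarrow> \<exists>j. i = Suc j \<and> \<pi> ! j \<in> D"
    "finite D" "finite U"
proof -
  show "finite D" "finite U" using assms unfolding woven_def by (metis List.finite_set finite_subset)+
qed (use assms in \<open>unfold woven_def, blast+\<close>)

text \<open>
  If the first \<open>i + 1\<close> letters are at most \<open>i + 1\<close>, they exhaust these values.
\<close>

lemma prefix_le_imp_suffix_gt:
  assumes d: "distinct \<pi>" "set \<pi> = {1..length \<pi>}" and ij: "i < j" "j < length \<pi>"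
    and le: "\<And>k. k \<le> i \<Longrightarrow> \<pi> ! k \<le> Suc i"
  shows "Suc i < \<pi> ! j"
proof -
  have sub: "set (take (Suc i) \<pi>) \<subseteq> {1..Suc i}"
  proof
    fix x assume "x \<in> set (take (Suc i) \<pi>)"
    then obtain k where k: "k < Suc i" "x = \<pi> ! k" using ij by (auto simp: in_set_conv_nth)
    then have "x \<in> set \<pi>" using ij by simp
    then show "x \<in> {1..Suc i}" using d(2) le k by auto
  qed
  have "card (set (take (Suc i) \<pi>)) = Suc i"
    using d(1) ij by (subst distinct_card) auto
  then have eq: "set (take (Suc i) \<pi>) = {1..Suc i}"
    using sub by (intro card_subset_eq) auto
  have "\<pi> ! j \<in> set (drop (Suc i) \<pi>)"
    using ij by (auto simp: in_set_conv_nth intro!: exI[of _ "j - Suc i"])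
  then have "\<pi> ! j \<notin> {1..Suc i}"
    using d(1) eq set_take_disj_set_drop_if_distinct[of \<pi> "Suc i" "Suc i"] by auto
  moreover have "\<pi> ! j \<in> {1..length \<pi>}" using d(2) ij by (metis nth_mem)
  ultimately show ?thesis by auto
qed

lemma Dset_iff:
  assumes "distinct \<pi>" "i < length \<pi>"
  shows "\<pi> ! i \<in> Dset \<pi> \<longleftrightarrow> lr_max_at \<pi> i \<and> \<not> fixed_point_at \<pi> i"
  using assms unfolding Dset_def lr_max_at_def by (auto simp: nth_eq_iff_index_eq)

text \<open>
  Two letters outside \<open>D\<close> in decreasing order are impossible: if the first is not a left-to-right
  maximum, a larger letter before it completes the pattern 321; if it is one, it is a fixed point,
  and then all smaller values come before it.
\<close>

lemma motzkin_perms_woven: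
  assumes "\<pi> \<in> motzkin_perms n"
  shows "woven (Dset \<pi>) (Uset \<pi>) \<pi>" "length \<pi> = n"
proof -
  have p: "distinct \<pi>" "set \<pi> = {1..n}" and av: "avoids_321 \<pi>"
    and m: "\<And>i. lr_max_at \<pi> i \<Longrightarrow> descent_at \<pi> i \<or> fixed_point_at \<pi> i"
    using assms by (auto simp: motzkin_perms_def permutations_of_set_def)
  show len: "length \<pi> = n" using distinct_card[OF p(1)] p(2) by simp
  have D: "\<pi> ! i \<in> Dset \<pi> \<longleftrightarrow> lr_max_at \<pi> i \<and> \<not> fixed_point_at \<pi> i" if "i < length \<pi>" for i
    using Dset_iff[OF p(1) that] .
  have ne: "\<pi> ! i \<noteq> \<pi> ! j" if "i < j" "j < length \<pi>" for i j
    using p(1) that by (simp add: nth_eq_iff_index_eq)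
  have ord: "\<pi> ! i < \<pi> ! j" if ij: "i < j" "j < length \<pi>" and eq: "\<pi> ! i \<in> Dset \<pi> \<longleftrightarrow> \<pi> ! j \<in> Dset \<pi>" for i j
  proof (cases "\<pi> ! j \<in> Dset \<pi>")
    case True
    then show ?thesis using D[OF ij(2)] ij by (auto simp: lr_max_at_def)
  next
    case False
    then have i: "\<not> lr_max_at \<pi> i \<or> fixed_point_at \<pi> i" using eq D[of i] ij by auto
    show ?thesis
    proof (cases "lr_max_at \<pi> i")
      case True
      then have fx: "\<pi> ! i = Suc i" using i by (auto simp: fixed_point_at_def)
      have "\<pi> ! k \<le> Suc i" if "k \<le> i" for k
        using True fx that by (cases "k = i") (auto simp: lr_max_at_def intro: less_imp_le)
      then show ?thesis using prefix_le_imp_suffix_gt[of \<pi> i j] p len ij fx by simp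
    next
      case False
      then obtain k where k: "k < i" "\<pi> ! i \<le> \<pi> ! k" using ij by (auto simp: lr_max_at_def not_less)
      then have "\<pi> ! i < \<pi> ! k" using ne[of k i] ij by simp
      then have "\<not> \<pi> ! j < \<pi> ! i" using av k(1) ij unfolding avoids_321_def by blast
      then show ?thesis using ne[OF ij] by simp
    qed
  qed
  have des: "Suc i < length \<pi> \<and> \<pi> ! Suc i \<in> Uset \<pi> \<and> \<pi> ! Suc i < \<pi> ! i"
    if "i < length \<pi>" "\<pi> ! i \<in> Dset \<pi>" for i
    using that D[OF that(1)] m[of i] by (auto simp: descent_at_def Uset_def)
  have pre: "\<exists>j. i = Suc j \<and> \<pi> ! j \<in> Dset \<pi>" if "i < length \<pi>" "\<pi> ! i \<in> Uset \<pi>" for i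
    using that p(1) by (auto simp: Uset_def nth_eq_iff_index_eq)
  have "u \<notin> Dset \<pi>" if u: "u \<in> Uset \<pi>" for u
  proof -
    obtain i where i: "Suc i < length \<pi>" "\<pi> ! i \<in> Dset \<pi>" "u = \<pi> ! Suc i"
      using u unfolding Uset_def by blast
    then have "\<not> lr_max_at \<pi> (Suc i)" using des[of i] unfolding lr_max_at_def by (meson Suc_lessD lessI less_asym)
    then show ?thesis using D[OF i(1)] i(3) by simp
  qed
  moreover have "Dset \<pi> \<subseteq> set \<pi>" "Uset \<pi> \<subseteq> set \<pi>"
    by (auto simp: Dset_def Uset_def lr_max_at_def)
  ultimately show "woven (Dset \<pi>) (Uset \<pi>) \<pi>"
    unfolding woven_def using p len ord des pre by blast
qed

text \<open>
  A letter outside \<open>D\<close> standing before \<open>d\<close> is smaller than the partner \<open>u\<close> of \<open>d\<close>, hence smaller than \<open>d\<close>.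
\<close>

lemma woven_D_lr_max:
  assumes w: "woven D U \<pi>" and i: "i < length \<pi>" "\<pi> ! i \<in> D"
  shows "lr_max_at \<pi> i"
  unfolding lr_max_at_def
proof (intro conjI allI impI)
  note W = wovenD[OF w]
  fix j assume j: "j < i"
  show "\<pi> ! j < \<pi> ! i"
  proof (cases "\<pi> ! j \<in> D")
    case True
    then show ?thesis using W(6) j i by blast
  next
    case False
    have u: "Suc i < length \<pi>" "\<pi> ! Suc i \<in> U" "\<pi> ! Suc i < \<pi> ! i" using W(7)[OF i] by auto
    then have "\<pi> ! Suc i \<notin> D" using W(5) by auto
    then have "\<pi> ! j < \<pi> ! Suc i" using W(6)[of j "Suc i"] j u(1) False by simp
    then show ?thesis using u(3) by simp
  qed
qed (rule i)

lemma woven_D_not_fixed: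
  assumes w: "woven D U \<pi>" and i: "i < length \<pi>" "\<pi> ! i \<in> D"
  shows "\<not> fixed_point_at \<pi> i"
proof
  note W = wovenD[OF w]
  assume "fixed_point_at \<pi> i"
  then have f: "\<pi> ! i = Suc i" by (simp add: fixed_point_at_def)
  have "\<pi> ! k \<le> Suc i" if "k \<le> i" for k
    using woven_D_lr_max[OF w i] f that by (cases "k = i") (auto simp: lr_max_at_def intro: less_imp_le)
  then have "Suc i < \<pi> ! Suc i" using prefix_le_imp_suffix_gt[OF W(1,2), of i "Suc i"] W(7)[OF i] by simp
  then show False using W(7)[OF i] f by simp
qed

text \<open>
  A letter of \<open>D\<close> exceeds its partner, and the partner lies outside \<open>D\<close>, where letters increase.
\<close>

lemma woven_after_larger:
  assumes w: "woven D U \<pi>" and ij: "i < j" "j < length \<pi>" and i: "\<pi> ! i \<notin> D"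
  shows "\<pi> ! i < \<pi> ! j"
proof (cases "\<pi> ! j \<in> D")
  case False
  then show ?thesis using wovenD(6)[OF w ij] i by simp
next
  case True
  note W = wovenD[OF w]
  have u: "Suc j < length \<pi>" "\<pi> ! Suc j \<in> U" "\<pi> ! Suc j < \<pi> ! j" using W(7)[OF ij(2) True] by auto
  then have "\<pi> ! Suc j \<notin> D" using W(5) by auto
  then have "\<pi> ! i < \<pi> ! Suc j" using W(6)[of i "Suc j"] ij u(1) i by simp
  then show ?thesis using u(3) by simp
qed

lemma prefix_set_eq:
  assumes d: "distinct \<pi>" "set \<pi> = {1..length \<pi>}" and i: "i < length \<pi>"
    and before: "\<And>j. j < i \<Longrightarrow> \<pi> ! j < \<pi> ! i" and after: "\<And>j. i < j \<Longrightarrow> j < length \<pi> \<Longrightarrow> \<pi> ! i < \<pi> ! j"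
  shows "set (take i \<pi>) = {1..<\<pi> ! i}" "\<pi> ! i = Suc i"
proof -
  show eq: "set (take i \<pi>) = {1..<\<pi> ! i}"
  proof (intro equalityI subsetI)
    fix x assume "x \<in> set (take i \<pi>)"
    then obtain k where k: "k < i" "x = \<pi> ! k" using i by (auto simp: in_set_conv_nth)
    then have "x \<in> set \<pi>" using i by simp
    then show "x \<in> {1..<\<pi> ! i}" using d(2) before k by auto
  next
    fix x assume x: "x \<in> {1..<\<pi> ! i}"
    have "\<pi> ! i \<in> {1..length \<pi>}" using d(2) i by (metis nth_mem)
    then have "x \<in> set \<pi>" using d(2) x by auto
    then obtain k where k: "k < length \<pi>" "x = \<pi> ! k" by (auto simp: in_set_conv_nth)
    have "k < i" using after[of k] k x by (metis atLeastLessThan_iff less_asym linorder_neqE_nat less_irrefl)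
    then show "x \<in> set (take i \<pi>)" using k by (auto simp: in_set_conv_nth intro!: exI[of _ k])
  qed
  have "\<pi> ! i \<in> {1..length \<pi>}" using d(2) i by (metis nth_mem)
  moreover have "card (set (take i \<pi>)) = i" using d(1) i by (subst distinct_card) auto
  ultimately show "\<pi> ! i = Suc i" using eq by auto
qed

text \<open>
  The parameters \<open>D\<close> and \<open>U\<close> are determined by the word.  A left-to-right maximum outside \<open>D\<close> exceeds
  everything before it and nothing after it, so it stands at its own position.
\<close>

lemma woven_Dset:
  assumes w: "woven D U \<pi>"
  shows "Dset \<pi> = D" "lr_max_at \<pi> i \<Longrightarrow> \<pi> ! i \<notin> D \<Longrightarrow> fixed_point_at \<pi> i"
proof -
  note W = wovenD[OF w]
  show fxd: "fixed_point_at \<pi> i" if l: "lr_max_at \<pi> i" "\<pi> ! i \<notin> D" for i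
  proof -
    have i: "i < length \<pi>" using l by (simp add: lr_max_at_def)
    have "\<pi> ! i = Suc i"
      using prefix_set_eq(2)[OF W(1,2) i] woven_after_larger[OF w _ _ l(2)] l(1) by (auto simp: lr_max_at_def)
    then show ?thesis using i by (simp add: fixed_point_at_def)
  qed
  have "\<pi> ! i \<in> Dset \<pi> \<longleftrightarrow> \<pi> ! i \<in> D" if "i < length \<pi>" for i
    using Dset_iff[OF W(1) that] woven_D_lr_max[OF w that] woven_D_not_fixed[OF w that] fxd[of i] by blast
  moreover have "Dset \<pi> \<subseteq> set \<pi>" by (auto simp: Dset_def lr_max_at_def)
  moreover have "D \<subseteq> set \<pi>" using W by simp
  ultimately show "Dset \<pi> = D" by (metis in_set_conv_nth subsetD subset_antisym subsetI)
qed

lemma woven_Uset: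
  assumes w: "woven D U \<pi>"
  shows "Uset \<pi> = U"
proof -
  note W = wovenD[OF w]
  show ?thesis unfolding Uset_def woven_Dset(1)[OF w]
  proof (intro equalityI subsetI)
    fix u assume "u \<in> {\<pi> ! Suc i |i. Suc i < length \<pi> \<and> \<pi> ! i \<in> D}"
    then show "u \<in> U" using W(7) by auto
  next
    fix u assume u: "u \<in> U"
    then have "u \<in> set \<pi>" using W by auto
    then obtain i where i: "i < length \<pi>" "u = \<pi> ! i" by (auto simp: in_set_conv_nth)
    then obtain j where "i = Suc j" "\<pi> ! j \<in> D" using W(8) u by blast
    then show "u \<in> {\<pi> ! Suc i |i. Suc i < length \<pi> \<and> \<pi> ! i \<in> D}" using i by auto
  qed
qed

text \<open>
  Of three letters, two lie in the same of two increasing subsequences.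
\<close>

lemma woven_motzkin_perms:
  assumes w: "woven D U \<pi>"
  shows "\<pi> \<in> motzkin_perms (length \<pi>)"
proof -
  note W = wovenD[OF w]
  have "avoids_321 \<pi>"
    unfolding avoids_321_def
  proof clarify
    fix i j k assume ijk: "i < j" "j < k" "k < length \<pi>" "\<pi> ! j < \<pi> ! i" "\<pi> ! k < \<pi> ! j"
    show False using W(6)[of i j] W(6)[of j k] W(6)[of i k] ijk by (meson less_asym less_trans)
  qed
  moreover have "descent_at \<pi> i \<or> fixed_point_at \<pi> i" if "lr_max_at \<pi> i" for i
    using woven_Dset(2)[OF w that] W(7)[of i] that by (auto simp: descent_at_def lr_max_at_def)
  ultimately show ?thesis
    using W unfolding motzkin_perms_def permutations_of_set_def by blast
qed

text \<open>
  The recursive form of \<open>woven\<close>, without the condition that letters increase.  It makes explicit that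
  reading the letters outside \<open>D\<close> one by one decides, by membership in \<open>U\<close>, when the next letter of \<open>D\<close> comes.
\<close>

inductive interleaving :: "nat set \<Rightarrow> nat set \<Rightarrow> nat list \<Rightarrow> bool" for D U where
  Nil: "interleaving D U []"
| single: "c \<notin> D \<Longrightarrow> c \<notin> U \<Longrightarrow> interleaving D U r \<Longrightarrow> interleaving D U (c # r)"
| pair: "d \<in> D \<Longrightarrow> u \<notin> D \<Longrightarrow> u \<in> U \<Longrightarrow> u < d \<Longrightarrow> interleaving D U r \<Longrightarrow> interleaving D U (d # u # r)"

lemma interleaving_unique:
  assumes "interleaving D U xs" "interleaving D U ys"
    and "filter (\<lambda>v. v \<in> D) xs = filter (\<lambda>v. v \<in> D) ys" "filter (\<lambda>v. v \<notin> D) xs = filter (\<lambda>v. v \<notin> D) ys"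
  shows "xs = ys"
  using assms
proof (induction xs arbitrary: ys)
  case Nil
  have "v \<notin> set ys" for v
    using Nil(2,3) by (cases "v \<in> D") (auto simp: filter_empty_conv dest: sym)
  then show ?case by (cases ys) auto
next
  case (single c r)
  from single.prems(1) show ?case
  proof cases
    case Nil
    then show ?thesis using single by simp
  next
    case s: (single c' r')
    then have "c = c'" "filter (\<lambda>v. v \<in> D) r = filter (\<lambda>v. v \<in> D) r'"
      "filter (\<lambda>v. v \<notin> D) r = filter (\<lambda>v. v \<notin> D) r'"
      using single.prems(2,3) single.hyps by simp_all
    then show ?thesis using single.IH s by simp
  next
    case (pair d u r')
    then have "c = u" using single.prems(3) single.hyps by simp
    then show ?thesis using pair single.hyps by simp
  qed
next
  case (pair d u r)
  from pair.prems(1) show ?case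
  proof cases
    case Nil
    then show ?thesis using pair by simp
  next
    case (single c' r')
    then have "u = c'" using pair.prems(3) pair.hyps by simp
    then show ?thesis using single pair.hyps by simp
  next
    case p: (pair d' u' r')
    then have "d = d'" "u = u'" "filter (\<lambda>v. v \<in> D) r = filter (\<lambda>v. v \<in> D) r'"
      "filter (\<lambda>v. v \<notin> D) r = filter (\<lambda>v. v \<notin> D) r'"
      using pair.prems(2,3) pair.hyps by simp_all
    then show ?thesis using pair.IH p by simp
  qed
qed

text \<open>
  Put the \<open>j\<close>-th letter of \<open>D\<close> before the \<open>j\<close>-th letter of \<open>U\<close>.
\<close>

lemma interleaving_exists:
  assumes "set cs \<inter> D = {}" "set ds \<subseteq> D" "list_all2 (<) (filter (\<lambda>c. c \<in> U) cs) ds"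
  shows "\<exists>xs. interleaving D U xs \<and> filter (\<lambda>v. v \<in> D) xs = ds \<and> filter (\<lambda>v. v \<notin> D) xs = cs"
  using assms
proof (induction cs arbitrary: ds)
  case Nil
  then show ?case by (auto intro!: exI[of _ "[]"] interleaving.Nil)
next
  case (Cons c cs)
  show ?case
  proof (cases "c \<in> U")
    case True
    then obtain d ds' where ds: "ds = d # ds'" "c < d" "list_all2 (<) (filter (\<lambda>c. c \<in> U) cs) ds'"
      using Cons.prems by (auto simp: list_all2_Cons1)
    then obtain xs where "interleaving D U xs" "filter (\<lambda>v. v \<in> D) xs = ds'" "filter (\<lambda>v. v \<notin> D) xs = cs"
      using Cons.IH[of ds'] Cons.prems by auto
    then show ?thesis using ds True Cons.prems
      by (intro exI[of _ "d # c # xs"]) (auto intro: interleaving.pair)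
  next
    case False
    then obtain xs where "interleaving D U xs" "filter (\<lambda>v. v \<in> D) xs = ds" "filter (\<lambda>v. v \<notin> D) xs = cs"
      using Cons.IH[of ds] Cons.prems by auto
    then show ?thesis using False Cons.prems
      by (intro exI[of _ "c # xs"]) (auto intro: interleaving.single)
  qed
qed

lemma interleaving_D:
  "interleaving D U xs \<Longrightarrow> i < length xs \<Longrightarrow> xs ! i \<in> D \<Longrightarrow>
     Suc i < length xs \<and> xs ! Suc i \<in> U \<and> xs ! Suc i < xs ! i"
proof (induction xs arbitrary: i rule: interleaving.induct)
  case (single c r)
  then show ?case by (cases i) auto
next
  case (pair d u r)
  then show ?case by (cases i; cases "i - 1") auto
qed simp

lemma interleaving_U:
  "interleaving D U xs \<Longrightarrow> D \<inter> U = {} \<Longrightarrow> i < length xs \<Longrightarrow> xs ! i \<in> U \<Longrightarrow> \<exists>j. i = Suc j \<and> xs ! j \<in> D"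
proof (induction xs arbitrary: i rule: interleaving.induct)
  case (single c r)
  then obtain k where k: "i = Suc k" "k < length r" "r ! k \<in> U" by (cases i) auto
  then obtain j where "k = Suc j" "r ! j \<in> D" using single by blast
  then show ?case using k by simp
next
  case (pair d u r)
  consider "i = 0" | "i = Suc 0" | k where "i = Suc (Suc k)" by (metis nat.exhaust)
  then show ?case
  proof cases
    case 3
    then obtain j where "k = Suc j" "r ! j \<in> D" using pair by fastforce
    then show ?thesis using 3 by simp
  qed (use pair in auto)
qed simp

text \<open>
  The statement is proved for all suffixes that do not begin with a letter of \<open>U\<close>, since such a letter belongs
  to the letter of \<open>D\<close> before it.
\<close>

lemma woven_interleaving:
  assumes w: "woven D U \<pi>"
  shows "interleaving D U \<pi>"
proof -
  note W = wovenD[OF w]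
  have "interleaving D U (drop i \<pi>)" if "i \<le> length \<pi>" "i < length \<pi> \<longrightarrow> \<pi> ! i \<notin> U" for i
    using that
  proof (induction "length \<pi> - i" arbitrary: i rule: less_induct)
    case less
    show ?case
    proof (cases "i < length \<pi>")
      case False
      then show ?thesis by (simp add: interleaving.Nil)
    next
      case i: True
      then have di: "drop i \<pi> = \<pi> ! i # drop (Suc i) \<pi>" by (simp add: Cons_nth_drop_Suc)
      show ?thesis
      proof (cases "\<pi> ! i \<in> D")
        case False
        have "\<pi> ! Suc i \<notin> U" if "Suc i < length \<pi>" using W(8)[OF that] False by auto
        then have "interleaving D U (drop (Suc i) \<pi>)" using less.hyps[of "Suc i"] i by auto
        then show ?thesis using False less.prems i by (auto simp: di intro: interleaving.single)
      next
        case True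
        have u: "Suc i < length \<pi>" "\<pi> ! Suc i \<in> U" "\<pi> ! Suc i < \<pi> ! i" using W(7)[OF i True] by auto
        then have uD: "\<pi> ! Suc i \<notin> D" using W(5) by auto
        have "\<pi> ! Suc (Suc i) \<notin> U" if "Suc (Suc i) < length \<pi>" using W(8)[OF that] uD by auto
        then have "interleaving D U (drop (Suc (Suc i)) \<pi>)" using less.hyps[of "Suc (Suc i)"] u i by auto
        moreover have "drop i \<pi> = \<pi> ! i # \<pi> ! Suc i # drop (Suc (Suc i)) \<pi>"
          using di u(1) by (simp add: Cons_nth_drop_Suc)
        ultimately show ?thesis using True u uD by (auto intro: interleaving.pair)
      qed
    qed
  qed
  moreover have "\<pi> ! 0 \<notin> U" if "0 < length \<pi>" using W(8)[OF that] by auto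
  ultimately show ?thesis using drop0 by (metis le0)
qed

lemma sorted_filter_nth:
  assumes "\<And>i j. i < j \<Longrightarrow> j < length xs \<Longrightarrow> P (xs ! i) \<Longrightarrow> P (xs ! j) \<Longrightarrow> xs ! i < xs ! j"
  shows "sorted_wrt (<) (filter P xs)"
proof -
  have "sorted_wrt (\<lambda>x y. P x \<longrightarrow> P y \<longrightarrow> x < y) xs"
    using assms by (auto simp: sorted_wrt_iff_nth_less)
  then have "sorted_wrt (\<lambda>x y. P x \<longrightarrow> P y \<longrightarrow> x < y) (filter P xs)" by (rule sorted_wrt_filter)
  then show ?thesis by (rule sorted_wrt_mono_rel[rotated]) auto
qed

lemma nth_less_of_sorted_filter:
  assumes "sorted_wrt (<) (filter P xs)" "i < j" "j < length xs" "P (xs ! i)" "P (xs ! j)"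
  shows "xs ! i < xs ! j"
proof -
  have "xs = take j xs @ xs ! j # drop (Suc j) xs" using assms(3) by (rule id_take_nth_drop)
  then have "filter P xs = filter P (take j xs) @ xs ! j # filter P (drop (Suc j) xs)"
    using assms(5) by (metis filter.simps(2) filter_append)
  moreover have "xs ! i \<in> set (take j xs)"
    using assms(2,3) by (auto simp: in_set_conv_nth intro!: exI[of _ i])
  ultimately show ?thesis using assms(1,4) by (auto simp: sorted_wrt_append)
qed

lemma woven_unique:
  assumes w: "woven D U \<pi>" "woven D U \<rho>" and len: "length \<pi> = length \<rho>"
  shows "\<pi> = \<rho>"
proof (rule interleaving_unique)
  note W = wovenD[OF w(1)] and W' = wovenD[OF w(2)]
  show "interleaving D U \<pi>" "interleaving D U \<rho>" using w woven_interleaving by auto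
  have "filter P \<pi> = filter P \<rho>" if P: "P = (\<lambda>v. v \<in> D) \<or> P = (\<lambda>v. v \<notin> D)" for P
  proof -
    have "sorted_wrt (<) (filter P \<pi>)" "sorted_wrt (<) (filter P \<rho>)"
      using P by (auto intro!: sorted_filter_nth W(6) W'(6))
    moreover have "set (filter P \<pi>) = set (filter P \<rho>)" using W(2) W'(2) len by simp
    ultimately show ?thesis by (simp add: strict_sorted_equal)
  qed
  then show "filter (\<lambda>v. v \<in> D) \<pi> = filter (\<lambda>v. v \<in> D) \<rho>" "filter (\<lambda>v. v \<notin> D) \<pi> = filter (\<lambda>v. v \<notin> D) \<rho>"
    by blast+
qed

text \<open>
  The ballot condition on \<open>(U, D)\<close> says that the \<open>j\<close>-th letter of \<open>U\<close> is smaller than the \<open>j\<close>-th letter of \<open>D\<close>.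
\<close>

lemma woven_exists:
  assumes sub: "D \<subseteq> {1..n}" "U \<subseteq> {1..n}" "D \<inter> U = {}" and bal: "ballot U D" "card U = card D"
  shows "\<exists>\<pi>. woven D U \<pi> \<and> length \<pi> = n"
proof -
  have fin: "finite D" "finite U" using sub finite_subset by blast+
  let ?cs = "sorted_list_of_set ({1..n} - D)" and ?ds = "sorted_list_of_set D"
  let ?us = "filter (\<lambda>c. c \<in> U) ?cs"
  have us: "sorted_wrt (<) ?us" "set ?us = U" using sub by (auto intro: sorted_wrt_filter)
  have "length ?us = card U" using us by (metis distinct_card strict_sorted_iff)
  moreover have "\<forall>c<length ?ds. ?us ! c < ?ds ! c"
    using ballot_lists_iff[OF us(1), of ?ds] us(2) sub bal fin by auto
  ultimately have "list_all2 (<) ?us ?ds"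
    using bal by (auto simp: list_all2_conv_all_nth)
  then obtain \<pi> where p: "interleaving D U \<pi>" "filter (\<lambda>v. v \<in> D) \<pi> = ?ds" "filter (\<lambda>v. v \<notin> D) \<pi> = ?cs"
    using interleaving_exists[of ?cs D ?ds U] fin by auto
  have ord: "\<pi> ! i < \<pi> ! j" if ij: "i < j" "j < length \<pi>" "\<pi> ! i \<in> D \<longleftrightarrow> \<pi> ! j \<in> D" for i j
    using nth_less_of_sorted_filter[of "\<lambda>v. v \<in> D" \<pi> i j]
      nth_less_of_sorted_filter[of "\<lambda>v. v \<notin> D" \<pi> i j] ij p by auto
  have "distinct \<pi>" unfolding distinct_conv_nth
    by (metis ord less_irrefl linorder_neqE_nat)
  have "set \<pi> = set (filter (\<lambda>v. v \<in> D) \<pi>) \<union> set (filter (\<lambda>v. v \<notin> D) \<pi>)" by auto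
  also have "\<dots> = {1..n}" unfolding p using sub fin by auto
  finally have s: "set \<pi> = {1..n}" .
  then have "length \<pi> = n" using distinct_card[OF \<open>distinct \<pi>\<close>] by simp
  moreover have "woven D U \<pi>"
    unfolding woven_def
    using \<open>distinct \<pi>\<close> s \<open>length \<pi> = n\<close> sub ord interleaving_D[OF p(1)] interleaving_U[OF p(1) sub(3)] by auto
  ultimately show ?thesis by blast
qed

text \<open>
  The map sending a letter of \<open>D\<close> to its partner.  It decreases letters, which yields the ballot condition.
\<close>

lemma woven_successor:
  assumes w: "woven D U \<pi>"
  shows "\<exists>f. bij_betw f D U \<and> (\<forall>i < length \<pi>. \<pi> ! i \<in> D \<longrightarrow> f (\<pi> ! i) = \<pi> ! Suc i) \<and>
    (\<forall>d\<in>D. f d < d)"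
proof -
  note W = wovenD[OF w]
  define f where "f d = \<pi> ! Suc (THE i. i < length \<pi> \<and> \<pi> ! i = d)" for d
  have f: "f (\<pi> ! i) = \<pi> ! Suc i" if "i < length \<pi>" for i
  proof -
    have "(THE j. j < length \<pi> \<and> \<pi> ! j = \<pi> ! i) = i"
      using W(1) that by (intro the_equality) (auto simp: nth_eq_iff_index_eq)
    then show ?thesis by (simp add: f_def)
  qed
  have D: "\<exists>i<length \<pi>. d = \<pi> ! i" if "d \<in> D" for d
    using that W(2,3) by (metis in_set_conv_nth subsetD)
  have "inj_on f D"
  proof (rule inj_onI)
    fix d e assume de: "d \<in> D" "e \<in> D" "f d = f e"
    obtain i j where ij: "i < length \<pi>" "d = \<pi> ! i" "j < length \<pi>" "e = \<pi> ! j" using D de by blast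
    then have "\<pi> ! Suc i = \<pi> ! Suc j" "Suc i < length \<pi>" "Suc j < length \<pi>" using f de W(7) by auto
    then have "i = j" using W(1) by (simp add: nth_eq_iff_index_eq)
    then show "d = e" using ij by simp
  qed
  moreover have "f ` D = U"
  proof (intro equalityI subsetI)
    fix u assume "u \<in> f ` D"
    then show "u \<in> U" using D f W(7) by fastforce
  next
    fix u assume u: "u \<in> U"
    then have "u \<in> set \<pi>" using W by auto
    then obtain i where i: "i < length \<pi>" "u = \<pi> ! i" by (auto simp: in_set_conv_nth)
    then obtain j where j: "i = Suc j" "\<pi> ! j \<in> D" using W(8) u by blast
    then have "f (\<pi> ! j) = u" using f[of j] i by simp
    then show "u \<in> f ` D" using j by blast
  qed
  ultimately have "bij_betw f D U" by (simp add: bij_betw_def)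
  moreover have "f d < d" if "d \<in> D" for d
    using D[OF that] f W(7) that by auto
  ultimately show ?thesis using f by blast
qed

lemma woven_ballot:
  assumes w: "woven D U \<pi>"
  shows "ballot U D" "card U = card D"
proof -
  obtain f where f: "bij_betw f D U" "\<forall>d\<in>D. f d < d"
    using woven_successor[OF w] by blast
  show "card U = card D" using bij_betw_same_card[OF f(1)] by simp
  show "ballot U D"
    unfolding ballot_def cnt_def
  proof
    fix v
    have "f d \<in> U \<and> f d \<le> v" if "d \<in> D" "d \<le> v" for d
      using bij_betw_apply[OF f(1) that(1)] bspec[OF f(2) that(1)] that(2) by simp
    then have "f ` {d \<in> D. d \<le> v} \<subseteq> {u \<in> U. u \<le> v}" by blast
    moreover have "inj_on f {d \<in> D. d \<le> v}" using f(1) by (auto simp: bij_betw_def inj_on_def)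
    moreover have "finite {u \<in> U. u \<le> v}" using wovenD(10)[OF w] by simp
    ultimately show "card {d \<in> D. d \<le> v} \<le> card {u \<in> U. u \<le> v}"
      using card_inj_on_le by blast
  qed
qed

text \<open>
  Both directions compare \<open>D\<close> and \<open>U\<close> below the letter \<open>Suc i\<close> through the partner map.  If \<open>Suc i\<close> is fixed,
  the letters before it are exactly the smaller ones, so partners occur together below \<open>Suc i\<close>.
  Conversely, equal counts force the partner map to be onto below \<open>Suc i\<close>; then a letter of \<open>D\<close> before
  \<open>Suc i\<close>, whose partner is smaller than \<open>Suc i\<close>, is itself smaller.
\<close>

lemma woven_fixed_point_iff:
  assumes w: "woven D U \<pi>" and i: "i < length \<pi>"
  shows "fixed_point_at \<pi> i \<longleftrightarrow> Suc i \<notin> D \<and> Suc i \<notin> U \<and> cnt U i = cnt D i"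
proof
  note W = wovenD[OF w]
  obtain f where f: "bij_betw f D U" "\<forall>i < length \<pi>. \<pi> ! i \<in> D \<longrightarrow> f (\<pi> ! i) = \<pi> ! Suc i"
    "\<forall>d\<in>D. f d < d" using woven_successor[OF w] by blast
  \<comment> \<open>\<open>f\<close> sends a letter of \<open>D\<close> to the letter after it.\<close>
  have inj: "inj_on f {d \<in> D. d \<le> i}" using f(1) by (auto simp: bij_betw_def inj_on_def)
  have "f d \<in> U \<and> f d \<le> i" if "d \<in> D" "d \<le> i" for d
    using bij_betw_apply[OF f(1) that(1)] bspec[OF f(3) that(1)] that(2) by simp
  then have sub: "f ` {d \<in> D. d \<le> i} \<subseteq> {u \<in> U. u \<le> i}" by blast
  {
    assume fp: "fixed_point_at \<pi> i"
    then have v: "\<pi> ! i = Suc i" by (simp add: fixed_point_at_def)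
    have nD: "\<pi> ! i \<notin> D" using woven_D_not_fixed[OF w i] fp by blast
    have after: "\<pi> ! i < \<pi> ! j" if "i < j" "j < length \<pi>" for j
      using woven_after_larger[OF w that nD] .
    have sub': "{1..i} \<subseteq> set (take i \<pi>)"
    proof
      fix x assume x: "x \<in> {1..i}"
      then have "x \<in> set \<pi>" using W(2) i by auto
      then obtain k where k: "k < length \<pi>" "x = \<pi> ! k" by (auto simp: in_set_conv_nth)
      have "k < i"
      proof (rule ccontr)
        assume "\<not> k < i"
        then have "k = i \<or> \<pi> ! i < \<pi> ! k" using after[of k] k(1) by linarith
        then show False using x k(2) v by auto
      qed
      then have "take i \<pi> ! k \<in> set (take i \<pi>)" using k(1) i by (intro nth_mem) simp
      then show "x \<in> set (take i \<pi>)" using k(2) \<open>k < i\<close> by simp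
    qed
    have "card (set (take i \<pi>)) = i" using W(1) i by (subst distinct_card) auto
    then have pre: "{1..i} = set (take i \<pi>)" using sub' by (intro card_subset_eq) auto
    have before: "\<pi> ! j \<le> i" if "j < i" for j
    proof -
      have "take i \<pi> ! j \<in> set (take i \<pi>)" using that i by (intro nth_mem) simp
      then have "\<pi> ! j \<in> {1..i}" using that unfolding pre by simp
      then show ?thesis by simp
    qed
    have nU: "\<pi> ! i \<notin> U"
    proof
      assume "\<pi> ! i \<in> U"
      then obtain j where j: "i = Suc j" "\<pi> ! j \<in> D" using W(8)[OF i] by blast
      then have "\<pi> ! i < \<pi> ! j" using W(7)[of j] i by simp
      then show False using before[of j] j v by simp
    qed
    have "f ` {d \<in> D. d \<le> i} = {u \<in> U. u \<le> i}"
    proof (rule equalityI; rule subsetI)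
      fix u assume "u \<in> f ` {d \<in> D. d \<le> i}"
      then show "u \<in> {u \<in> U. u \<le> i}" using sub by blast
    next
      fix u assume u: "u \<in> {u \<in> U. u \<le> i}"
      then have "1 \<le> u" using W(4) by auto
      then have "u \<in> {1..i}" using u by simp
      then have "u \<in> set (take i \<pi>)" by (simp only: pre)
      then obtain k where k: "k < i" "u = \<pi> ! k" using i by (auto simp: in_set_conv_nth)
      then have "k < length \<pi>" "\<pi> ! k \<in> U" using u i by simp_all
      then obtain j where j: "k = Suc j" "\<pi> ! j \<in> D" using W(8) by blast
      then have "f (\<pi> ! j) = u" using f(2)[rule_format, of j] j k i by simp
      moreover have "\<pi> ! j \<le> i" using before k j by simp
      ultimately show "u \<in> f ` {d \<in> D. d \<le> i}" using j by blast
    qed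
    then have "cnt U i = cnt D i" unfolding cnt_def using card_image[OF inj] by simp
    then show "Suc i \<notin> D \<and> Suc i \<notin> U \<and> cnt U i = cnt D i" using nD nU v by simp
  }
  assume c: "Suc i \<notin> D \<and> Suc i \<notin> U \<and> cnt U i = cnt D i"
  have "Suc i \<in> set \<pi>" using W(2) i by simp
  then obtain k where k: "k < length \<pi>" "\<pi> ! k = Suc i" by (auto simp: in_set_conv_nth)
  have "card (f ` {d \<in> D. d \<le> i}) = card {u \<in> U. u \<le> i}"
    using c card_image[OF inj] by (simp add: cnt_def)
  with sub have im: "f ` {d \<in> D. d \<le> i} = {u \<in> U. u \<le> i}"
    using W(10) by (intro card_subset_eq) auto
  have before: "\<pi> ! j < \<pi> ! k" if j: "j < k" for j
  proof (cases "\<pi> ! j \<in> D")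
    case False
    then show ?thesis using W(6)[OF j k(1)] c k(2) by simp
  next
    case True
    have u: "Suc j < length \<pi>" "\<pi> ! Suc j \<in> U" using W(7)[of j] True j k(1) by auto
    have "Suc j \<noteq> k" using u(2) c k(2) by auto
    then have "Suc j < k" using j by simp
    moreover have "\<pi> ! Suc j \<notin> D" using u(2) W(5) by auto
    ultimately have "\<pi> ! Suc j < \<pi> ! k" using W(6)[of "Suc j" k] k c by simp
    then have "\<pi> ! Suc j \<in> {u \<in> U. u \<le> i}" using u(2) k(2) by simp
    then have "\<pi> ! Suc j \<in> f ` {d \<in> D. d \<le> i}" by (simp only: im)
    then obtain d where d: "d \<in> D" "d \<le> i" "\<pi> ! Suc j = f d" by auto
    have "f (\<pi> ! j) = f d" using f(2)[rule_format, of j] True j k(1) d(3) by simp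
    then have "\<pi> ! j = d" using f(1) True d(1) unfolding bij_betw_def by (meson inj_onD)
    then show ?thesis using d k(2) by simp
  qed
  have "\<pi> ! k < \<pi> ! j" if "k < j" "j < length \<pi>" for j
    using woven_after_larger[OF w that] c k(2) by simp
  then have "\<pi> ! k = Suc k" using prefix_set_eq(2)[OF W(1,2) k(1)] before by blast
  then show "fixed_point_at \<pi> i" using k by (simp add: fixed_point_at_def)
qed

definition word_of :: "nat \<Rightarrow> nat set \<Rightarrow> nat set \<Rightarrow> step list" where
  "word_of n D U = map (\<lambda>v. if v \<in> D then Down else if v \<in> U then Up else Hor) [1..<Suc n]"

lemma length_word_of [simp]: "length (word_of n D U) = n"
  by (simp add: word_of_def)

lemma nth_word_of:
  "i < n \<Longrightarrow> word_of n D U ! i = (if Suc i \<in> D then Down else if Suc i \<in> U then Up else Hor)"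
  unfolding word_of_def by (subst nth_map) (simp_all del: upt_Suc)

lemma height_word_of:
  assumes "D \<subseteq> {1..n}" "U \<subseteq> {1..n}" "D \<inter> U = {}" "i \<le> n"
  shows "height (take i (word_of n D U)) = int (cnt U i) - int (cnt D i)"
  using assms(4)
proof (induction i)
  case 0
  have "0 \<notin> D" "0 \<notin> U" using assms by auto
  then show ?case by (simp add: cnt_0 height_def)
next
  case (Suc i)
  have fin: "finite D" "finite U" using assms finite_subset by blast+
  have "take (Suc i) (word_of n D U) = take i (word_of n D U) @ [word_of n D U ! i]"
    using Suc.prems by (simp add: take_Suc_conv_app_nth)
  then have "height (take (Suc i) (word_of n D U)) = height (take i (word_of n D U)) + rise (word_of n D U ! i)"
    by (simp add: height_def)
  moreover have "rise (word_of n D U ! i) = (if Suc i \<in> U then 1 else 0) - (if Suc i \<in> D then 1 else 0)"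
    using Suc.prems assms(3) by (auto simp: nth_word_of)
  ultimately show ?case using Suc fin by (simp add: cnt_Suc)
qed

lemma word_of_motzkin_iff:
  assumes "D \<subseteq> {1..n}" "U \<subseteq> {1..n}" "D \<inter> U = {}"
  shows "word_of n D U \<in> motzkin_paths n \<longleftrightarrow> ballot U D \<and> card U = card D"
proof -
  have c: "cnt U v = card U" "cnt D v = card D" if "n \<le> v" for v
    using assms that by (auto intro!: cnt_all)
  have b: "ballot U D \<longleftrightarrow> (\<forall>v\<le>n. cnt D v \<le> cnt U v)"
    unfolding ballot_def by (metis c le_refl nat_le_linear)
  have "height (word_of n D U) = int (card U) - int (card D)"
    using height_word_of[OF assms, of n] c[of n] by simp
  then show ?thesis
    unfolding motzkin_paths_def b using height_word_of[OF assms] by auto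
qed

lemma word_of_surj:
  fixes w :: "step list"
  defines "D \<equiv> {Suc i |i. i < length w \<and> w ! i = Down}" and "U \<equiv> {Suc i |i. i < length w \<and> w ! i = Up}"
  shows "D \<subseteq> {1..length w}" "U \<subseteq> {1..length w}" "D \<inter> U = {}" "word_of (length w) D U = w"
proof -
  show "D \<subseteq> {1..length w}" "U \<subseteq> {1..length w}" "D \<inter> U = {}" by (auto simp: D_def U_def)
  show "word_of (length w) D U = w"
  proof (rule nth_equalityI)
    fix i assume i: "i < length (word_of (length w) D U)"
    then have "i < length w" by simp
    then show "word_of (length w) D U ! i = w ! i"
      by (cases "w ! i") (auto simp: nth_word_of D_def U_def)
  qed simp
qed

lemma word_of_inj:
  assumes "D \<subseteq> {1..n}" "U \<subseteq> {1..n}" "D \<inter> U = {}" "D' \<subseteq> {1..n}" "U' \<subseteq> {1..n}" "D' \<inter> U' = {}"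
    and eq: "word_of n D U = word_of n D' U'"
  shows "D = D'" "U = U'"
proof -
  have *: "(v \<in> D \<longleftrightarrow> v \<in> D') \<and> (v \<in> U \<longleftrightarrow> v \<in> U')" if v: "v \<in> {1..n}" for v
  proof -
    obtain i where i: "v = Suc i" "i < n" using v by (cases v) auto
    have "word_of n D U ! i = word_of n D' U' ! i" using eq by simp
    moreover have "\<not> (v \<in> D \<and> v \<in> U)" "\<not> (v \<in> D' \<and> v \<in> U')" using assms by auto
    ultimately show ?thesis using i by (auto simp: nth_word_of split: if_splits)
  qed
  then show "D = D'" "U = U'" using assms by blast+
qed

lemma alpha_word_of: "alpha \<pi> = word_of (length \<pi>) (Dset \<pi>) (Uset \<pi>)"
  by (simp add: alpha_def word_of_def)

lemma alpha_bij: "bij_betw alpha (motzkin_perms n) (motzkin_paths n)"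
proof (rule bij_betw_imageI)
  show "inj_on alpha (motzkin_perms n)"
  proof (rule inj_onI)
    fix \<pi> \<rho> assume p: "\<pi> \<in> motzkin_perms n" and r: "\<rho> \<in> motzkin_perms n" and eq: "alpha \<pi> = alpha \<rho>"
    note P = motzkin_perms_woven[OF p] and R = motzkin_perms_woven[OF r]
    have "word_of n (Dset \<pi>) (Uset \<pi>) = word_of n (Dset \<rho>) (Uset \<rho>)"
      using eq P(2) R(2) by (simp add: alpha_word_of)
    then have "Dset \<pi> = Dset \<rho>" "Uset \<pi> = Uset \<rho>"
      using word_of_inj wovenD(3-5)[OF P(1)] wovenD(3-5)[OF R(1)] P(2) R(2) by metis+
    then show "\<pi> = \<rho>" using woven_unique P R by metis
  qed
  show "alpha ` motzkin_perms n = motzkin_paths n"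
  proof (intro equalityI subsetI)
    fix w assume "w \<in> alpha ` motzkin_perms n"
    then obtain \<pi> where p: "\<pi> \<in> motzkin_perms n" "w = alpha \<pi>" by blast
    note P = motzkin_perms_woven[OF p(1)]
    show "w \<in> motzkin_paths n"
      using p(2) word_of_motzkin_iff[OF wovenD(3-5)[OF P(1)]] woven_ballot[OF P(1)] P(2)
      by (simp add: alpha_word_of)
  next
    fix w assume w: "w \<in> motzkin_paths n"
    then have len: "length w = n" by (simp add: motzkin_paths_def)
    define D where "D = {Suc i |i. i < length w \<and> w ! i = Down}"
    define U where "U = {Suc i |i. i < length w \<and> w ! i = Up}"
    note W = word_of_surj[of w, folded D_def U_def]
    have "ballot U D" "card U = card D"
      using word_of_motzkin_iff[OF W(1-3)] W(4) w len by auto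
    then obtain \<pi> where p: "woven D U \<pi>" "length \<pi> = n"
      using woven_exists[OF W(1-3)] len by blast
    have "alpha \<pi> = w"
      using p W(4) len by (simp add: alpha_word_of woven_Dset(1)[OF p(1)] woven_Uset[OF p(1)])
    moreover have "\<pi> \<in> motzkin_perms n" using woven_motzkin_perms[OF p(1)] p(2) by simp
    ultimately show "w \<in> alpha ` motzkin_perms n" by blast
  qed
qed

text \<open>
  The height of the path before step \<open>Suc i\<close> is the difference of the counts of \<open>U\<close> and \<open>D\<close> up to \<open>i\<close>.
\<close>

lemma alpha_axis_hor_iff:
  assumes p: "\<pi> \<in> motzkin_perms n"
  shows "axis_hor_at (alpha \<pi>) i \<longleftrightarrow> fixed_point_at \<pi> i"
proof (cases "i < n")
  case True
  note P = motzkin_perms_woven[OF p] and W = wovenD[OF motzkin_perms_woven(1)[OF p]]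
  have "height (take i (alpha \<pi>)) = int (cnt (Uset \<pi>) i) - int (cnt (Dset \<pi>) i)"
    unfolding alpha_word_of by (rule height_word_of) (use W True P(2) in auto)
  then show ?thesis
    using True P(2) woven_fixed_point_iff[OF P(1), of i]
    by (auto simp: axis_hor_at_def alpha_word_of nth_word_of)
next
  case False
  then show ?thesis using motzkin_perms_woven(2)[OF p]
    by (simp add: axis_hor_at_def fixed_point_at_def alpha_word_of)
qed

lemma alpha_riordan_iff:
  assumes p: "\<pi> \<in> motzkin_perms n"
  shows "alpha \<pi> \<in> riordan_paths n \<longleftrightarrow> \<pi> \<in> riordan_perms n"
  using alpha_axis_hor_iff[OF p] alpha_bij[of n] p
  by (auto simp: riordan_paths_def riordan_perms_def bij_betw_def)

lemma alpha_inv_bij: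
  "bij_betw (alpha_inv n) (motzkin_paths n) (motzkin_perms n)"
  "bij_betw (alpha_inv n) (riordan_paths n) (riordan_perms n)"
  "bij_betw alpha (motzkin_perms n - riordan_perms n) (motzkin_paths n - riordan_paths n)"
proof -
  have sub: "riordan_perms n \<subseteq> motzkin_perms n" "riordan_paths n \<subseteq> motzkin_paths n"
    by (auto simp: riordan_perms_def riordan_paths_def)
  have inj: "inj_on alpha (motzkin_perms n)" and im: "alpha ` motzkin_perms n = motzkin_paths n"
    using alpha_bij[of n] by (auto simp: bij_betw_def)
  have imR: "alpha ` riordan_perms n = riordan_paths n"
  proof (intro equalityI subsetI)
    fix w assume "w \<in> alpha ` riordan_perms n"
    then obtain \<pi> where "\<pi> \<in> riordan_perms n" "w = alpha \<pi>" by blast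
    then show "w \<in> riordan_paths n" using alpha_riordan_iff[of \<pi> n] sub(1) by blast
  next
    fix w assume w: "w \<in> riordan_paths n"
    then have "w \<in> alpha ` motzkin_perms n" using sub(2) im by blast
    then obtain \<pi> where "\<pi> \<in> motzkin_perms n" "w = alpha \<pi>" by blast
    then show "w \<in> alpha ` riordan_perms n" using alpha_riordan_iff[of \<pi> n] w by blast
  qed
  show inv: "bij_betw (alpha_inv n) (motzkin_paths n) (motzkin_perms n)"
    unfolding alpha_inv_def by (rule bij_betw_inv_into[OF alpha_bij])
  have "alpha_inv n ` riordan_paths n = riordan_perms n"
    unfolding alpha_inv_def imR[symmetric] by (rule inv_into_image_cancel[OF inj sub(1)])
  then show "bij_betw (alpha_inv n) (riordan_paths n) (riordan_perms n)"
    by (rule bij_betw_subset[OF inv sub(2)])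
  have "alpha ` (motzkin_perms n - riordan_perms n) = alpha ` motzkin_perms n - alpha ` riordan_perms n"
    by (rule inj_on_image_set_diff[OF inj]) (use sub(1) in simp_all)
  then have "alpha ` (motzkin_perms n - riordan_perms n) = motzkin_paths n - riordan_paths n"
    unfolding im imR .
  then show "bij_betw alpha (motzkin_perms n - riordan_perms n) (motzkin_paths n - riordan_paths n)"
    by (rule bij_betw_subset[OF alpha_bij Diff_subset])
qed

section \<open>Raising the first horizontal step on the axis\<close>

lemma height_append [simp]: "height (xs @ ys) = height xs + height ys"
  by (simp add: height_def)

lemma height_Cons [simp]: "height (x # xs) = rise x + height xs" "height [] = 0"
  by (simp_all add: height_def)

lemma axis_hor_at_append:
  "axis_hor_at (xs @ ys) i \<longleftrightarrow>
     axis_hor_at xs i \<or> length xs \<le> i \<and> i < length xs + length ys \<and> ys ! (i - length xs) = Hor \<and>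
       height xs + height (take (i - length xs) ys) = 0"
  by (auto simp: axis_hor_at_def nth_append)

lemma nonneg_prefix_append:
  "(\<forall>i. 0 \<le> height (take i (xs @ ys))) \<longleftrightarrow>
     (\<forall>i. 0 \<le> height (take i xs)) \<and> (\<forall>i. 0 \<le> height xs + height (take i ys))"
proof (intro iffI conjI allI)
  fix i
  assume *: "\<forall>i. 0 \<le> height (take i (xs @ ys))"
  show "0 \<le> height (take i xs)" using *[rule_format, of "min i (length xs)"] by (simp add: min_def split: if_splits)
  show "0 \<le> height xs + height (take i ys)" using *[rule_format, of "length xs + i"] by simp
next
  fix i
  assume *: "(\<forall>i. 0 \<le> height (take i xs)) \<and> (\<forall>i. 0 \<le> height xs + height (take i ys))"
  show "0 \<le> height (take i (xs @ ys))"
    using * by (cases "i \<le> length xs") auto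
qed

lemma motzkin_paths_iff:
  "w \<in> motzkin_paths n \<longleftrightarrow> length w = n \<and> height w = 0 \<and> (\<forall>i. 0 \<le> height (take i w))"
proof -
  have "0 \<le> height (take i w)" if "\<forall>j\<le>length w. 0 \<le> height (take j w)" for i
    using that by (cases "i \<le> length w") auto
  then show ?thesis unfolding motzkin_paths_def by auto
qed

text \<open>
  The factors of a path around its first horizontal step on the axis, and equally the factors of a Riordan path
  around its last up-step from the axis.
\<close>

definition riordan_motzkin :: "step list \<Rightarrow> step list \<Rightarrow> bool" where
  "riordan_motzkin u v \<longleftrightarrow> u \<in> riordan_paths (length u) \<and> v \<in> motzkin_paths (length v)"

lemma non_riordan_decomp:
  assumes "w \<in> motzkin_paths n - riordan_paths n"
  shows "\<exists>u v. riordan_motzkin u v \<and> w = u @ Hor # v"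
proof -
  have w: "length w = n" "height w = 0" "\<forall>i. 0 \<le> height (take i w)"
    using assms by (auto simp: motzkin_paths_iff)
  have ex: "\<exists>i. axis_hor_at w i" using assms by (auto simp: riordan_paths_def)
  define i where "i = (LEAST i. axis_hor_at w i)"
  have i: "axis_hor_at w i" unfolding i_def using ex by (rule LeastI_ex)
  have min: "\<not> axis_hor_at w j" if "j < i" for j using not_less_Least that unfolding i_def by blast
  let ?u = "take i w" and ?v = "drop (Suc i) w"
  have eq: "w = ?u @ Hor # ?v" using i by (metis axis_hor_at_def id_take_nth_drop)
  have h: "height ?u = 0" using i by (simp add: axis_hor_at_def)
  have "height w = height ?u + height ?v" by (subst eq) simp
  then have hv: "height ?v = 0" using h w by simp
  have "\<forall>i. 0 \<le> height (take i (?u @ Hor # ?v))" using w(3) eq by simp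
  then have nn: "\<forall>i. 0 \<le> height (take i ?u)" "\<forall>i. 0 \<le> height (take i (Hor # ?v))"
    unfolding nonneg_prefix_append using h by simp_all
  have "0 \<le> height (take i ?v)" for i using nn(2)[rule_format, of "Suc i"] by simp
  moreover have "\<not> axis_hor_at ?u j" for j
  proof (cases "j < i")
    case True
    then show ?thesis using min[OF True] eq axis_hor_at_append[of ?u "Hor # ?v" j] by metis
  qed (simp add: axis_hor_at_def)
  ultimately have "riordan_motzkin ?u ?v"
    unfolding riordan_motzkin_def riordan_paths_def motzkin_paths_iff using h hv nn by auto
  then show ?thesis using eq by blast
qed

lemma riordan_motzkin_gamma:
  assumes "riordan_motzkin u v"
  shows "u @ Hor # v \<in> motzkin_paths (length u + Suc (length v)) - riordan_paths (length u + Suc (length v))"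
    "gamma (u @ Hor # v) = u @ Up # v @ [Down]"
    "u @ Up # v @ [Down] \<in> riordan_paths (Suc (length u + Suc (length v)))"
proof -
  have u: "height u = 0" "\<forall>i. 0 \<le> height (take i u)" "\<And>i. \<not> axis_hor_at u i"
    and v: "height v = 0" "\<forall>i. 0 \<le> height (take i v)"
    using assms by (auto simp: riordan_motzkin_def riordan_paths_def motzkin_paths_iff)
  have ax: "axis_hor_at (u @ Hor # v) (length u)"
    using u by (simp add: axis_hor_at_def)
  moreover have "length u \<le> j" if "axis_hor_at (u @ Hor # v) j" for j
    using that u(3) axis_hor_at_append[of u "Hor # v" j] by auto
  ultimately have "(LEAST i. axis_hor_at (u @ Hor # v) i) = length u" by (rule Least_equality)
  then show "gamma (u @ Hor # v) = u @ Up # v @ [Down]" by (simp add: gamma_def)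
  have "0 \<le> height u + height (take i (Hor # v))" for i using u v by (cases i) auto
  then have "u @ Hor # v \<in> motzkin_paths (length u + Suc (length v))"
    using u v nonneg_prefix_append[of u "Hor # v"] by (simp add: motzkin_paths_iff)
  then show "u @ Hor # v \<in> motzkin_paths (length u + Suc (length v)) - riordan_paths (length u + Suc (length v))"
    using ax by (auto simp: riordan_paths_def)
  have pre: "0 \<le> height u + height (take i (Up # v @ [Down]))" for i
  proof (cases i)
    case (Suc j)
    show ?thesis
    proof (cases "j \<le> length v")
      case True
      then show ?thesis using Suc u v by (simp add: add_nonneg_nonneg)
    next
      case False
      then have "take j (v @ [Down]) = v @ [Down]" by simp
      then show ?thesis using Suc u v by simp
    qed
  qed (use u in simp)
  have "\<not> axis_hor_at (u @ Up # v @ [Down]) i" for i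
  proof
    assume a: "axis_hor_at (u @ Up # v @ [Down]) i"
    define k where "k = i - length u"
    have k: "k < length (Up # v @ [Down])" "(Up # v @ [Down]) ! k = Hor" "height (take k (Up # v @ [Down])) = 0"
      using a u(1,3) unfolding axis_hor_at_append k_def by auto
    obtain j where j: "k = Suc j" using k(2) by (cases k) auto
    have "j < length v" using k j by (cases "j = length v") (auto simp: nth_append)
    then show False using k(3) j v(2) by (simp add: add_nonneg_eq_0_iff)
  qed
  then show "u @ Up # v @ [Down] \<in> riordan_paths (Suc (length u + Suc (length v)))"
    unfolding riordan_paths_def motzkin_paths_iff
    using pre u v nonneg_prefix_append[of u "Up # v @ [Down]"] by auto
qed

text \<open>
  If the left factor \<open>u\<close> were longer than \<open>u'\<close>, it would contain the displayed up-step of the other factorisation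
  and therefore end at positive height.
\<close>

lemma riordan_motzkin_length_le:
  assumes "riordan_motzkin u v" "riordan_motzkin u' v'" "u @ Up # v = u' @ Up # v'"
  shows "length u \<le> length u'"
proof (rule ccontr)
  assume "\<not> length u \<le> length u'"
  then have less: "length u' < length u" by simp
  have "take (length u) (u @ Up # v) = u" by simp
  then have "u = take (length u) (u' @ Up # v')" using assms(3) by simp
  then have "u = u' @ Up # take (length u - Suc (length u')) v'"
    using less by (simp add: take_Cons')
  then have "height u = height u' + 1 + height (take (length u - Suc (length u')) v')"
    by (metis add.assoc height_Cons(1) height_append rise.simps(1))
  moreover have "height u = 0" "height u' = 0" "0 \<le> height (take (length u - Suc (length u')) v')"
    using assms by (auto simp: riordan_motzkin_def riordan_paths_def motzkin_paths_iff)
  ultimately show False by simp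
qed

text \<open>
  The last step is a down-step because a horizontal one would lie on the axis.  Cut at the last visit to the axis before
  the end; the step there can only go up.
\<close>

lemma riordan_decomp:
  assumes "w \<in> riordan_paths (Suc n)"
  shows "\<exists>u v. riordan_motzkin u v \<and> w = u @ Up # v @ [Down]"
proof -
  have w: "length w = Suc n" "height w = 0" "\<And>i. 0 \<le> height (take i w)" and flat: "\<And>i. \<not> axis_hor_at w i"
    using assms by (auto simp: riordan_paths_def motzkin_paths_iff)
  obtain w' x where wx: "w = w' @ [x]" using w(1) by (metis length_Suc_conv_rev)
  have len: "length w' = n" using w wx by simp
  have h: "height w' + rise x = 0" using w(2) wx by simp
  have pos: "0 \<le> height w'" using w(3)[of n] wx len by simp
  have "x \<noteq> Hor"
  proof
    assume "x = Hor"
    then have "axis_hor_at w n" using h wx len by (simp add: axis_hor_at_def nth_append)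
    then show False using flat by blast
  qed
  then have x: "x = Down" "height w' = 1" using h pos by (cases x; simp)+
  \<comment> \<open>The last visit to the axis before the final down-step.\<close>
  define i where "i = (GREATEST i. i \<le> n \<and> height (take i w') = 0)"
  have i: "i \<le> n \<and> height (take i w') = 0"
    unfolding i_def by (rule GreatestI_nat[where k = 0 and b = n]) auto
  have imax: "j \<le> i" if "j \<le> n" "height (take j w') = 0" for j
    unfolding i_def by (rule Greatest_le_nat[of "\<lambda>i. i \<le> n \<and> height (take i w') = 0" j n]) (use that in auto)
  have "i \<noteq> n" using i x(2) len by auto
  then have lt: "i < n" using i by simp
  have tk: "take j w = take j w'" if "j \<le> n" for j using that wx len by simp
  have pos': "0 < height (take j w')" if "i < j" "j \<le> n" for j
  proof -
    have "height (take j w') \<noteq> 0" using imax[of j] that by auto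
    then show ?thesis using w(3)[of j] tk[OF that(2)] by simp
  qed
  let ?u = "take i w'" and ?v = "drop (Suc i) w'"
  have eq: "w' = ?u @ w' ! i # ?v" using lt len by (simp add: id_take_nth_drop)
  have "take (Suc i) w' = ?u @ [w' ! i]" using lt len by (simp add: take_Suc_conv_app_nth)
  then have "0 < rise (w' ! i)" using pos'[of "Suc i"] lt i by simp
  then have up: "w' ! i = Up" by (cases "w' ! i") auto
  have eq: "w' = ?u @ Up # ?v" using eq up by simp
  have "height w' = height ?u + (1 + height ?v)" by (subst eq) simp
  then have hv: "height ?v = 0" using x(2) i by simp
  have nv: "0 \<le> height (take j ?v)" for j
  proof (cases "Suc i + j \<le> n")
    case True
    have "take (Suc i + j) w' = ?u @ Up # take j ?v"
      by (subst eq, subst take_append) (use lt len in \<open>simp add: min_def\<close>)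
    then have "height (take (Suc i + j) w') = 1 + height (take j ?v)" using i by simp
    then show ?thesis using pos'[of "Suc i + j"] True by simp
  next
    case False
    then have "take j ?v = ?v" using len by simp
    then show ?thesis using hv by simp
  qed
  have "0 \<le> height (take j ?u)" for j
    using w(3)[of "min j i"] tk[of "min j i"] lt by (simp add: min.commute)
  moreover have "\<not> axis_hor_at ?u j" for j
    using flat[of j] axis_hor_at_append[of ?u "Up # ?v @ [x]" j] eq wx
    by (metis append.assoc append_Cons)
  ultimately have "riordan_motzkin ?u ?v"
    unfolding riordan_motzkin_def riordan_paths_def motzkin_paths_iff using i hv nv by auto
  moreover have "w = ?u @ Up # ?v @ [Down]" using wx x(1) eq by (metis append.assoc append_Cons)
  ultimately show ?thesis by blast
qed

lemma gamma_bij: "bij_betw gamma (motzkin_paths n - riordan_paths n) (riordan_paths (Suc n))"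
proof (rule bij_betw_imageI)
  show "inj_on gamma (motzkin_paths n - riordan_paths n)"
  proof (rule inj_onI)
    fix w w' assume w: "w \<in> motzkin_paths n - riordan_paths n" "w' \<in> motzkin_paths n - riordan_paths n"
      and eq: "gamma w = gamma w'"
    obtain u v where 1: "riordan_motzkin u v" "w = u @ Hor # v" using non_riordan_decomp[OF w(1)] by blast
    obtain u' v' where 2: "riordan_motzkin u' v'" "w' = u' @ Hor # v'" using non_riordan_decomp[OF w(2)] by blast
    have "u @ Up # v = u' @ Up # v'" using eq 1 2 riordan_motzkin_gamma(2) by simp
    moreover then have "length u = length u'" using riordan_motzkin_length_le 1 2 by (metis le_antisym)
    ultimately show "w = w'" using 1 2 by simp
  qed
  show "gamma ` (motzkin_paths n - riordan_paths n) = riordan_paths (Suc n)"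
  proof (intro equalityI subsetI)
    fix z assume "z \<in> gamma ` (motzkin_paths n - riordan_paths n)"
    then obtain w where w: "w \<in> motzkin_paths n - riordan_paths n" "z = gamma w" by blast
    obtain u v where 1: "riordan_motzkin u v" "w = u @ Hor # v" using non_riordan_decomp[OF w(1)] by blast
    have "length w = n" using w by (simp add: motzkin_paths_iff)
    then show "z \<in> riordan_paths (Suc n)" using riordan_motzkin_gamma(2,3)[OF 1(1)] w(2) 1(2) by simp
  next
    fix z assume z: "z \<in> riordan_paths (Suc n)"
    obtain u v where 1: "riordan_motzkin u v" "z = u @ Up # v @ [Down]" using riordan_decomp[OF z] by blast
    have "length z = Suc n" using z by (simp add: riordan_paths_def motzkin_paths_iff)
    then have "length u + Suc (length v) = n" using 1 by simp
    then show "z \<in> gamma ` (motzkin_paths n - riordan_paths n)"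
      using riordan_motzkin_gamma(1,2)[OF 1(1)] 1(2) by (metis imageI)
  qed
qed

section \<open>From Riordan permutations to pairs of rows\<close>

text \<open>
  The element of \<open>C\<close> following \<open>v\<close>, if there is one, belongs to \<open>U\<close>.
\<close>

definition next_in :: "nat set \<Rightarrow> nat set \<Rightarrow> nat \<Rightarrow> bool" where
  "next_in U C v \<longleftrightarrow> (\<forall>c\<in>C. v < c \<and> (\<forall>c'\<in>C. v < c' \<longrightarrow> c \<le> c') \<longrightarrow> c \<in> U)"

lemma next_in_iff:
  assumes "c \<in> C" "v < c" "\<And>e. e \<in> C \<Longrightarrow> v < e \<Longrightarrow> c \<le> e"
  shows "next_in U C v \<longleftrightarrow> c \<in> U"
proof
  assume "next_in U C v"
  then show "c \<in> U" using assms unfolding next_in_def by blast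
next
  assume c: "c \<in> U"
  show "next_in U C v"
    unfolding next_in_def
  proof (intro ballI impI)
    fix e assume e: "e \<in> C" "v < e \<and> (\<forall>c'\<in>C. v < c' \<longrightarrow> e \<le> c')"
    then have "e \<le> c" "c \<le> e" using assms by auto
    then show "e \<in> U" using c by simp
  qed
qed

text \<open>
  The letters outside \<open>D\<close> fall into blocks, each beginning with a letter of \<open>U\<close>; these are the last letters of
  the blocks.
\<close>

definition block_ends :: "nat \<Rightarrow> nat set \<Rightarrow> nat set \<Rightarrow> nat set" where
  "block_ends N D U = {c \<in> {1..N} - D. next_in U ({1..N} - D) c}"

text \<open>
  Blocks begun up to \<open>v\<close> are completed up to \<open>v\<close>, except for the last one if it continues after \<open>v\<close>.
\<close>

lemma cnt_block_ends:
  assumes U: "U \<subseteq> {1..N} - D" and first: "next_in U ({1..N} - D) 0"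
  shows "Suc (cnt (block_ends N D U) v) = cnt U v + (if next_in U ({1..N} - D) v then 1 else 0)"
proof (induction v)
  case 0
  have "0 \<notin> U" "0 \<notin> block_ends N D U" using U by (auto simp: block_ends_def)
  then show ?case using first by (simp add: cnt_0)
next
  case (Suc v)
  let ?C = "{1..N} - D"
  have fin: "finite U" "finite (block_ends N D U)" using U finite_subset by (auto simp: block_ends_def)
  show ?case
  proof (cases "Suc v \<in> ?C")
    case False
    then have "v < c \<longleftrightarrow> Suc v < c" if "c \<in> ?C" for c using that by (metis Suc_lessI Suc_lessD)
    then have "next_in U ?C (Suc v) \<longleftrightarrow> next_in U ?C v" unfolding next_in_def by blast
    moreover have "Suc v \<notin> U" "Suc v \<notin> block_ends N D U" using False U by (auto simp: block_ends_def)
    ultimately show ?thesis using Suc fin by (simp add: cnt_Suc)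
  next
    case True
    then have "next_in U ?C v \<longleftrightarrow> Suc v \<in> U" by (intro next_in_iff) auto
    moreover have "Suc v \<in> block_ends N D U \<longleftrightarrow> next_in U ?C (Suc v)" using True by (simp add: block_ends_def)
    ultimately show ?thesis using Suc fin by (simp add: cnt_Suc)
  qed
qed

lemma card_block_ends:
  assumes "U \<subseteq> {1..N} - D" "next_in U ({1..N} - D) 0"
  shows "card (block_ends N D U) = card U"
proof -
  have "next_in U ({1..N} - D) N" unfolding next_in_def by auto
  then have "cnt (block_ends N D U) N = cnt U N" using cnt_block_ends[OF assms, of N] by simp
  moreover have "cnt (block_ends N D U) N = card (block_ends N D U)"
    by (rule cnt_all) (auto simp: block_ends_def)
  moreover have "cnt U N = card U" by (rule cnt_all) (use assms(1) in auto)
  ultimately show ?thesis by simp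
qed

text \<open>
  The pairs of rows \<open>(a\<^sub>1 \<dots> a\<^sub>k, m\<^sub>1 \<dots> m\<^sub>k)\<close> that come from Riordan permutations.
\<close>

definition row_pairs :: "nat \<Rightarrow> (nat set \<times> nat set) set" where
  "row_pairs N = {(A, D). A \<union> D \<subseteq> {1..N} \<and> A \<inter> D = {} \<and> card A = card D \<and> ballot A D \<and>
     (\<forall>b\<in>{1..N} - (A \<union> D). \<exists>a\<in>A. b < a)}"

text \<open>
  The pairs \<open>(U, D)\<close> of Riordan permutations; the last condition excludes horizontal steps on the axis.
\<close>

definition riordan_pairs :: "nat \<Rightarrow> (nat set \<times> nat set) set" where
  "riordan_pairs N = {(U, D). D \<subseteq> {1..N} \<and> U \<subseteq> {1..N} - D \<and> ballot U D \<and> card U = card D \<and>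
     (\<forall>i. Suc i \<in> {1..N} - D - U \<longrightarrow> cnt U i \<noteq> cnt D i)}"

text \<open>
  A horizontal step before all up-steps would lie on the axis.
\<close>

lemma riordan_pairs_first:
  assumes "(U, D) \<in> riordan_pairs N"
  shows "next_in U ({1..N} - D) 0"
  unfolding next_in_def
proof (intro ballI impI, rule ccontr)
  fix c assume c: "c \<in> {1..N} - D" "0 < c \<and> (\<forall>c'\<in>{1..N} - D. 0 < c' \<longrightarrow> c \<le> c')" "c \<notin> U"
  have r: "D \<subseteq> {1..N}" "U \<subseteq> {1..N} - D" "ballot U D" "\<And>i. Suc i \<in> {1..N} - D - U \<Longrightarrow> cnt U i \<noteq> cnt D i"
    using assms by (auto simp: riordan_pairs_def)
  obtain i where i: "c = Suc i" using c(2) by (cases c) auto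
  have "{s \<in> U. s \<le> i} = {}"
  proof (rule ccontr)
    assume "{s \<in> U. s \<le> i} \<noteq> {}"
    then obtain s where s: "s \<in> U" "s \<le> i" by auto
    then have "s \<in> {1..N} - D" using r(2) by auto
    moreover then have "0 < s" by simp
    ultimately have "c \<le> s" using c(2) by blast
    then show False using s(2) i by simp
  qed
  then have "cnt U i = 0" by (simp add: cnt_def)
  moreover then have "cnt D i = 0" using r(3) by (metis ballot_def le_zero_eq)
  ultimately show False using r(4)[of i] c i by simp
qed

text \<open>
  If a new block begins after \<open>v\<close>, or nothing follows, \<open>A\<close> and \<open>U\<close> have the same count at \<open>v\<close>.  Otherwise the count of \<open>A\<close>
  is one less; but then the next letter outside \<open>D\<close> is a horizontal step, and its height is positive.
\<close>

lemma block_ends_row_pairs: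
  assumes "(U, D) \<in> riordan_pairs N"
  shows "(block_ends N D U, D) \<in> row_pairs N"
proof -
  let ?C = "{1..N} - D" and ?A = "block_ends N D U"
  have r: "D \<subseteq> {1..N}" "U \<subseteq> ?C" "ballot U D" "card U = card D"
    "\<And>i. Suc i \<in> ?C - U \<Longrightarrow> cnt U i \<noteq> cnt D i"
    using assms by (auto simp: riordan_pairs_def)
  have fin: "finite D" using r(1) finite_subset by blast
  note ce = cnt_block_ends[OF r(2) riordan_pairs_first[OF assms]]
  have "ballot ?A D" unfolding ballot_def
  proof
    fix v
    show "cnt D v \<le> cnt ?A v"
    proof (cases "next_in U ?C v")
      case True
      then show ?thesis using ce[of v] r(3) by (simp add: ballot_def)
    next
      case False
      then obtain c where c: "c \<in> ?C" "v < c" "\<And>c'. c' \<in> ?C \<Longrightarrow> v < c' \<Longrightarrow> c \<le> c'" "c \<notin> U"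
        unfolding next_in_def by blast
      then obtain i where i: "c = Suc i" by (cases c) auto
      have "cnt U v = cnt U i"
      proof (rule cnt_cong)
        fix s assume "s \<in> U"
        then have "s \<in> ?C" using r(2) by auto
        then have "v < s \<Longrightarrow> c \<le> s" using c(3) by blast
        then show "s \<le> v \<longleftrightarrow> s \<le> i" using c(2) i by linarith
      qed
      moreover have "cnt D v \<le> cnt D i" using c(2) i fin by (intro cnt_mono) auto
      moreover have "cnt D i \<le> cnt U i" using r(3) by (simp add: ballot_def)
      moreover have "cnt U i \<noteq> cnt D i" using r(5)[of i] c i by simp
      ultimately show ?thesis using ce[of v] False by simp
    qed
  qed
  moreover have "card ?A = card D"
    using card_block_ends[OF r(2) riordan_pairs_first[OF assms]] r(4) by simp
  moreover have "\<exists>a\<in>?A. b < a" if b: "b \<in> {1..N} - (?A \<union> D)" for b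
  proof -
    have bC: "b \<in> ?C" using b by auto
    then have "?C \<noteq> {}" by blast
    then have M: "Max ?C \<in> ?C" "b \<le> Max ?C"
      using Max_in[of ?C] Max_ge[OF _ bC] by (blast intro: finite_Diff finite_atLeastAtMost)+
    have "next_in U ?C (Max ?C)"
      unfolding next_in_def using Max_ge[of ?C] by (meson finite_Diff finite_atLeastAtMost leD)
    then have "Max ?C \<in> ?A" using M by (simp add: block_ends_def)
    moreover then have "b \<noteq> Max ?C" using b by auto
    ultimately show ?thesis using M(2) by (metis le_neq_implies_less)
  qed
  moreover have "?A \<union> D \<subseteq> {1..N}" "?A \<inter> D = {}" using r(1) by (auto simp: block_ends_def)
  ultimately show ?thesis unfolding row_pairs_def by blast
qed

lemma block_ends_inj:
  assumes "(U, D) \<in> riordan_pairs N" "(U', D) \<in> riordan_pairs N" "block_ends N D U = block_ends N D U'"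
  shows "U \<subseteq> U'"
proof
  let ?C = "{1..N} - D"
  fix c assume c: "c \<in> U"
  have cC: "c \<in> ?C" using c assms(1) by (auto simp: riordan_pairs_def)
  show "c \<in> U'"
  proof (cases "{p \<in> ?C. p < c} = {}")
    case True
    then have "\<forall>c'\<in>?C. c \<le> c'" by (auto simp: not_less)
    moreover have "0 < c" using cC by auto
    ultimately show ?thesis using riordan_pairs_first[OF assms(2)] cC unfolding next_in_def by blast
  next
    case False
    define p where "p = Max {p \<in> ?C. p < c}"
    have "p \<in> {p \<in> ?C. p < c}" unfolding p_def using False by (intro Max_in) auto
    then have p: "p \<in> ?C" "p < c" by auto
    have pmax: "q \<le> p" if "q \<in> ?C" "q < c" for q unfolding p_def using that by (intro Max_ge) auto
    have "c \<le> e" if "e \<in> ?C" "p < e" for e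
      using pmax[OF that(1)] that(2) by (meson leD not_le_imp_less)
    then have "next_in V ?C p \<longleftrightarrow> c \<in> V" for V
      using next_in_iff[OF cC p(2)] by blast
    then have "(p \<in> block_ends N D V) \<longleftrightarrow> c \<in> V" for V using p(1) by (simp add: block_ends_def)
    then show ?thesis using assms(3) c by blast
  qed
qed

text \<open>
  A letter begins a block if it is the first one outside \<open>D\<close> or its predecessor ends a block.  A horizontal
  step of this \<open>(U, D)\<close> on the axis would give \<open>A\<close> too small a count just before it.
\<close>

lemma block_ends_surj:
  assumes "(A, D) \<in> row_pairs N"
  shows "\<exists>U. (U, D) \<in> riordan_pairs N \<and> block_ends N D U = A"
proof -
  let ?C = "{1..N} - D"
  have r: "D \<subseteq> {1..N}" "A \<subseteq> ?C" "ballot A D" "card A = card D" "\<And>b. b \<in> ?C - A \<Longrightarrow> \<exists>a\<in>A. b < a"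
    using assms by (auto simp: row_pairs_def)
  define U where "U = {c \<in> ?C. \<forall>p\<in>?C. p < c \<and> (\<forall>q\<in>?C. q < c \<longrightarrow> q \<le> p) \<longrightarrow> p \<in> A}"
  have U: "U \<subseteq> ?C" by (auto simp: U_def)
  have first: "next_in U ?C 0"
    unfolding next_in_def
  proof (intro ballI impI)
    fix c assume c: "c \<in> ?C" "0 < c \<and> (\<forall>c'\<in>?C. 0 < c' \<longrightarrow> c \<le> c')"
    have "\<not> p < c" if "p \<in> ?C" for p
    proof -
      have "0 < p" using that by simp
      then show ?thesis using c(2) that by (meson leD)
    qed
    then show "c \<in> U" using c(1) unfolding U_def by blast
  qed
  have A: "block_ends N D U = A"
  proof -
    have "next_in U ?C c \<longleftrightarrow> c \<in> A" if c: "c \<in> ?C" for c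
    proof (cases "{e \<in> ?C. c < e} = {}")
      case True
      then have "next_in U ?C c" unfolding next_in_def by blast
      moreover have "c \<in> A"
      proof (rule ccontr)
        assume "c \<notin> A"
        then obtain a where "a \<in> A" "c < a" using r(5) c by blast
        then show False using True r(2) by blast
      qed
      ultimately show ?thesis by simp
    next
      case False
      define e where "e = Min {e \<in> ?C. c < e}"
      have "e \<in> {e \<in> ?C. c < e}" unfolding e_def using False by (intro Min_in) auto
      then have e: "e \<in> ?C" "c < e" by auto
      have emin: "e \<le> q" if "q \<in> ?C" "c < q" for q unfolding e_def using that by (intro Min_le) auto
      have "next_in U ?C c \<longleftrightarrow> e \<in> U" using next_in_iff[OF e emin] .
      moreover have "e \<in> U \<longleftrightarrow> c \<in> A"
      proof
        have prev: "q \<le> c" if "q \<in> ?C" "q < e" for q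
          using emin[OF that(1)] that(2) by (meson leD not_le_imp_less)
        assume "e \<in> U"
        then show "c \<in> A" using c e(2) prev unfolding U_def by blast
      next
        assume cA: "c \<in> A"
        have "p \<in> A" if p: "p \<in> ?C" "p < e" "\<forall>q\<in>?C. q < e \<longrightarrow> q \<le> p" for p
        proof -
          have "c \<le> p" using p(3) c e(2) by blast
          moreover have "\<not> c < p" using emin[OF p(1)] p(2) by (meson leD)
          ultimately show ?thesis using cA by simp
        qed
        then show "e \<in> U" using e(1) unfolding U_def by blast
      qed
      ultimately show ?thesis by simp
    qed
    then show ?thesis using r(2) unfolding block_ends_def by blast
  qed
  note ce = cnt_block_ends[OF U first, unfolded A]
  have "ballot U D"
    unfolding ballot_def
  proof
    fix v
    have "cnt A v \<le> cnt U v" using ce[of v] by (auto split: if_splits)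
    then show "cnt D v \<le> cnt U v" using r(3) by (meson ballot_def order_trans)
  qed
  moreover have "card U = card D" using card_block_ends[OF U first] A r(4) by simp
  moreover have "cnt U i \<noteq> cnt D i" if i: "Suc i \<in> ?C - U" for i
  proof -
    have "\<not> next_in U ?C i"
      using next_in_iff[of "Suc i" ?C i U] i by auto
    then have "Suc (cnt A i) = cnt U i" using ce[of i] by simp
    moreover have "cnt D i \<le> cnt A i" using r(3) by (simp add: ballot_def)
    ultimately show ?thesis by simp
  qed
  ultimately show ?thesis using A r(1) U unfolding riordan_pairs_def by blast
qed

lemma block_ends_bij:
  "bij_betw (\<lambda>(U, D). (block_ends N D U, D)) (riordan_pairs N) (row_pairs N)"
proof (rule bij_betw_imageI)
  show "inj_on (\<lambda>(U, D). (block_ends N D U, D)) (riordan_pairs N)"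
  proof (rule inj_onI, clarsimp)
    fix U U' D assume r: "(U, D) \<in> riordan_pairs N" "(U', D) \<in> riordan_pairs N"
      "block_ends N D U = block_ends N D U'"
    show "U = U'"
      using block_ends_inj[OF r] block_ends_inj[OF r(2,1) r(3)[symmetric]] by blast
  qed
  show "(\<lambda>(U, D). (block_ends N D U, D)) ` riordan_pairs N = row_pairs N"
  proof (intro equalityI subsetI)
    fix z assume "z \<in> (\<lambda>(U, D). (block_ends N D U, D)) ` riordan_pairs N"
    then show "z \<in> row_pairs N" using block_ends_row_pairs by auto
  next
    fix z assume z: "z \<in> row_pairs N"
    obtain A D where "z = (A, D)" by (cases z)
    then show "z \<in> (\<lambda>(U, D). (block_ends N D U, D)) ` riordan_pairs N"
      using block_ends_surj[of A D N] z by force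
  qed
qed

lemma riordan_perms_bij:
  "bij_betw (\<lambda>\<pi>. (Uset \<pi>, Dset \<pi>)) (riordan_perms N) (riordan_pairs N)"
proof (rule bij_betw_imageI)
  have fixed: "(\<forall>i. \<not> fixed_point_at \<pi> i) \<longleftrightarrow> (\<forall>i. Suc i \<in> {1..N} - D - U \<longrightarrow> cnt U i \<noteq> cnt D i)"
    if w: "woven D U \<pi>" "length \<pi> = N" for D U \<pi>
  proof -
    have "fixed_point_at \<pi> i \<longleftrightarrow> Suc i \<in> {1..N} - D - U \<and> cnt U i = cnt D i" for i
    proof (cases "i < N")
      case True
      then show ?thesis using woven_fixed_point_iff[OF w(1), of i] w(2) by simp
    next
      case False
      then show ?thesis using w(2) by (simp add: fixed_point_at_def)
    qed
    then show ?thesis by blast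
  qed
  show "inj_on (\<lambda>\<pi>. (Uset \<pi>, Dset \<pi>)) (riordan_perms N)"
  proof (rule inj_onI)
    fix \<pi> \<rho> assume p: "\<pi> \<in> riordan_perms N" "\<rho> \<in> riordan_perms N"
      and eq: "(Uset \<pi>, Dset \<pi>) = (Uset \<rho>, Dset \<rho>)"
    have m: "\<pi> \<in> motzkin_perms N" "\<rho> \<in> motzkin_perms N" using p by (simp_all add: riordan_perms_def)
    show "\<pi> = \<rho>"
      using woven_unique[of "Dset \<pi>" "Uset \<pi>" \<pi> \<rho>] motzkin_perms_woven[OF m(1)] motzkin_perms_woven[OF m(2)] eq
      by simp
  qed
  show "(\<lambda>\<pi>. (Uset \<pi>, Dset \<pi>)) ` riordan_perms N = riordan_pairs N"
  proof (intro equalityI subsetI)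
    fix z assume "z \<in> (\<lambda>\<pi>. (Uset \<pi>, Dset \<pi>)) ` riordan_perms N"
    then obtain \<pi> where p: "\<pi> \<in> riordan_perms N" "z = (Uset \<pi>, Dset \<pi>)" by blast
    have m: "\<pi> \<in> motzkin_perms N" "\<forall>i. \<not> fixed_point_at \<pi> i" using p(1) by (simp_all add: riordan_perms_def)
    note P = motzkin_perms_woven[OF m(1)]
    note W = wovenD[OF P(1), unfolded P(2)]
    have "Uset \<pi> \<subseteq> {1..N} - Dset \<pi>" using W(4,5) by blast
    then show "z \<in> riordan_pairs N"
      unfolding riordan_pairs_def p(2) mem_Collect_eq prod.case
      using W(3) woven_ballot[OF P(1)] fixed[OF P] m(2) by metis
  next
    fix z assume z: "z \<in> riordan_pairs N"
    obtain U D where UD: "z = (U, D)" by (cases z)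
    have r: "D \<subseteq> {1..N}" "U \<subseteq> {1..N} - D" "ballot U D" "card U = card D"
      "\<forall>i. Suc i \<in> {1..N} - D - U \<longrightarrow> cnt U i \<noteq> cnt D i"
      using z UD by (auto simp: riordan_pairs_def)
    then have "U \<subseteq> {1..N}" "D \<inter> U = {}" by auto
    then obtain \<pi> where p: "woven D U \<pi>" "length \<pi> = N"
      using woven_exists[OF r(1) _ _ r(3,4)] by metis
    have "\<pi> \<in> riordan_perms N"
      using woven_motzkin_perms[OF p(1)] fixed[OF p] r(5) p(2) by (simp add: riordan_perms_def)
    moreover have "z = (Uset \<pi>, Dset \<pi>)" using UD woven_Dset(1)[OF p(1)] woven_Uset[OF p(1)] by simp
    ultimately show "z \<in> (\<lambda>\<pi>. (Uset \<pi>, Dset \<pi>)) ` riordan_perms N" by blast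
  qed
qed

section \<open>Inserting the remaining letters\<close>

lemma row_insert_append:
  "\<forall>a\<in>set xs. a < b \<Longrightarrow> row_insert b xs = (xs @ [b], None)"
  by (induction xs) auto

lemma row_insert_bump:
  assumes "sorted_wrt (<) xs" "b \<notin> set xs" "\<not> (\<forall>a\<in>set xs. a < b)"
  shows "\<exists>zs. row_insert b xs = (zs, Some (Min {a \<in> set xs. b < a})) \<and> sorted_wrt (<) zs \<and>
    set zs = insert b (set xs - {Min {a \<in> set xs. b < a}})"
  using assms
proof (induction xs)
  case (Cons y ys)
  show ?case
  proof (cases "b < y")
    case True
    have "Min {a \<in> set (y # ys). b < a} = y"
      using True Cons.prems(1) by (intro Min_eqI) auto
    then show ?thesis using True Cons.prems by (auto simp: not_less)
  next
    case False
    then have y: "y < b" using Cons.prems(2) by (simp add: not_less le_less)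
    have "{a \<in> set (y # ys). b < a} = {a \<in> set ys. b < a}" using False by auto
    moreover obtain zs where zs: "row_insert b ys = (zs, Some (Min {a \<in> set ys. b < a}))"
      "sorted_wrt (<) zs" "set zs = insert b (set ys - {Min {a \<in> set ys. b < a}})"
      using Cons y by auto
    moreover have "Min {a \<in> set ys. b < a} \<in> {a \<in> set ys. b < a}"
      using Cons.prems y by (intro Min_in) (auto simp: not_less le_less)
    then have "y \<noteq> Min {a \<in> set ys. b < a}" using y by auto
    ultimately show ?thesis using False y Cons.prems(1) by auto
  qed
qed simp

lemma sorted_list_of_set_eqI: "sorted_wrt (<) zs \<Longrightarrow> set zs = S \<Longrightarrow> sorted_list_of_set S = zs"
  by (metis sorted_list_of_set.idem_if_sorted_distinct strict_sorted_iff)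

lemma sorted_list_of_set_insert_Max:
  assumes "finite A" "\<And>a. a \<in> A \<Longrightarrow> a < x"
  shows "sorted_list_of_set (insert x A) = sorted_list_of_set A @ [x]"
  by (rule sorted_list_of_set_eqI) (use assms in \<open>auto simp: sorted_wrt_append\<close>)

lemma row_insert_set_append:
  assumes "finite S" "\<forall>a\<in>S. a < b"
  shows "row_insert b (sorted_list_of_set S) = (sorted_list_of_set (insert b S), None)"
  using row_insert_append[of "sorted_list_of_set S" b] sorted_list_of_set_insert_Max[of S b] assms by simp

lemma row_insert_set_bump:
  assumes "finite S" "b \<notin> S" "\<not> (\<forall>a\<in>S. a < b)"
  defines "x \<equiv> Min {a \<in> S. b < a}"
  shows "row_insert b (sorted_list_of_set S) = (sorted_list_of_set (insert b (S - {x})), Some x)"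
proof -
  obtain zs where "row_insert b (sorted_list_of_set S) = (zs, Some x)" "sorted_wrt (<) zs"
    "set zs = insert b (S - {x})"
    using row_insert_bump[of "sorted_list_of_set S" b] assms by auto
  then show ?thesis using sorted_list_of_set_eqI by metis
qed

text \<open>
  Row insertion into a triple, in the only two forms that occur here: the letter is appended to the first row,
  or it bumps through all three rows and the last bumped entry is appended to the third.
\<close>

fun ins :: "nat \<Rightarrow> triple \<Rightarrow> triple" where
  "ins b (A, B, C) =
     (if \<forall>a\<in>A. a < b then (insert b A, B, C)
      else let x = Min {a \<in> A. b < a}; y = Min {z \<in> B. x < z}
           in (insert b (A - {x}), insert x (B - {y}), insert y C))"

text \<open>
  The tableaux present before the letters \<open>b\<^sub>i\<close> are inserted.
\<close>

fun rectangular :: "triple \<Rightarrow> bool" where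
  "rectangular (A, B, C) \<longleftrightarrow> card A = card B \<and> C = {}"

text \<open>
  The inverse of \<open>ins\<close>: the second row keeps its length during the insertions, so a first row longer than the second
  shows that the last letter has been appended there.
\<close>

fun pop :: "triple \<Rightarrow> triple \<times> nat" where
  "pop (A, B, C) =
     (if card B < card A then ((A - {Max A}, B, C), Max A)
      else let y = Max C; x = link B C; w = Max {a \<in> A. a < x}
           in ((insert x (A - {w}), insert y (B - {x}), C - {y}), w))"

declare ins.simps [simp del] pop.simps [simp del]

lemma pop_link:
  assumes st: "standard (A, B, C)" and ne: "C \<noteq> {}"
  defines "w \<equiv> Max {a \<in> A. a < link B C}"
  shows "w \<in> A" "w < link B C" "a \<in> A \<Longrightarrow> a < link B C \<Longrightarrow> a \<le> w"
proof -
  note d = standardD[OF st]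
  have "\<exists>a\<in>A. a < link B C"
    using ballot_below[of A B "link B C"] link_props[OF st ne] d st by (auto simp: standard_def)
  then have "w \<in> {a \<in> A. a < link B C}"
    unfolding w_def using d by (intro Max_in) auto
  then show "w \<in> A" "w < link B C" by auto
  show "a \<in> A \<Longrightarrow> a < link B C \<Longrightarrow> a \<le> w"
    unfolding w_def using d by (intro Max_ge) auto
qed

text \<open>
  One insertion, for a letter \<open>b\<close> larger than the one inserted before.  If \<open>b\<close> bumps \<open>x\<close> from row 1, then rows 1
  and 2 have equal length, because a longer row 1 would end with the previous letter.  Hence the ballot condition leaves an entry of row
  2 above \<open>x\<close>, which \<open>x\<close> bumps.  Bumping positions move to the right, so \<open>x\<close> exceeds the previous link and
  the entry bumped from row 2 exceeds all of row 3.
\<close>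

lemma ins_step:
  assumes st: "standard (A, B, C)" and b: "b \<notin> content (A, B, C)"
    and ok: "rectangular (A, B, C) \<or> snd (pop (A, B, C)) < b"
    and eq: "ins b (A, B, C) = (A', B', C')"
  shows "standard (A', B', C')" (is ?std)
    and "content (A', B', C') = insert b (content (A, B, C))" (is ?content)
    and "card B' = card B" (is ?card)
    and "\<not> rectangular (A', B', C')" (is ?not_rect)
    and "pop (A', B', C') = ((A, B, C), b)" (is ?pop)
    and "tab_insert b (tableau_of (A, B, C)) = tableau_of (A', B', C')" (is ?insert)
    and "\<not> (\<forall>a\<in>A. a < b) \<longrightarrow> C' \<noteq> {} \<and> link B' C' \<in> A \<and> b < link B' C' \<and>
      A' = insert b (A - {link B' C'}) \<and> (C \<noteq> {} \<longrightarrow> link B C < link B' C')" (is ?bump)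
proof -
  have main: "?std \<and> ?content \<and> ?card \<and> ?not_rect \<and> ?pop \<and> ?insert \<and> ?bump"
  proof (cases "\<forall>a\<in>A. a < b")
  case True
  note d = standardD[OF st]
  have b': "b \<notin> A" "b \<notin> B" "b \<notin> C" using b by (auto simp: content_def)
  have A': "A' = insert b A" and B': "B' = B" and C': "C' = C"
    using eq True by (auto simp: ins.simps)
  have cA: "cnt A' v = cnt A v + (if b \<le> v then 1 else 0)" for v
    using A' d b' by (simp add: cnt_insert)
  have "cnt B' v \<le> cnt A' v" "cnt C' v \<le> cnt B' v" for v
    using cA[of v] d(7,8)[of v] B' C' by auto
  then have st': "standard (A', B', C')"
    using d b' unfolding standard_def ballot_def A' B' C' by auto
  have card: "card A' = Suc (card A)" using A' d b' by simp
  have "Max A' = b" unfolding A' using True d by (intro Max_eqI) (auto intro: less_imp_le)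
  then have "pop (A', B', C') = ((A, B, C), b)"
    using card d(9) A' B' C' b' by (auto simp: pop.simps insert_absorb)
  moreover have "tab_insert b (tableau_of (A, B, C)) = tableau_of (A', B', C')"
  proof (cases "A = {}")
    case True
    then have "B = {}" "C = {}" using standard_empty[OF st] by auto
    then show ?thesis using True A' B' C'
      by (simp add: tableau_of_def drop_empty_def)
  next
    case False
    show ?thesis
      unfolding B' C' tableau_of_cases[OF st] tableau_of_cases[OF st'[unfolded B' C']]
      using False A' row_insert_set_append[OF d(1) True] by auto
  qed
  ultimately show ?thesis
    using st' True card d(9) by (auto simp: content_def A' B' C')
next
  case False
  let ?x = "Min {a \<in> A. b < a}"
  let ?y = "Min {z \<in> B. ?x < z}"
  note d = standardD[OF st]
  have b': "b \<notin> A" "b \<notin> B" "b \<notin> C" using b by (auto simp: content_def)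
  have A': "A' = insert b (A - {?x})" and B': "B' = insert ?x (B - {?y})" and C': "C' = insert ?y C"
    using eq False by (auto simp: ins.simps Let_def split: if_splits)
  have "?x \<in> {a \<in> A. b < a}"
    using False b' d by (intro Min_in) (auto simp: not_less le_less)
  then have x: "?x \<in> A" "b < ?x" by auto
  then have x': "?x \<notin> B" "?x \<notin> C" using d(4,5) by blast+
  have xmin: "?x \<le> a" if "a \<in> A" "b < a" for a using that d by (intro Min_le) auto
  have eqc: "card A = card B"
  proof (rule ccontr)
    assume "card A \<noteq> card B"
    then have "card B < card A" using d(9) by simp
    then have "Max A < b" using ok by (auto simp: pop.simps)
    then show False using x d Max_ge[OF d(1) x(1)] by simp
  qed
  \<comment> \<open>Up to the bumped entry \<open>x\<close> itself, row 1 has a surplus over row 2.\<close>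
  have pre: "cnt B ?x < cnt A ?x"
  proof -
    have "cnt B ?x = cnt B (?x - 1)"
      by (rule cnt_cong) (use x' in \<open>auto simp: le_less\<close>)
    also have "\<dots> \<le> cnt A (?x - 1)" by (rule d(7))
    also have "\<dots> < cnt A ?x" using x d by (intro cnt_less[of _ ?x]) auto
    finally show ?thesis .
  qed
  have "{z \<in> B. ?x < z} \<noteq> {}"
  proof
    assume "{z \<in> B. ?x < z} = {}"
    then have "cnt B ?x = card B" by (intro cnt_all) (auto simp: not_less)
    then show False using pre eqc cnt_le_card[OF d(1), of ?x] by simp
  qed
  then have "?y \<in> {z \<in> B. ?x < z}" using d(2) by (intro Min_in) auto
  then have y: "?y \<in> B" "?x < ?y" by auto
  then have y': "?y \<notin> A" "?y \<notin> C" using d(4,6) by blast+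
  have ymin: "?y \<le> z" if "z \<in> B" "?x < z" for z using that d by (intro Min_le) auto
  have lk: "link B C < ?x" if C: "C \<noteq> {}"
  proof -
    have "Max {a \<in> A. a < link B C} < b"
      using ok C eqc by (auto simp: pop.simps Let_def)
    then have "\<not> ?x < link B C" using pop_link(3)[OF st C x(1)] x(2) by linarith
    moreover have "link B C \<noteq> ?x" using link_props(1)[OF st C] x' by auto
    ultimately show ?thesis by simp
  qed
  have yC: "\<forall>c\<in>C. c < ?y"
  proof
    fix c assume c: "c \<in> C"
    then have C: "C \<noteq> {}" by auto
    have "\<not> ?y < Max C" using link_props(3)[OF st C y(1)] lk[OF C] y(2) by linarith
    moreover have "c \<le> Max C" using c d by simp
    ultimately have "c \<le> ?y" by simp
    then show "c < ?y" using c y' by (metis le_neq_implies_less)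
  qed
  have cA: "cnt A' v + (if ?x \<le> v then 1 else 0) = cnt A v + (if b \<le> v then 1 else 0)" for v
    using A' d b' x cnt_insert[of "A - {?x}" b v] cnt_remove[of A ?x v] by simp
  note bump = bump_into_last_cnt[OF d(2,3,8) y(1) y'(2) bspec[OF yC] x'(1) y(2), folded B']
  note cB = bump(1) and CB = bump(2)[folded C']
  have "cnt B' v \<le> cnt A' v" for v
  proof (cases "?x \<le> v \<and> v < ?y")
    case True
    have "cnt B v = cnt B ?x"
      by (rule cnt_cong) (use True ymin in \<open>meson le_less_trans less_le_not_le not_le_imp_less\<close>)
    also have "\<dots> < cnt A ?x" by (rule pre)
    also have "\<dots> \<le> cnt A v" using True d by (intro cnt_mono) auto
    finally show ?thesis using True cA[of v] cB[of v] x(2) by auto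
  next
    case False
    then show ?thesis using cA[of v] cB[of v] d(7)[of v] x(2) y(2) by (auto split: if_splits)
  qed
  moreover note CB
  ultimately have st': "standard (A', B', C')"
    using d b' x x' y y' unfolding standard_def ballot_def A' B' C' by auto
  have cont: "content (A', B', C') = insert b (content (A, B, C))"
    using b' x y unfolding content_def A' B' C' by auto
  have cards: "card A' = card A" "card B' = card B"
    using A' B' d b' x x' y by (auto simp: card_gt_0_iff intro!: Suc_pred)
  have M: "Max C' = ?y"
    unfolding C' using d yC by (intro Max_eqI) (auto intro: less_imp_le)
  have L: "link B' C' = ?x"
    unfolding link_def M B' using d y ymin by (intro Max_eqI) (auto simp: not_less[symmetric])
  have W: "Max {a \<in> A'. a < ?x} = b"
    unfolding A' using d x xmin by (intro Max_eqI) (auto simp: not_less[symmetric])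
  have "pop (A', B', C') = ((A, B, C), b)"
    using cards eqc M L W A' B' C' b' x x' y y' by (auto simp: pop.simps Let_def)
  moreover have "tab_insert b (tableau_of (A, B, C)) = tableau_of (A', B', C')"
  proof -
    have ne: "A \<noteq> {}" "B \<noteq> {}" "A' \<noteq> {}" "B' \<noteq> {}" "C' \<noteq> {}" using x y A' B' C' by auto
    have nB: "\<not> (\<forall>z\<in>B. z < ?x)" using y by (meson less_asym)
    note ri = row_insert_set_bump[OF d(1) b'(1) False, folded A']
      row_insert_set_bump[OF d(2) x'(1) nB, folded B'] row_insert_set_append[OF d(3) yC, folded C']
    show ?thesis
      unfolding tableau_of_cases[OF st] tableau_of_cases[OF st']
      using ne ri by (auto simp: C')
  qed
  ultimately show ?thesis
    using st' cont cards L x lk A' C' by auto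
qed
  show ?std ?content ?card ?not_rect ?pop ?insert ?bump using main by blast+
qed

text \<open>
  The reverse of the previous lemma; the letters that are popped one after another decrease.
\<close>

lemma pop_step:
  assumes st: "standard (A, B, C)" and nr: "\<not> rectangular (A, B, C)"
    and eq: "pop (A, B, C) = ((A', B', C'), b)"
  shows "standard (A', B', C')" (is ?std)
    and "b \<in> content (A, B, C)" (is ?mem)
    and "content (A', B', C') = content (A, B, C) - {b}" (is ?content)
    and "rectangular (A', B', C') \<or> snd (pop (A', B', C')) < b" (is ?decr)
    and "ins b (A', B', C') = (A, B, C)" (is ?ins)
proof -
  have main: "?std \<and> ?mem \<and> ?content \<and> ?decr \<and> ?ins"
  proof (cases "card B < card A")
  case True
  note d = standardD[OF st]
  have b: "b = Max A" and A': "A' = A - {b}" and B': "B' = B" and C': "C' = C"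
    using eq True by (auto simp: pop.simps)
  have "A \<noteq> {}" using True by auto
  then have "b \<in> A" and bmax: "\<And>a. a \<in> A \<Longrightarrow> a \<le> b" using d(1) b by simp_all
  then have bA: "b \<in> A" "b \<notin> B" "b \<notin> C" using d(4,5) by blast+
  have lt: "\<forall>a\<in>A'. a < b" using A' bmax by (auto simp: le_neq_implies_less)
  have cA: "cnt A v = cnt A' v + (if b \<le> v then 1 else 0)" for v
    using A' d bA cnt_remove[of A b v] by simp
  have "cnt B' v \<le> cnt A' v" for v
  proof (cases "b \<le> v")
    case le: True
    then have "cnt A v = card A" using bmax by (intro cnt_all) (meson order_trans)
    then show ?thesis using le cA[of v] B' True cnt_le_card[OF d(2), of v] by auto
  qed (use cA[of v] B' d(7)[of v] in auto)
  moreover have "cnt C' v \<le> cnt B' v" for v using d(8) B' C' by simp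
  ultimately have st': "standard (A', B', C')"
    using d unfolding standard_def ballot_def A' B' C' by auto
  note d' = standardD[OF st']
  have "rectangular (A', B', C') \<or> snd (pop (A', B', C')) < b"
  proof (cases "card B' < card A'")
    case True
    then have "Max A' \<in> A'" using d' by (intro Max_in) auto
    then show ?thesis using True lt by (simp add: pop.simps)
  next
    case False
    then have "card A' = card B'" using d' by simp
    moreover have "snd (pop (A', B', C')) < b" if "C' \<noteq> {}"
      using False pop_link(1)[OF st' that] lt by (simp add: pop.simps Let_def)
    ultimately show ?thesis by auto
  qed
  moreover have "ins b (A', B', C') = (A, B, C)"
    using lt A' B' C' bA by (auto simp: ins.simps)
  ultimately show ?thesis
    using st' bA by (auto simp: content_def A' B' C')
next
  case False
  let ?y = "Max C" and ?x = "link B C"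
  note d = standardD[OF st]
  have eqc: "card A = card B" using False d(9) by simp
  then have ne: "C \<noteq> {}" using nr by simp
  have b: "b = Max {a \<in> A. a < ?x}" and A': "A' = insert ?x (A - {b})"
    and B': "B' = insert ?y (B - {?x})" and C': "C' = C - {?y}"
    using eq False by (auto simp: pop.simps Let_def)
  note l = link_props[OF st ne] and w = pop_link[OF st ne, folded b]
  have y: "?y \<in> C" and ymax: "\<And>c. c \<in> C \<Longrightarrow> c \<le> ?y" using d(3) ne by simp_all
  then have y': "?y \<notin> A" "?y \<notin> B" using d(5,6) by blast+
  have b': "b \<notin> B" "b \<notin> C" using w(1) d(4,5) by blast+
  have cA: "cnt A' v + (if b \<le> v then 1 else 0) = cnt A v + (if ?x \<le> v then 1 else 0)" for v
    using A' d w l cnt_insert[of "A - {b}" ?x v] cnt_remove[of A b v] by simp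
  note cB = move_link_cnt(1)[OF st ne, folded B'] and CB = move_link_cnt(2)[OF st ne, folded B' C']
  have "cnt B' v \<le> cnt A' v" for v
  proof (cases "b \<le> v \<and> v < ?x")
    case True
    have "cnt B v < cnt B ?x" using True d l by (intro cnt_less[of _ ?x]) auto
    also have "\<dots> \<le> cnt A ?x" by (rule d(7))
    also have "cnt A ?x = cnt A v"
      by (rule cnt_cong) (metis True l(4) le_neq_implies_less less_imp_le order_trans w(3))
    finally show ?thesis using True cA[of v] cB[of v] l(2) by auto
  next
    case False
    then show ?thesis using cA[of v] cB[of v] d(7)[of v] w(2) l(2) by (auto split: if_splits)
  qed
  moreover note CB
  ultimately have st': "standard (A', B', C')"
    using d l w y y' b' unfolding standard_def ballot_def A' B' C' by auto
  have cards: "card A' = card A" "card B' = card B"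
    using A' B' d w l y' by (auto simp: card_gt_0_iff intro!: Suc_pred)
  have "snd (pop (A', B', C')) < b" if ne': "C' \<noteq> {}"
  proof -
    have "Max C' \<le> ?y" using C' ne' d(3) ymax by (metis Diff_iff Max_in finite_Diff)
    note l' = link_props[OF st' ne'] and w' = pop_link[OF st' ne']
    let ?w = "Max {a \<in> A'. a < link B' C'}"
    have "link B' C' \<noteq> ?y" using l'(2) \<open>Max C' \<le> ?y\<close> by auto
    then have "link B' C' \<in> B" using l'(1) B' by auto
    then have "link B' C' \<le> ?x" using l(3) l'(2) \<open>Max C' \<le> ?y\<close> by (meson less_le_trans)
    then have "?w < ?x" using w'(2) by (meson less_le_trans)
    moreover then have "?w \<in> A" "?w \<noteq> b" using w'(1) A' w by auto
    ultimately have "?w < b" using w(3) by (metis le_neq_implies_less)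
    then show ?thesis using cards eqc by (simp add: pop.simps Let_def)
  qed
  then have "rectangular (A', B', C') \<or> snd (pop (A', B', C')) < b" using cards eqc by auto
  moreover have "ins b (A', B', C') = (A, B, C)"
  proof -
    have "\<not> (\<forall>a\<in>A'. a < b)" using A' w(2) by auto
    moreover have "Min {a \<in> A'. b < a} = ?x"
      unfolding A' using d w by (intro Min_eqI) (auto simp: not_less[symmetric])
    moreover have "Min {z \<in> B'. ?x < z} = ?y"
      unfolding B' using d l by (intro Min_eqI) (auto simp: not_less[symmetric])
    ultimately show ?thesis using A' B' C' w l y y' b'
      by (auto simp: ins.simps Let_def)
  qed
  ultimately show ?thesis
    using st' w l y y' b' by (auto simp: content_def A' B' C')
qed
  show ?std ?mem ?content ?decr ?ins using main by blast+
qed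

lemma fold_ins:
  assumes "standard T\<^sub>0" "rectangular T\<^sub>0" "sorted_wrt (<) bs" "set bs \<inter> content T\<^sub>0 = {}"
  shows "standard (fold ins bs T\<^sub>0)" (is ?std)
    and "content (fold ins bs T\<^sub>0) = content T\<^sub>0 \<union> set bs" (is ?content)
    and "rectangular (fold ins bs T\<^sub>0) \<longleftrightarrow> bs = []" (is ?rect)
    and "bs \<noteq> [] \<longrightarrow> pop (fold ins bs T\<^sub>0) = (fold ins (butlast bs) T\<^sub>0, last bs)" (is ?pop)
    and "fold tab_insert bs (tableau_of T\<^sub>0) = tableau_of (fold ins bs T\<^sub>0)" (is ?insert)
proof -
  have "?std \<and> ?content \<and> ?rect \<and> ?pop \<and> ?insert"
    using assms(3,4)
  proof (induction bs rule: rev_induct)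
    case Nil
    then show ?case using assms by simp
  next
    case (snoc b bs)
    let ?T = "fold ins bs T\<^sub>0"
    have IH: "standard ?T" "content ?T = content T\<^sub>0 \<union> set bs" "rectangular ?T \<longleftrightarrow> bs = []"
      "bs \<noteq> [] \<Longrightarrow> pop ?T = (fold ins (butlast bs) T\<^sub>0, last bs)"
      "fold tab_insert bs (tableau_of T\<^sub>0) = tableau_of ?T"
      using snoc by (auto simp: sorted_wrt_append)
    have lt: "\<forall>c\<in>set bs. c < b" using snoc.prems by (auto simp: sorted_wrt_append)
    then have nb: "b \<notin> content ?T" using snoc.prems IH(2) by auto
    have ok: "rectangular ?T \<or> snd (pop ?T) < b"
      using IH(3,4) lt by (cases "bs = []") auto
    obtain A B C where T: "?T = (A, B, C)" by (cases ?T)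
    obtain A' B' C' where T': "ins b (A, B, C) = (A', B', C')" by (cases "ins b (A, B, C)")
    note S = ins_step[OF IH(1)[unfolded T] nb[unfolded T] ok[unfolded T] T']
    show ?case using S IH T T' by simp
  qed
  then show ?std ?content ?rect ?pop ?insert by blast+
qed

lemma last_max:
  assumes "sorted_wrt (<) bs" "(b :: nat) \<in> set bs"
  shows "b \<le> last bs"
  using assms by (induction bs rule: rev_induct) (auto simp: sorted_wrt_append)

text \<open>
  Popping reads off the inserted letters from the last to the first and stops at a rectangular tableau.
\<close>

lemma fold_ins_inj:
  assumes "standard S" "rectangular S" "sorted_wrt (<) bs" "set bs \<inter> content S = {}"
    and "standard T" "rectangular T" "sorted_wrt (<) cs" "set cs \<inter> content T = {}"
    and "fold ins bs S = fold ins cs T"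
  shows "S = T"
  using assms
proof (induction bs arbitrary: cs rule: rev_induct)
  case Nil
  then have "rectangular (fold ins cs T)" by simp
  then have "cs = []" using fold_ins(3)[of T cs] Nil by blast
  then show ?case using Nil by simp
next
  case (snoc b bs)
  have "\<not> rectangular (fold ins (bs @ [b]) S)" using fold_ins(3)[of S "bs @ [b]"] snoc by blast
  then have ne: "cs \<noteq> []" using snoc by (metis fold_simps(1))
  have "fold ins bs S = fold ins (butlast cs) T"
    using fold_ins(4)[of S "bs @ [b]"] fold_ins(4)[of T cs] snoc.prems ne by simp
  moreover have "sorted_wrt (<) bs" using snoc.prems by (simp add: sorted_wrt_append)
  moreover have "sorted_wrt (<) (butlast cs)"
    using snoc.prems ne by (metis append_butlast_last_id sorted_wrt_append)
  moreover have "set (butlast cs) \<inter> content T = {}" using snoc.prems by (auto dest: in_set_butlastD)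
  ultimately show ?case using snoc.IH[of "butlast cs"] snoc.prems by simp
qed

lemma fold_ins_surj:
  assumes "standard T"
  shows "\<exists>T\<^sub>0 bs. standard T\<^sub>0 \<and> rectangular T\<^sub>0 \<and> sorted_wrt (<) bs \<and> set bs \<inter> content T\<^sub>0 = {} \<and>
    fold ins bs T\<^sub>0 = T"
  using assms
proof (induction "card (content T)" arbitrary: T rule: less_induct)
  case less
  obtain A B C where T: "T = (A, B, C)" by (cases T)
  have st: "standard (A, B, C)" using less T by simp
  show ?case
  proof (cases "rectangular T")
    case True
    then show ?thesis using less.prems by (intro exI[of _ T] exI[of _ "[]"]) simp
  next
    case False
    then have nr: "\<not> rectangular (A, B, C)" using T by simp
    obtain A' B' C' b where p: "pop (A, B, C) = ((A', B', C'), b)" by (metis prod.exhaust)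
    let ?T' = "(A', B', C')"
    note P = pop_step[OF st nr p]
    have fin: "finite (content T)" using standardD[OF st] by (simp add: T content_def)
    have "card (content ?T') < card (content T)"
      using P(2,3) fin T by (metis card_Diff1_less)
    then obtain T\<^sub>0 bs where R: "standard T\<^sub>0" "rectangular T\<^sub>0" "sorted_wrt (<) bs"
      "set bs \<inter> content T\<^sub>0 = {}" "fold ins bs T\<^sub>0 = ?T'"
      using less.hyps P(1) by blast
    note F = fold_ins[OF R(1-4), unfolded R(5)]
    have nb: "b \<notin> content T\<^sub>0 \<union> set bs" using F(2) P(3) by auto
    have "\<forall>c\<in>set bs. c < b"
    proof (cases "bs = []")
      case False
      then have "last bs < b" using F(3,4) P(4) by auto
      moreover have "c \<le> last bs" if "c \<in> set bs" for c
        using last_max[OF R(3) that] .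
      ultimately show ?thesis by (meson le_less_trans)
    qed simp
    then have "sorted_wrt (<) (bs @ [b])" using R(3) by (simp add: sorted_wrt_append)
    moreover have "set (bs @ [b]) \<inter> content T\<^sub>0 = {}" using R(4) nb by auto
    moreover have "fold ins (bs @ [b]) T\<^sub>0 = T" using R(5) P(5) T by simp
    ultimately show ?thesis using R(1,2) by blast
  qed
qed

text \<open>
  The invariant that locates the old maximum \<open>M\<close> of row 1: either it is still there, or it has been the last
  entry to be bumped, and then it is the link.  Entries of row 1 above \<open>M\<close> are inserted letters, and later
  letters do not bump them.
\<close>

lemma fold_ins_Max:
  assumes T\<^sub>0: "standard (A\<^sub>0, B\<^sub>0, {})" "rectangular (A\<^sub>0, B\<^sub>0, {})" "A\<^sub>0 \<noteq> {}"
    and bs: "sorted_wrt (<) bs" "set bs \<inter> content (A\<^sub>0, B\<^sub>0, {}) = {}"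
    and eq: "fold ins bs (A\<^sub>0, B\<^sub>0, {}) = (A, B, C)"
  shows "(Max A\<^sub>0 \<in> A \<or> C \<noteq> {} \<and> link B C = Max A\<^sub>0) \<and> (C \<noteq> {} \<longrightarrow> link B C \<le> Max A\<^sub>0) \<and>
    (\<forall>a\<in>A. a \<le> Max A\<^sub>0 \<or> a \<in> set bs)"
  using bs eq
proof (induction bs arbitrary: A B C rule: rev_induct)
  case Nil
  then show ?case using T\<^sub>0 standardD(1)[OF T\<^sub>0(1)] by auto
next
  case (snoc b bs)
  let ?T\<^sub>0 = "(A\<^sub>0, B\<^sub>0, {})" and ?M = "Max A\<^sub>0"
  obtain A' B' C' where T: "fold ins bs ?T\<^sub>0 = (A', B', C')" by (metis prod.exhaust)
  have bs: "sorted_wrt (<) bs" "set bs \<inter> content ?T\<^sub>0 = {}" and lt: "\<And>c. c \<in> set bs \<Longrightarrow> c < b"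
    using snoc.prems by (auto simp: sorted_wrt_append)
  note F = fold_ins[OF T\<^sub>0(1,2) bs, unfolded T]
  have nb: "b \<notin> content (A', B', C')" using F(2) snoc.prems(2) lt by auto
  have ok: "rectangular (A', B', C') \<or> snd (pop (A', B', C')) < b"
    using F(3,4) lt by (cases "bs = []") auto
  have i: "ins b (A', B', C') = (A, B, C)" using snoc.prems(3) T by simp
  note S = ins_step[OF F(1) nb ok i]
  note IH = snoc.IH[OF bs T]
  show ?case
  proof (cases "\<forall>a\<in>A'. a < b")
    case True
    then have "A = insert b A'" "B = B'" "C = C'" using i by (auto simp: ins.simps)
    then show ?thesis using IH by auto
  next
    case False
    let ?x = "link B C"
    have x: "C \<noteq> {}" "A = insert b (A' - {?x})" "C' \<noteq> {} \<Longrightarrow> link B' C' < ?x" "?x \<in> A'" "b < ?x"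
      using mp[OF S(7) False] by auto
    have "?x \<notin> set bs" using lt x(5) by (meson less_asym)
    then have "?x \<le> ?M" using IH x(4) by auto
    moreover have "?M \<in> A'"
    proof (rule ccontr)
      assume "?M \<notin> A'"
      then have "C' \<noteq> {}" "link B' C' = ?M" using IH by auto
      then show False using x(3) \<open>?x \<le> ?M\<close> by simp
    qed
    ultimately show ?thesis using x(1,2) IH by auto
  qed
qed

text \<open>
  Only the largest letter \<open>b\<close> matters.  If row 1 is longer than row 2, it ends with \<open>b\<close>, and \<open>b\<close> is smaller than
  the old maximum if and only if this maximum has left row 1 and become the link.  If the two rows have equal length, \<open>b\<close> has
  bumped an entry that is at most the old maximum.
\<close>

lemma fold_ins_admissible_iff:
  assumes T\<^sub>0: "standard (A\<^sub>0, B\<^sub>0, {})" "rectangular (A\<^sub>0, B\<^sub>0, {})"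
    and bs: "sorted_wrt (<) bs" "set bs \<inter> content (A\<^sub>0, B\<^sub>0, {}) = {}"
  shows "admissible (fold ins bs (A\<^sub>0, B\<^sub>0, {})) \<longleftrightarrow> (\<forall>b\<in>set bs. \<exists>a\<in>A\<^sub>0. b < a)"
proof -
  obtain A B C where T: "fold ins bs (A\<^sub>0, B\<^sub>0, {}) = (A, B, C)" by (metis prod.exhaust)
  note F = fold_ins[OF T\<^sub>0 bs, unfolded T]
  note d\<^sub>0 = standardD[OF T\<^sub>0(1)] and d = standardD[OF F(1)]
  consider "bs = []" | "bs \<noteq> []" "A\<^sub>0 = {}" | "bs \<noteq> []" "A\<^sub>0 \<noteq> {}" by blast
  then show ?thesis
  proof cases
    case 1
    then show ?thesis using F(3) T by (auto simp: admissible.simps)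
  next
    case 2
    have "B\<^sub>0 = {}" using d\<^sub>0(9) 2 d\<^sub>0(2) by simp
    have all: "fold ins cs (A\<^sub>0, B\<^sub>0, {}) = (set cs, {}, {})" if "sorted_wrt (<) cs" for cs
      using that by (induction cs rule: rev_induct)
        (use 2 \<open>B\<^sub>0 = {}\<close> in \<open>auto simp: ins.simps sorted_wrt_append\<close>)
    show ?thesis unfolding all[OF bs(1)] using 2 by (simp add: admissible.simps)
  next
    case 3
    let ?M = "Max A\<^sub>0"
    note I = fold_ins_Max[OF T\<^sub>0 3(2) bs T]
    have nr: "\<not> rectangular (A, B, C)" and p: "snd (pop (A, B, C)) = last bs"
      using F(3,4) 3 by auto
    have "last bs \<in> set bs" using 3 by simp
    moreover have "b \<le> last bs" if "b \<in> set bs" for b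
      using last_max[OF bs(1) that] .
    ultimately have "(\<forall>b\<in>set bs. \<exists>a\<in>A\<^sub>0. b < a) \<longleftrightarrow> last bs < ?M"
      using 3(2) d\<^sub>0(1) by (metis Max_gr_iff le_less_trans)
    also have "\<dots> \<longleftrightarrow> admissible (A, B, C)"
    proof (cases "card B < card A")
      case True
      then have l: "last bs = Max A" using p by (simp add: pop.simps)
      have le: "a \<le> Max A" if "a \<in> A" for a using that d(1) by simp
      have ne: "card A \<noteq> card B" using True by simp
      show ?thesis
      proof
        assume "last bs < ?M"
        then have "?M \<notin> A" using le[of ?M] l by auto
        then show "admissible (A, B, C)" using I \<open>last bs < ?M\<close> l by (simp add: admissible.simps)
      next
        assume "admissible (A, B, C)"
        then have "C \<noteq> {}" "Max A < link B C" using ne by (simp_all add: admissible.simps)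
        then show "last bs < ?M" using I l by auto
      qed
    next
      case False
      then have eqc: "card A = card B" using d(9) by simp
      then have C: "C \<noteq> {}" using nr by simp
      then have "last bs < link B C"
        using p False pop_link(2)[OF F(1) C] by (simp add: pop.simps Let_def)
      then show ?thesis using I C eqc by (auto simp: admissible.simps)
    qed
    finally show ?thesis by (simp add: T)
  qed
qed

definition insert_rest :: "nat \<Rightarrow> nat set \<times> nat set \<Rightarrow> triple" where
  "insert_rest N = (\<lambda>(A, D). fold ins (sorted_list_of_set ({1..N} - (A \<union> D))) (A, D, {}))"

lemma standard_pair:
  "standard (A, D, {}) \<longleftrightarrow> finite A \<and> finite D \<and> A \<inter> D = {} \<and> ballot A D"
  by (auto simp: standard_def ballot_def)

lemma insert_rest_bij:
  "bij_betw (insert_rest N) (row_pairs N) {T \<in> triples N. admissible T}"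
proof (rule bij_betw_imageI)
  have base: "standard (A, D, {})" "rectangular (A, D, {})" "content (A, D, {}) = A \<union> D"
    if "(A, D) \<in> row_pairs N" for A D
  proof -
    have "finite A" "finite D" using that by (auto simp: row_pairs_def intro: finite_subset)
    then show "standard (A, D, {})" "rectangular (A, D, {})" "content (A, D, {}) = A \<union> D"
      using that by (auto simp: row_pairs_def standard_pair content_def)
  qed
  have srt: "sorted_wrt (<) (sorted_list_of_set ({1..N} - X))" for X by simp
  have set: "set (sorted_list_of_set ({1..N} - X)) = {1..N} - X" for X by simp
  show "inj_on (insert_rest N) (row_pairs N)"
  proof (rule inj_onI, clarify)
    fix A D A' D'
    assume AD: "(A, D) \<in> row_pairs N" and AD': "(A', D') \<in> row_pairs N"
      and eq: "insert_rest N (A, D) = insert_rest N (A', D')"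
    have "(A, D, {} :: nat set) = (A', D', {})"
      by (rule fold_ins_inj[OF base(1,2)[OF AD] srt[of "A \<union> D"] _ base(1,2)[OF AD'] srt[of "A' \<union> D'"]])
        (use eq in \<open>simp_all only: insert_rest_def prod.case base(3)[OF AD] base(3)[OF AD'] set, auto\<close>)
    then show "A = A' \<and> D = D'" by simp
  qed
  show "insert_rest N ` row_pairs N = {T \<in> triples N. admissible T}"
  proof (intro equalityI subsetI)
    fix T assume "T \<in> insert_rest N ` row_pairs N"
    then obtain A D where AD: "(A, D) \<in> row_pairs N" and T: "T = insert_rest N (A, D)" by auto
    let ?bs = "sorted_list_of_set ({1..N} - (A \<union> D))"
    have dis: "set ?bs \<inter> content (A, D, {}) = {}" using set base(3)[OF AD] by auto
    note F = fold_ins[OF base(1,2)[OF AD] srt dis]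
      and G = fold_ins_admissible_iff[OF base(1,2)[OF AD] srt dis]
    have T': "T = fold ins ?bs (A, D, {})" by (simp add: T insert_rest_def)
    have "A \<union> D \<subseteq> {1..N}" using AD by (simp add: row_pairs_def)
    then have "content T = {1..N}" using F(2) unfolding T' set base(3)[OF AD] by auto
    moreover have "admissible T"
      unfolding T' G set using AD by (simp add: row_pairs_def)
    ultimately show "T \<in> {T \<in> triples N. admissible T}" using F(1) T' by (simp add: triples_def)
  next
    fix T assume T: "T \<in> {T \<in> triples N. admissible T}"
    then obtain T\<^sub>0 bs where R: "standard T\<^sub>0" "rectangular T\<^sub>0" "sorted_wrt (<) bs"
      "set bs \<inter> content T\<^sub>0 = {}" "fold ins bs T\<^sub>0 = T"
      using fold_ins_surj[of T] by (auto simp: triples_def)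
    obtain A D where T\<^sub>0: "T\<^sub>0 = (A, D, {})" using R(2) by (cases T\<^sub>0) auto
    have cont: "content T\<^sub>0 = A \<union> D" by (simp add: T\<^sub>0 content_def)
    have un: "(A \<union> D) \<union> set bs = {1..N}"
      using fold_ins(2)[OF R(1-4)] R(5) T cont by (simp add: triples_def)
    then have sb: "set bs = {1..N} - (A \<union> D)" using R(4) cont by auto
    have bs: "bs = sorted_list_of_set ({1..N} - (A \<union> D))"
      using sorted_list_of_set_eqI[OF R(3) sb] by simp
    have "admissible (fold ins bs (A, D, {}))" using T R(5) T\<^sub>0 by simp
    then have "\<forall>b\<in>{1..N} - (A \<union> D). \<exists>a\<in>A. b < a"
      using fold_ins_admissible_iff[of A D bs] R T\<^sub>0 sb by blast
    then have "(A, D) \<in> row_pairs N"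
      using R(1,2) un unfolding T\<^sub>0 by (auto simp: row_pairs_def standard_pair)
    moreover have "T = insert_rest N (A, D)" using R(5) by (simp add: insert_rest_def T\<^sub>0 bs)
    ultimately show "T \<in> insert_rest N ` row_pairs N" by blast
  qed
qed

text \<open>
  Each \<open>m\<close> is appended to row 1 and bumped into row 2 by the \<open>a\<close> that follows it.
\<close>

lemma fold_tab_insert_pairs:
  assumes "length as = length ms" "sorted_wrt (<) as" "sorted_wrt (<) ms" "list_all2 (<) as ms"
  shows "fold tab_insert (concat (map2 (\<lambda>m a. [m, a]) ms as)) [] = (if as = [] then [] else [as, ms])"
  using assms
proof (induction as ms rule: rev_induct2)
  case (4 a as m ms)
  have 1: "length as = length ms" and lt: "a < m" "list_all2 (<) as ms"
    using 4 by (auto simp: list_all2_append)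
  have srt: "sorted_wrt (<) as" "sorted_wrt (<) ms" "\<forall>x\<in>set as. x < a" "\<forall>x\<in>set ms. x < m"
    using 4 by (auto simp: sorted_wrt_append)
  have as_m: "\<forall>x\<in>set as. x < m" using srt(3) lt(1) by auto
  have IH: "fold tab_insert (concat (map2 (\<lambda>m a. [m, a]) ms as)) [] = (if as = [] then [] else [as, ms])"
    using 4 1 lt srt by simp
  have ra: "row_insert a (as @ [m]) = (as @ [a], Some m)"
    using srt(3) lt(1) by (induction as) auto
  show ?case
    using IH 1 row_insert_append[OF as_m] row_insert_append[OF srt(4)] ra
    by (cases "as = []") (auto simp: lt(1))
qed (auto)

text \<open>
  In terms of positions: a block ends where a letter of \<open>D\<close>, or nothing, follows.
\<close>

lemma block_ends_nth_iff:
  assumes w: "woven D U \<pi>" and i: "i < length \<pi>" and nD: "\<pi> ! i \<notin> D"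
  shows "\<pi> ! i \<in> block_ends (length \<pi>) D U \<longleftrightarrow> Suc i = length \<pi> \<or> \<pi> ! Suc i \<in> D"
proof -
  note W = wovenD[OF w]
  let ?C = "{1..length \<pi>} - D"
  have nth_C: "\<pi> ! j \<in> ?C \<longleftrightarrow> \<pi> ! j \<notin> D" if "j < length \<pi>" for j
    using W(2) that nth_mem by blast
  have ex: "\<exists>j. i < j \<and> j < length \<pi> \<and> e = \<pi> ! j" if e: "e \<in> ?C" "\<pi> ! i < e" for e
  proof -
    have "e \<in> set \<pi>" using W(2) e by blast
    then obtain j where j: "j < length \<pi>" "e = \<pi> ! j" by (auto simp: in_set_conv_nth)
    have "\<not> j < i" using W(6)[of j i] j e nD i by (auto dest: less_asym)
    then have "i < j" using j e by (metis less_irrefl linorder_neqE_nat)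
    then show ?thesis using j by blast
  qed
  have "\<pi> ! i \<in> block_ends (length \<pi>) D U \<longleftrightarrow> next_in U ?C (\<pi> ! i)"
    unfolding block_ends_def using nth_C[OF i] nD by blast
  also have "\<dots> \<longleftrightarrow> Suc i = length \<pi> \<or> \<pi> ! Suc i \<in> D"
  proof (cases "Suc i = length \<pi>")
    case True
    have "\<not> \<pi> ! i < e" if "e \<in> ?C" for e using ex[OF that] True by auto
    then show ?thesis using True unfolding next_in_def by blast
  next
    case False
    then have i': "Suc i < length \<pi>" using i by simp
    show ?thesis
    proof (cases "\<pi> ! Suc i \<in> D")
      case True
      then have u: "Suc (Suc i) < length \<pi>" "\<pi> ! Suc (Suc i) \<in> U" using W(7)[OF i'] by auto
      then have uD: "\<pi> ! Suc (Suc i) \<notin> D" using W(5) by blast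
      have "next_in U ?C (\<pi> ! i) \<longleftrightarrow> \<pi> ! Suc (Suc i) \<in> U"
      proof (rule next_in_iff)
        show "\<pi> ! Suc (Suc i) \<in> ?C" using nth_C[OF u(1)] uD by blast
        show "\<pi> ! i < \<pi> ! Suc (Suc i)" using W(6)[of i "Suc (Suc i)"] u(1) uD nD by simp
        fix e assume e: "e \<in> ?C" "\<pi> ! i < e"
        then obtain j where j: "i < j" "j < length \<pi>" "e = \<pi> ! j" using ex by blast
        have "j \<noteq> Suc i" using True e j by auto
        then have "j = Suc (Suc i) \<or> Suc (Suc i) < j" using j by linarith
        then show "\<pi> ! Suc (Suc i) \<le> e"
          using W(6)[of "Suc (Suc i)" j] j e uD by (auto intro: less_imp_le)
      qed
      then show ?thesis using u True by simp
    next
      case nD': False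
      have "next_in U ?C (\<pi> ! i) \<longleftrightarrow> \<pi> ! Suc i \<in> U"
      proof (rule next_in_iff)
        show "\<pi> ! Suc i \<in> ?C" using nth_C[OF i'] nD' by blast
        show "\<pi> ! i < \<pi> ! Suc i" using W(6)[of i "Suc i"] i' nD nD' by simp
        fix e assume e: "e \<in> ?C" "\<pi> ! i < e"
        then obtain j where j: "i < j" "j < length \<pi>" "e = \<pi> ! j" using ex by blast
        then have "j = Suc i \<or> Suc i < j" by linarith
        then show "\<pi> ! Suc i \<le> e"
          using W(6)[of "Suc i" j] j e nD' by (auto intro: less_imp_le)
      qed
      moreover have "\<pi> ! Suc i \<notin> U" using W(8)[OF i'] nD by auto
      ultimately show ?thesis using nD' False by simp
    qed
  qed
  finally show ?thesis .
qed

text \<open>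
  The left-to-right maxima of a Riordan permutation are the elements of \<open>D\<close>, and the letters between two of them increase, so
  the largest of these is the last one.
\<close>

lemma theta_conv:
  assumes p: "\<pi> \<in> riordan_perms N"
  defines "A \<equiv> block_ends N (Dset \<pi>) (Uset \<pi>)" and "D \<equiv> Dset \<pi>"
  shows "theta \<pi> = concat (map2 (\<lambda>m a. [m, a]) (sorted_list_of_set D) (sorted_list_of_set A)) @
    sorted_list_of_set ({1..N} - (A \<union> D))"
proof -
  let ?U = "Uset \<pi>"
  have m: "\<pi> \<in> motzkin_perms N" "\<And>i. \<not> fixed_point_at \<pi> i" using p by (auto simp: riordan_perms_def)
  have w: "woven D ?U \<pi>" and len: "length \<pi> = N" using motzkin_perms_woven[OF m(1)] by (simp_all add: D_def)
  note W = wovenD[OF w]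
  define L where "L = lr_positions \<pi>"
  define k where "k = length L"
  have lr: "lr_max_at \<pi> i \<longleftrightarrow> i < N \<and> \<pi> ! i \<in> D" for i
    using woven_D_lr_max[OF w] woven_Dset(2)[OF w] m(2) len by (auto simp: lr_max_at_def)
  have Lset: "set L = {i. i < N \<and> \<pi> ! i \<in> D}"
    unfolding L_def lr_positions_def using lr len by auto
  have Lsrt: "sorted_wrt (<) L"
    unfolding L_def lr_positions_def by (intro sorted_wrt_filter) simp
  have Ls: "L ! i < L ! j" if "i < j" "j < k" for i j
    using sorted_wrt_nth_less[OF Lsrt] that by (simp add: k_def)
  have LD: "L ! j < N" "\<pi> ! (L ! j) \<in> D" if "j < k" for j
    using Lset that nth_mem[of j L] by (auto simp: k_def)
  have LI: "\<exists>j<k. i = L ! j" if "i < N" "\<pi> ! i \<in> D" for i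
    using Lset that by (metis (mono_tags, lifting) in_set_conv_nth k_def mem_Collect_eq)
  have nxt: "Suc (L ! j) < N \<and> \<pi> ! Suc (L ! j) \<notin> D" if "j < k" for j
    using W(7)[of "L ! j"] LD[OF that] len W(5) by auto
  \<comment> \<open>The position of the last letter before the next left-to-right maximum.\<close>
  define pos where "pos j = (if Suc j < k then L ! Suc j - 1 else N - 1)" for j
  have pos: "L ! j < pos j" "pos j < N" if j: "j < k" for j
  proof -
    show "pos j < N" using LD(1)[OF j] LD(1)[of "Suc j"] by (auto simp: pos_def)
    show "L ! j < pos j"
    proof (cases "Suc j < k")
      case True
      have "L ! j < L ! Suc j" using Ls True by simp
      moreover have "Suc (L ! j) \<noteq> L ! Suc j" using nxt[OF j] LD(2)[OF True] by auto
      ultimately show ?thesis using True by (simp add: pos_def)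
    next
      case False
      then show ?thesis using nxt[OF j] by (auto simp: pos_def)
    qed
  qed
  have between: "\<pi> ! i \<notin> D" if j: "j < k" "L ! j < i" "i \<le> pos j" for i j
  proof
    assume "\<pi> ! i \<in> D"
    moreover have "i < N" using j pos(2)[OF j(1)] by simp
    ultimately obtain l where l: "l < k" "i = L ! l" using LI by blast
    have "j < l" using j(2) l Ls[of l j] j(1) by (metis less_asym less_irrefl linorder_neqE_nat)
    then have sj: "Suc j < k" using l by simp
    have "L ! Suc j \<le> i" using Ls[of "Suc j" l] l \<open>j < l\<close> by (cases "l = Suc j") auto
    moreover have "0 < L ! Suc j" using Ls[of j "Suc j"] sj by simp
    ultimately show False using j(3) sj by (simp add: pos_def)
  qed
  have posD: "\<pi> ! pos j \<notin> D" if "j < k" for j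
    using between[OF that pos(1)[OF that]] by simp
  have a: "a_val \<pi> j = \<pi> ! pos j" if j: "j < k" for j
  proof (cases "Suc j < k")
    case True
    have "Max {\<pi> ! i |i. L ! j < i \<and> i < L ! Suc j} = \<pi> ! pos j"
    proof (rule Max_eqI)
      show "finite {\<pi> ! i |i. L ! j < i \<and> i < L ! Suc j}" by simp
      have le: "i \<le> pos j \<longleftrightarrow> i < L ! Suc j" if "L ! j < i" for i
        using True that Ls[of j "Suc j"] by (auto simp: pos_def)
      show "\<pi> ! pos j \<in> {\<pi> ! i |i. L ! j < i \<and> i < L ! Suc j}"
        using pos(1)[OF j] le[of "pos j"] by auto
      fix y assume "y \<in> {\<pi> ! i |i. L ! j < i \<and> i < L ! Suc j}"
      then obtain i where i: "y = \<pi> ! i" "L ! j < i" "i \<le> pos j" using le by blast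
      then show "y \<le> \<pi> ! pos j"
        using W(6)[of i "pos j"] between[OF j] pos(2)[OF j] posD[OF j] len
        by (cases "i = pos j") (auto intro: less_imp_le)
    qed
    then show ?thesis using True by (simp add: a_val_def L_def[symmetric] k_def)
  next
    case False
    have "\<pi> \<noteq> []" using pos(2)[OF j] len by auto
    then show ?thesis using False len by (simp add: a_val_def L_def[symmetric] k_def pos_def last_conv_nth)
  qed
  have ms: "map (m_val \<pi>) [0..<k] = sorted_list_of_set D"
  proof (rule sorted_list_of_set_eqI[symmetric])
    have "\<pi> ! (L ! i) < \<pi> ! (L ! j)" if "i < j" "j < k" for i j
      using W(6)[OF Ls[OF that]] LD[of j] LD[of i] that len by simp
    then show "sorted_wrt (<) (map (m_val \<pi>) [0..<k])"
      by (auto simp: sorted_wrt_iff_nth_less m_val_def L_def[symmetric])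
    have "d \<in> (\<lambda>j. \<pi> ! (L ! j)) ` {..<k}" if "d \<in> D" for d
    proof -
      have "d \<in> set \<pi>" using W(2,3) that by blast
      then obtain i where "i < N" "d = \<pi> ! i" using len by (auto simp: in_set_conv_nth)
      then show ?thesis using LI[of i] that by blast
    qed
    then show "set (map (m_val \<pi>) [0..<k]) = D"
      using LD by (auto simp: m_val_def L_def[symmetric] atLeast0LessThan)
  qed
  have as: "map (a_val \<pi>) [0..<k] = sorted_list_of_set A"
  proof (rule sorted_list_of_set_eqI[symmetric])
    have "\<pi> ! pos i < \<pi> ! pos j" if ij: "i < j" "j < k" for i j
    proof -
      have "pos i < pos j"
      proof -
        have "pos i < L ! Suc i" using ij Ls[of i "Suc i"] by (simp add: pos_def)
        also have "L ! Suc i \<le> L ! j" using Ls[of "Suc i" j] ij by (cases "j = Suc i") auto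
        also have "\<dots> < pos j" using pos(1) ij by simp
        finally show ?thesis .
      qed
      then show ?thesis using W(6)[of "pos i" "pos j"] pos(2) posD ij len by simp
    qed
    then show "sorted_wrt (<) (map (a_val \<pi>) [0..<k])"
      using a by (simp add: sorted_wrt_iff_nth_less)
    have "A = (\<lambda>j. \<pi> ! pos j) ` {..<k}"
    proof (intro equalityI subsetI)
      fix c assume c: "c \<in> A"
      then have cC: "c \<in> {1..N} - D" by (simp add: A_def D_def block_ends_def)
      then have "c \<in> set \<pi>" using W(2) len by simp
      then obtain i where i: "i < N" "c = \<pi> ! i" using len by (auto simp: in_set_conv_nth)
      have iD: "\<pi> ! i \<notin> D" using cC i by blast
      have "\<pi> ! i \<in> block_ends (length \<pi>) D ?U" using c i(2) by (simp add: A_def D_def len)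
      then have "Suc i = N \<or> \<pi> ! Suc i \<in> D"
        using block_ends_nth_iff[OF w _ iD] i(1) by (simp add: len)
      then consider "Suc i = N" | "Suc i < N" "\<pi> ! Suc i \<in> D" using i(1) by linarith
      then have "\<exists>j<k. i = pos j"
      proof cases
        case 1
        have "lr_max_at \<pi> 0" using i len by (auto simp: lr_max_at_def)
        then have "0 < k" using LI[of 0] lr[of 0] by auto
        then show ?thesis using 1 by (intro exI[of _ "k - 1"]) (auto simp: pos_def)
      next
        case 2
        then obtain l where l: "l < k" "Suc i = L ! l" using LI by blast
        have "lr_max_at \<pi> 0" using i len by (auto simp: lr_max_at_def)
        then obtain l0 where l0: "l0 < k" "0 = L ! l0" using LI[of 0] lr[of 0] by blast
        have "l \<noteq> 0"
        proof
          assume "l = 0"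
          then show False using l l0 Ls[of 0 l0] by (cases "l0 = 0") auto
        qed
        then obtain j where "l = Suc j" by (cases l) auto
        then show ?thesis using l by (intro exI[of _ j]) (auto simp: pos_def)
      qed
      then show "c \<in> (\<lambda>j. \<pi> ! pos j) ` {..<k}" using i by blast
    next
      fix c assume "c \<in> (\<lambda>j. \<pi> ! pos j) ` {..<k}"
      then obtain j where j: "j < k" "c = \<pi> ! pos j" by blast
      have "Suc (pos j) = N \<or> \<pi> ! Suc (pos j) \<in> D"
      proof (cases "Suc j < k")
        case True
        then have "Suc (pos j) = L ! Suc j" using Ls[of j "Suc j"] by (simp add: pos_def)
        then show ?thesis using LD(2)[OF True] by simp
      next
        case False
        then show ?thesis using pos(2)[OF j(1)] by (simp add: pos_def)
      qed
      then show "c \<in> A"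
        using block_ends_nth_iff[OF w, of "pos j"] pos(2)[OF j(1)] posD[OF j(1)] len j(2)
        by (simp add: A_def D_def)
    qed
    then show "set (map (a_val \<pi>) [0..<k]) = A" using a by auto
  qed
  have "map (\<lambda>j. [m_val \<pi> j, a_val \<pi> j]) [0..<k] =
      map2 (\<lambda>m a. [m, a]) (map (m_val \<pi>) [0..<k]) (map (a_val \<pi>) [0..<k])"
    by (simp add: map2_map_map)
  moreover have "m_val \<pi> ` {..<k} = D" "a_val \<pi> ` {..<k} = A"
  proof -
    have "m_val \<pi> ` {..<k} = set (map (m_val \<pi>) [0..<k])" "a_val \<pi> ` {..<k} = set (map (a_val \<pi>) [0..<k])"
      by auto
    moreover have "finite A" "finite D" using W(9) by (simp_all add: A_def block_ends_def)
    ultimately show "m_val \<pi> ` {..<k} = D" "a_val \<pi> ` {..<k} = A" unfolding ms as by simp_all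
  qed
  ultimately show ?thesis
    unfolding theta_def L_def[symmetric] k_def[symmetric] Let_def
    by (simp add: ms as len Un_commute)
qed

lemma P_tab_theta:
  assumes p: "\<pi> \<in> riordan_perms N"
  shows "P_tab (theta \<pi>) = tableau_of (insert_rest N (block_ends N (Dset \<pi>) (Uset \<pi>), Dset \<pi>))"
proof -
  let ?A = "block_ends N (Dset \<pi>) (Uset \<pi>)" and ?D = "Dset \<pi>"
  let ?as = "sorted_list_of_set ?A" and ?ms = "sorted_list_of_set ?D"
  let ?bs = "sorted_list_of_set ({1..N} - (?A \<union> ?D))"
  have "(Uset \<pi>, Dset \<pi>) \<in> riordan_pairs N" using riordan_perms_bij[of N] p by (auto simp: bij_betw_def)
  then have "(?A, ?D) \<in> row_pairs N" by (rule block_ends_row_pairs)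
  then have r: "?A \<union> ?D \<subseteq> {1..N}" "?A \<inter> ?D = {}" "card ?A = card ?D" "ballot ?A ?D"
    by (auto simp: row_pairs_def)
  have fin: "finite ?A" "finite ?D" using r(1) finite_subset by blast+
  have st: "standard (?A, ?D, {})" using r fin by (simp add: standard_pair)
  have "\<forall>c<length ?ms. ?as ! c < ?ms ! c"
    using ballot_lists_iff[of ?as ?ms] r fin by auto
  then have all2: "list_all2 (<) ?as ?ms" using r(3) by (auto simp: list_all2_conv_all_nth)
  have "fold tab_insert (concat (map2 (\<lambda>m a. [m, a]) ?ms ?as)) [] = (if ?as = [] then [] else [?as, ?ms])"
    by (rule fold_tab_insert_pairs) (use r(3) all2 in auto)
  also have "\<dots> = tableau_of (?A, ?D, {})"
  proof (cases "?A = {}")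
    case True
    then have "?D = {}" using r(3) fin by simp
    then show ?thesis using True by (simp add: tableau_of_def drop_empty_def)
  next
    case False
    then have "?D \<noteq> {}" using r(3) fin by (metis card_eq_0_iff)
    then show ?thesis using False fin by (simp add: tableau_of_cases[OF st])
  qed
  finally have "P_tab (theta \<pi>) = fold tab_insert ?bs (tableau_of (?A, ?D, {}))"
    unfolding P_tab_def theta_conv[OF p] by simp
  also have "\<dots> = tableau_of (fold ins ?bs (?A, ?D, {}))"
    by (rule fold_ins(5)[OF st]) (use r(3) in \<open>auto simp: content_def\<close>)
  finally show ?thesis by (simp add: insert_rest_def)
qed

section \<open>Repairing the parities\<close>

fun push1 :: "triple \<Rightarrow> triple" where
  "push1 (A, B, C) =
     (insert (link B C) A, insert (Max C) (B - {link B C}), C - {Max C})"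

fun push2 :: "triple \<Rightarrow> triple" where
  "push2 (A, B, C) = (insert (Max B) A, B - {Max B}, C)"

text \<open>
  Row insertion of the last entry of row 1 into row 2, the bumped entry being put into row 3.
\<close>

fun pull :: "triple \<Rightarrow> triple" where
  "pull (A, B, C) =
     (let q = Max A in
      if \<forall>b\<in>B. b < q then (A - {q}, insert q B, C)
      else let y = Min {b \<in> B. q < b} in (A - {q}, insert q (B - {y}), insert y C))"

text \<open>
  The first move keeps the columns strict because \<open>x\<close> is the last entry of row 2 below \<open>y\<close>, so that nothing remains below \<open>x\<close> in row 3.
  Afterwards \<open>x\<close> ends row 1 and the new link is an older, smaller entry of row 2; thus the result is not admissible by its link.
\<close>

lemma push1_props:
  assumes st: "standard (A, B, C)" and ne: "C \<noteq> {}" and x: "\<And>a. a \<in> A \<Longrightarrow> a < link B C"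
    and eq: "push1 (A, B, C) = (A', B', C')"
  shows "standard (A', B', C')" "content (A', B', C') = content (A, B, C)"
    "card A' = Suc (card A)" "card B' = card B" "Suc (card C') = card C"
    "pull (A', B', C') = (A, B, C)" "Max A' = link B C"
    "C' \<noteq> {} \<Longrightarrow> link B' C' < Max A'" "\<And>a. a \<in> A' \<Longrightarrow> a < Max B'"
proof -
  let ?x = "link B C" and ?y = "Max C"
  note d = standardD[OF st] and l = link_props[OF st ne]
  have A': "A' = insert ?x A" and B': "B' = insert ?y (B - {?x})" and C': "C' = C - {?y}"
    using eq by auto
  have y: "?y \<in> C" and ymax: "\<And>c. c \<in> C \<Longrightarrow> c \<le> ?y"
    using d(3) ne by simp_all
  then have y': "?y \<notin> B" "?y \<notin> A" using d(5,6) by blast+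
  have cA: "cnt A' v = cnt A v + (if ?x \<le> v then 1 else 0)" for v
    using A' d l by (simp add: cnt_insert)
  note cB = move_link_cnt(1)[OF st ne, folded B'] and CB = move_link_cnt(2)[OF st ne, folded B' C']
  have "cnt B' v \<le> cnt A' v" for v
    using cA[of v] cB[of v] d(7)[of v] l(2) by (auto split: if_splits)
  moreover note CB
  ultimately show "standard (A', B', C')"
    using d l y y' unfolding standard_def ballot_def A' B' C' by auto
  show "content (A', B', C') = content (A, B, C)"
    using l y y' unfolding content_def A' B' C' by auto
  show "card A' = Suc (card A)" "card B' = card B" "Suc (card C') = card C"
    using A' B' C' d l y y' by (auto simp: card_gt_0_iff intro!: Suc_pred)
  show M: "Max A' = ?x"
    unfolding A' using d x by (intro Max_eqI) (auto intro: less_imp_le)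
  have "Min {b \<in> B'. ?x < b} = ?y"
    unfolding B' using d l by (intro Min_eqI) (auto simp: not_le[symmetric])
  moreover have "\<not> (\<forall>b\<in>B'. b < ?x)" using B' l by auto
  ultimately show "pull (A', B', C') = (A, B, C)"
    using M A' B' C' l y y' by (auto simp: pull.simps Let_def insert_absorb)
  show "link B' C' < Max A'" if ne': "C' \<noteq> {}"
  proof -
    have st': "standard (A', B', C')" by fact
    note l' = link_props[OF st' ne']
    have "Max C' \<le> ?y" using C' ne' d ymax by (metis Diff_iff Max_in finite_Diff)
    then have "link B' C' \<noteq> ?y" using l' by auto
    then have "link B' C' \<in> B" "link B' C' \<noteq> ?x" using l'(1) B' by auto
    moreover have "link B' C' < ?y" using l'(2) \<open>Max C' \<le> ?y\<close> by simp
    ultimately show ?thesis unfolding M using l(3) by (metis le_neq_implies_less)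
  qed
  show "a < Max B'" if "a \<in> A'" for a
  proof -
    have "?y \<le> Max B'" using B' d by simp
    moreover have "a \<le> ?x" using that A' x by (auto intro: less_imp_le)
    ultimately show ?thesis using l(2) by linarith
  qed
qed

declare pull.simps [simp del] push1.simps [simp del] push2.simps [simp del] admissible.simps [simp del]

lemma push2_props:
  assumes st: "standard (A, B, C)" and e: "\<And>a. a \<in> A \<Longrightarrow> a < Max B"
    and lt: "card C < card B" and eq: "push2 (A, B, C) = (A', B', C')"
  shows "standard (A', B', C')" "content (A', B', C') = content (A, B, C)"
    "card A' = Suc (card A)" "Suc (card B') = card B" "C' = C"
    "pull (A', B', C') = (A, B, C)" "C' \<noteq> {} \<Longrightarrow> link B' C' < Max A'"
proof -
  let ?e = "Max B"
  note d = standardD[OF st]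
  have A': "A' = insert ?e A" and B': "B' = B - {?e}" and C': "C' = C"
    using eq by (auto simp: push2.simps)
  have "B \<noteq> {}" using lt by auto
  then have "?e \<in> B" and emax: "\<And>b. b \<in> B \<Longrightarrow> b \<le> ?e" using d(2) by simp_all
  then have eB: "?e \<in> B" "?e \<notin> A" "?e \<notin> C" using d(4,6) by blast+
  have cA: "cnt A' v = cnt A v + (if ?e \<le> v then 1 else 0)" for v
    using A' d eB by (simp add: cnt_insert)
  have cB: "cnt B v = cnt B' v + (if ?e \<le> v then 1 else 0)" for v
    using B' d eB cnt_remove[of B ?e v] by simp
  show cards: "card A' = Suc (card A)" "Suc (card B') = card B" "C' = C"
    using A' B' C' d eB by (auto simp: card_gt_0_iff intro!: Suc_pred)
  have "cnt B' v \<le> cnt A' v" for v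
    using cA[of v] cB[of v] d(7)[of v] by auto
  moreover have "cnt C' v \<le> cnt B' v" for v
  proof (cases "?e \<le> v")
    case True
    then have "cnt B v = card B" using emax by (intro cnt_all) (meson order_trans)
    then show ?thesis using True cB[of v] lt C' cnt_le_card[OF d(3), of v] by auto
  next
    case False
    then show ?thesis using cB[of v] C' d(8)[of v] by auto
  qed
  ultimately show st': "standard (A', B', C')"
    using d eB unfolding standard_def ballot_def A' B' C' by auto
  show "content (A', B', C') = content (A, B, C)"
    using eB unfolding content_def A' B' C' by auto
  have M: "Max A' = ?e"
    unfolding A' using d e by (intro Max_eqI) (auto intro: less_imp_le)
  have lt': "\<forall>b\<in>B'. b < ?e" using B' emax by (auto simp: le_neq_implies_less)
  then show "pull (A', B', C') = (A, B, C)"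
    using M A' B' C' eB by (auto simp: pull.simps Let_def insert_absorb)
  show "link B' C' < Max A'" if "C' \<noteq> {}"
    using link_props(1)[OF st' that] lt' M by auto
qed

text \<open>
  Undoing the second move.
\<close>

lemma pull_append_props:
  assumes st: "standard (A, B, C)" and q: "\<And>b. b \<in> B \<Longrightarrow> b < Max A"
    and lt: "card B + 2 \<le> card A" and eq: "pull (A, B, C) = (A', B', C')"
  shows "standard (A', B', C')" "content (A', B', C') = content (A, B, C)"
    "Suc (card A') = card A" "card B' = Suc (card B)" "C' = C" "Max B' = Max A"
    "push2 (A', B', C') = (A, B, C)" "\<And>a. a \<in> A' \<Longrightarrow> a < Max A" "Max A \<in> B'"
proof -
  let ?q = "Max A"
  note d = standardD[OF st]
  have "\<forall>b\<in>B. b < ?q" using q by blast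
  then have A': "A' = A - {?q}" and B': "B' = insert ?q B" and C': "C' = C"
    using eq by (simp_all add: pull.simps Let_def)
  have "A \<noteq> {}" using lt by auto
  then have "?q \<in> A" and qmax: "\<And>a. a \<in> A \<Longrightarrow> a \<le> ?q" using d(1) by simp_all
  then have qA: "?q \<in> A" "?q \<notin> B" "?q \<notin> C" using d(4,5) by blast+
  have cA: "cnt A v = cnt A' v + (if ?q \<le> v then 1 else 0)" for v
    using A' d qA cnt_remove[of A ?q v] by simp
  have cB: "cnt B' v = cnt B v + (if ?q \<le> v then 1 else 0)" for v
    using B' d qA by (simp add: cnt_insert)
  show cards: "Suc (card A') = card A" "card B' = Suc (card B)" "C' = C"
    using A' B' C' d qA by (auto simp: card_gt_0_iff intro!: Suc_pred)
  have "cnt B' v \<le> cnt A' v" for v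
  proof (cases "?q \<le> v")
    case True
    then have "cnt A v = card A" using qmax by (intro cnt_all) (meson order_trans)
    then show ?thesis using True cA[of v] cB[of v] lt cnt_le_card[OF d(2), of v] by auto
  next
    case False
    then show ?thesis using cA[of v] cB[of v] d(7)[of v] by auto
  qed
  moreover have "cnt C' v \<le> cnt B' v" for v
    using cB[of v] C' d(8)[of v] by auto
  ultimately show st': "standard (A', B', C')"
    using d qA unfolding standard_def ballot_def A' B' C' by auto
  show "content (A', B', C') = content (A, B, C)"
    using qA unfolding content_def A' B' C' by auto
  show M: "Max B' = ?q"
    unfolding B' using d q by (intro Max_eqI) (auto intro: less_imp_le)
  show "push2 (A', B', C') = (A, B, C)"
    using M A' B' C' qA by (auto simp: push1.simps push2.simps insert_absorb)
  show "a < ?q" if "a \<in> A'" for a using that A' qmax by (auto simp: le_neq_implies_less)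
  show "?q \<in> B'" using B' by simp
qed

text \<open>
  Undoing the first move.  That the link is smaller than the last entry of row 1 makes the bumped entry larger than all of row 3.
\<close>

lemma pull_bump_props:
  assumes st: "standard (A, B, C)" and q: "\<exists>b\<in>B. \<not> b < Max A"
    and lk: "C \<noteq> {} \<Longrightarrow> link B C < Max A"
    and lt: "card B < card A" and eq: "pull (A, B, C) = (A', B', C')"
  shows "standard (A', B', C')" "content (A', B', C') = content (A, B, C)"
    "Suc (card A') = card A" "card B' = card B" "card C' = Suc (card C)" "link B' C' = Max A"
    "push1 (A', B', C') = (A, B, C)" "\<And>a. a \<in> A' \<Longrightarrow> a < Max A" "C' \<noteq> {}"
proof -
  let ?q = "Max A" and ?y = "Min {b \<in> B. Max A < b}"
  note d = standardD[OF st]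
  have A': "A' = A - {?q}" and B': "B' = insert ?q (B - {?y})" and C': "C' = insert ?y C"
    using eq q by (auto simp: pull.simps Let_def split: if_splits)
  have "A \<noteq> {}" using lt by auto
  then have "?q \<in> A" and qmax: "\<And>a. a \<in> A \<Longrightarrow> a \<le> ?q" using d(1) by simp_all
  then have qA: "?q \<in> A" "?q \<notin> B" "?q \<notin> C" using d(4,5) by blast+
  have "{b \<in> B. ?q < b} \<noteq> {}" using q qA by (auto simp: not_less le_less)
  then have "?y \<in> {b \<in> B. ?q < b}" using d by (intro Min_in) auto
  then have "?y \<in> B" "?q < ?y" by auto
  then have y: "?y \<in> B" "?q < ?y" "?y \<notin> A" "?y \<notin> C" using d(4,6) by blast+
  have ymin: "?y \<le> b" if "b \<in> B" "?q < b" for b using that d by (intro Min_le) auto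
  have yC: "c < ?y" if c: "c \<in> C" for c
  proof (rule ccontr)
    assume "\<not> c < ?y"
    moreover have "c \<noteq> ?y" using c y by auto
    moreover have "c \<le> Max C" using c d by simp
    ultimately have "?y < Max C" by simp
    then have "?y \<le> link B C" using link_props(3)[OF st _ y(1)] c by blast
    then show False using lk c y(2) by fastforce
  qed
  have cA: "cnt A v = cnt A' v + (if ?q \<le> v then 1 else 0)" for v
    using A' d qA cnt_remove[of A ?q v] by simp
  note bump = bump_into_last_cnt[OF d(2,3,8) y(1,4) yC qA(2) y(2), folded B']
  note cB = bump(1) and CB = bump(2)[folded C']
  show cards: "Suc (card A') = card A" "card B' = card B" "card C' = Suc (card C)"
    using A' B' C' d qA y by (auto simp: card_gt_0_iff intro!: Suc_pred)
  have "cnt B' v \<le> cnt A' v" for v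
  proof (cases "?q \<le> v")
    case True
    then have cAv: "cnt A v = card A" using qmax by (intro cnt_all) (meson order_trans)
    show ?thesis
    proof (cases "?y \<le> v")
      case True
      then show ?thesis using \<open>?q \<le> v\<close> cAv cA[of v] cB[of v] lt cnt_le_card[OF d(2), of v] by auto
    next
      case False
      have "cnt B v < cnt B ?y" using False d y by (intro cnt_less[of _ ?y]) auto
      then have "cnt B v < card B" using cnt_le_card[OF d(2), of ?y] by simp
      then show ?thesis using False \<open>?q \<le> v\<close> cAv cA[of v] cB[of v] lt by auto
    qed
  next
    case False
    then show ?thesis using cA[of v] cB[of v] d(7)[of v] y(2) by auto
  qed
  moreover note CB
  ultimately show st': "standard (A', B', C')"
    using d qA y unfolding standard_def ballot_def A' B' C' by auto
  show "content (A', B', C') = content (A, B, C)"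
    using qA y unfolding content_def A' B' C' by auto
  have M: "Max C' = ?y"
    unfolding C' using d yC by (intro Max_eqI) (auto intro: less_imp_le)
  show L: "link B' C' = ?q"
    unfolding link_def M B' using d y ymin by (intro Max_eqI) (auto simp: not_less[symmetric])
  show "push1 (A', B', C') = (A, B, C)"
    using M L A' B' C' qA y by (auto simp: push1.simps push2.simps insert_absorb)
  show "a < ?q" if "a \<in> A'" for a using that A' qmax by (auto simp: le_neq_implies_less)
  show "C' \<noteq> {}" using C' by simp
qed

definition same_parity :: "triple \<Rightarrow> bool" where
  "same_parity = (\<lambda>(A, B, C). even (card A + card B) \<and> even (card B + card C))"

text \<open>
  \<open>Psi\<close> on triples; \<open>N\<close> is the number of cells.
\<close>

definition repair :: "nat \<Rightarrow> triple \<Rightarrow> triple" where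
  "repair N T =
     (let T' = (if snd (snd T) \<noteq> {} \<and> odd (card (snd (snd T)) + N) then push1 T else T)
      in if fst (snd T') \<noteq> {} \<and> odd (card (fst (snd T')) + N) then push2 T' else T')"

definition unrepair :: "triple \<Rightarrow> triple" where
  "unrepair T = (if admissible (pull T) then pull T else pull (pull T))"

lemma card_content:
  assumes "(A, B, C) \<in> triples N"
  shows "card A + card B + card C = N"
proof -
  have st: "standard (A, B, C)" and c: "A \<union> B \<union> C = {1..N}"
    using assms by (auto simp: triples_def content_def)
  note d = standardD[OF st]
  have "card (A \<union> B \<union> C) = card A + card B + card C"
    using d by (simp add: card_Un_disjoint Int_Un_distrib2)
  then show ?thesis using c by simp
qed

text \<open>
  If row 3 has the wrong parity, so has exactly one of the other rows; their lengths differ, and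
  admissibility must come from the link.
\<close>

lemma row3_defective:
  assumes tr: "(A, B, C) \<in> triples N" and ad: "admissible (A, B, C)"
    and C: "C \<noteq> {}" "odd (card C + N)"
  shows "card B < card A" "\<And>a. a \<in> A \<Longrightarrow> a < link B C"
proof -
  have "standard (A, B, C)" using tr by (simp add: triples_def)
  note d = standardD[OF this] and N = card_content[OF tr]
  have neq: "card A \<noteq> card B" using C(2) N by auto
  then show "card B < card A" using d(9) by simp
  have "Max A < link B C" using ad neq by (simp add: admissible.simps)
  then show "a < link B C" if "a \<in> A" for a
    using Max_ge[OF d(1) that] by linarith
qed

text \<open>
  With row 3 in order, rows 1 and 2 are both wrong.  If their lengths agree, the ballot condition puts the maximum of row 2 above row 1;
  otherwise the link does.
\<close>

lemma row2_defective:
  assumes tr: "(A, B, C) \<in> triples N" and ad: "admissible (A, B, C)" and np: "\<not> same_parity (A, B, C)"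
    and row3: "\<not> (C \<noteq> {} \<and> odd (card C + N))"
  shows "odd (card B + N)" "card C < card B" "\<And>a. a \<in> A \<Longrightarrow> a < Max B" "even (card C + N)"
proof -
  have st: "standard (A, B, C)" using tr by (simp add: triples_def)
  note d = standardD[OF st] and N = card_content[OF tr]
  show c: "even (card C + N)"
  proof (rule ccontr)
    assume "odd (card C + N)"
    then have "C = {}" "odd N" using row3 by auto
    then show False using ad np N by (auto simp: same_parity_def admissible.simps)
  qed
  show par: "odd (card B + N)" using np N c by (auto simp: same_parity_def)
  show "card C < card B" using c par d(10) by (cases "card C = card B") auto
  then have Bne: "B \<noteq> {}" by auto
  show "a < Max B" if a: "a \<in> A" for a
  proof (cases "card A = card B")
    case True
    have "Max B \<in> B" using Bne d by simp
    have "\<not> Max B < a"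
    proof
      assume less: "Max B < a"
      have "cnt A (Max B) < cnt A a" using less a d by (intro cnt_less[of _ a]) auto
      also have "\<dots> \<le> card A" using d by (simp add: cnt_le_card)
      also have "\<dots> = cnt B (Max B)" using True d by (subst cnt_all) auto
      also have "\<dots> \<le> cnt A (Max B)" by (rule d)
      finally show False by simp
    qed
    moreover have "a \<noteq> Max B" using a \<open>Max B \<in> B\<close> d by auto
    ultimately show ?thesis by simp
  next
    case False
    then have C: "C \<noteq> {}" "Max A < link B C" using ad by (auto simp: admissible.simps)
    have "a \<le> Max A" using a d by simp
    also have "\<dots> < link B C" by fact
    also have "\<dots> \<le> Max B" using link_props(1)[OF st C(1)] d by simp
    finally show ?thesis .
  qed
qed

text \<open>
  The moves that apply are undone one by one by \<open>pull\<close>.  After two moves, one pull leaves a tableau whose row 1 is longer than row 2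
  and ends above the link; it is not admissible, so \<open>unrepair\<close> pulls again.
\<close>

lemma repair_step:
  assumes T: "T \<in> triples N" "admissible T" "\<not> same_parity T"
  shows "repair N T \<in> triples N \<and> same_parity (repair N T) \<and> \<not> admissible (repair N T)
    \<and> unrepair (repair N T) = T"
proof -
  obtain A B C where ABC: "T = (A, B, C)" by (cases T)
  have st: "standard (A, B, C)" and tr: "(A, B, C) \<in> triples N"
    using T by (auto simp: ABC triples_def)
  note d = standardD[OF st] and N = card_content[OF tr]
  have np: "\<not> same_parity (A, B, C)" using T ABC by simp
  have cz: "C = {} \<longleftrightarrow> card C = 0" "B = {} \<longleftrightarrow> card B = 0" "A = {} \<longleftrightarrow> card A = 0" using d by auto
  show ?thesis
  proof (cases "C \<noteq> {} \<and> odd (card C + N)")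
    case False
    note row2 = row2_defective[OF tr _ np False]
    have lt: "card C < card B" and c: "even (card C + N)" and e: "\<And>a. a \<in> A \<Longrightarrow> a < Max B"
      and "odd (card B + N)"
      using row2 T(2) ABC by blast+
    then have par: "odd (card B + N)" "odd (card A + N)" using N by presburger+
    have Bne: "B \<noteq> {}" using lt by auto
    obtain A' B' C' where p: "push2 (A, B, C) = (A', B', C')" by (cases "push2 (A, B, C)")
    note P = push2_props[OF st e lt p]
    have r: "repair N T = (A', B', C')" using False par Bne p by (auto simp: repair_def ABC)
    have "(A', B', C') \<in> triples N" using P tr by (simp add: triples_def)
    moreover have "same_parity (A', B', C')"
    proof -
      have "card B = Suc (card B')" using P(4) by simp
      then show ?thesis using c par P(3,5) by (auto simp: same_parity_def)
    qed
    moreover have "\<not> admissible (A', B', C')" using P(3,4,7) d(9) by (auto simp: admissible.simps dest: less_asym)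
    moreover have "unrepair (A', B', C') = T" using P(6) T(2) by (simp add: unrepair_def ABC)
    ultimately show ?thesis using r by simp
  next
    case True
    then have C: "C \<noteq> {}" "odd (card C + N)" by auto
    have gt: "card B < card A" and x: "\<And>a. a \<in> A \<Longrightarrow> a < link B C"
      using row3_defective[OF tr _ C] T(2) ABC by blast+
    obtain A' B' C' where p: "push1 (A, B, C) = (A', B', C')" by (cases "push1 (A, B, C)")
    note P = push1_props[OF st C(1) x p]
    have tr': "(A', B', C') \<in> triples N" using P tr by (simp add: triples_def)
    have cC: "card C = Suc (card C')" using P(5) by simp
    have na: "\<not> admissible (A', B', C')" using P(3,4,8) gt by (auto simp: admissible.simps dest: less_asym)
    have B'ne: "B' \<noteq> {}" using P(4) cz d(10) C by auto
    show ?thesis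
    proof (cases "odd (card B + N)")
      case False
      then have r: "repair N T = (A', B', C')" using True p P(4) by (auto simp: repair_def ABC)
      have "same_parity (A', B', C')"
        using False C(2) N P(3,4) cC by (auto simp: same_parity_def)
      moreover have "unrepair (A', B', C') = T" using P(6) T(2) by (simp add: unrepair_def ABC)
      ultimately show ?thesis using r tr' na by simp
    next
      case par: True
      obtain A'' B'' C'' where p2: "push2 (A', B', C') = (A'', B'', C'')"
        by (cases "push2 (A', B', C')")
      have lt: "card C' < card B'" using d(10) cC P(4) by simp
      note Q = push2_props[OF P(1) P(9) lt p2]
      have r: "repair N T = (A'', B'', C'')"
        using True p p2 par P(4) B'ne by (auto simp: repair_def ABC)
      have "(A'', B'', C'') \<in> triples N" using Q(1,2) tr' by (simp add: triples_def)
      moreover have "same_parity (A'', B'', C'')"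
      proof -
        have "card B' = Suc (card B'')" using Q(4) by simp
        then show ?thesis using par C(2) N P(3,4) cC Q(3,5) by (auto simp: same_parity_def)
      qed
      moreover have "\<not> admissible (A'', B'', C'')" using Q(3,4,7) P(3,4) gt by (auto simp: admissible.simps dest: less_asym)
      moreover have "unrepair (A'', B'', C'') = T" using Q(6) P(6) na by (simp add: unrepair_def ABC)
      ultimately show ?thesis using r by simp
    qed
  qed
qed

text \<open>
  Rows 1 and 2 have different lengths of equal parity, so there is room for the last entry \<open>q\<close> of row 1 in row 2.  If it bumps an entry,
  \<open>q\<close> becomes the link and exceeds what is left of row 1.  If it is appended and the result is not admissible, the new last entry of
  row 1 bumps an entry, because it is smaller than \<open>q\<close>, and becomes the link.
\<close>

lemma unrepair_step:
  assumes T: "T \<in> triples N" "\<not> admissible T" "same_parity T"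
  shows "unrepair T \<in> triples N \<and> \<not> same_parity (unrepair T) \<and> admissible (unrepair T)
    \<and> repair N (unrepair T) = T"
proof -
  obtain A B C where ABC: "T = (A, B, C)" by (cases T)
  have st: "standard (A, B, C)" and tr: "(A, B, C) \<in> triples N"
    using T by (auto simp: ABC triples_def)
  note d = standardD[OF st] and N = card_content[OF tr]
  have par: "even (card A + N)" "even (card B + N)" "even (card C + N)"
    using T(3) N by (auto simp: same_parity_def ABC)
  have neq: "card A \<noteq> card B" and nlk: "C \<noteq> {} \<Longrightarrow> \<not> Max A < link B C" using T(2) ABC by (auto simp: admissible.simps)
  have gt: "card B + 2 \<le> card A"
  proof -
    have "card A \<noteq> Suc (card B)" using par by auto
    then show ?thesis using neq d(9) by linarith
  qed
  then have "A \<noteq> {}" by auto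
  then have MA: "Max A \<in> A" using d by simp
  have lk: "link B C < Max A" if "C \<noteq> {}"
    using link_props(4)[OF st that] nlk[OF that] MA by (metis linorder_neqE_nat)
  obtain A' B' C' where p: "pull (A, B, C) = (A', B', C')" by (cases "pull (A, B, C)")
  show ?thesis
  proof (cases "\<forall>b\<in>B. b < Max A")
    case False
    then have ex: "\<exists>b\<in>B. \<not> b < Max A" by auto
    have "card B < card A" using gt by simp
    note P = pull_bump_props[OF st ex lk this p]
    have "A' \<noteq> {}" using P(3) gt by auto
    moreover have "finite A'" using standardD(1)[OF P(1)] .
    ultimately have "Max A' < Max A" using P(8) Max_in by blast
    then have ad: "admissible (A', B', C')" using P(6,9) by (simp add: admissible.simps)
    then have u: "unrepair T = (A', B', C')" by (simp add: unrepair_def ABC p)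
    have "(A', B', C') \<in> triples N" using P(1,2) tr by (simp add: triples_def)
    moreover have "\<not> same_parity (A', B', C')" using par P(4,5) by (auto simp: same_parity_def)
    moreover have "repair N (A', B', C') = T"
    proof -
      have "push1 (A', B', C') = T" using P(7) ABC by simp
      then show ?thesis using par P(5,9) by (auto simp: repair_def ABC)
    qed
    ultimately show ?thesis using ad u by simp
  next
    case True
    then have lt: "\<And>b. b \<in> B \<Longrightarrow> b < Max A" by blast
    note P = pull_append_props[OF st lt gt p]
    have tr': "(A', B', C') \<in> triples N" using P(1,2) tr by (simp add: triples_def)
    note d' = standardD[OF P(1)]
    have B'ne: "B' \<noteq> {}" using P(9) by auto
    show ?thesis
    proof (cases "admissible (A', B', C')")
      case ad: True
      then have u: "unrepair T = (A', B', C')" by (simp add: unrepair_def ABC p)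
      have "\<not> same_parity (A', B', C')" using par P(4,5) by (auto simp: same_parity_def)
      moreover have "repair N (A', B', C') = T"
      proof -
        have "push2 (A', B', C') = T" using P(7) ABC by simp
        then show ?thesis using par P(4,5) B'ne by (auto simp: repair_def ABC)
      qed
      ultimately show ?thesis using ad u tr' by simp
    next
      case na: False
      have A'ne: "A' \<noteq> {}" using P(3) gt by auto
      then have MA': "Max A' \<in> A'" using d' by simp
      have less: "Max A' < Max A" using P(8) MA' by blast
      have ex: "\<exists>b\<in>B'. \<not> b < Max A'"
        using P(9) less by (metis less_asym)
      have lk': "link B' C' < Max A'" if "C' \<noteq> {}"
        using link_props(4)[OF P(1) that] na that MA' by (metis admissible.simps linorder_neqE_nat)
      have gt': "card B' < card A'" using na d'(9) by (auto simp: admissible.simps)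
      obtain A'' B'' C'' where p2: "pull (A', B', C') = (A'', B'', C'')" by (cases "pull (A', B', C')")
      note Q = pull_bump_props[OF P(1) ex lk' gt' p2]
      have u: "unrepair T = (A'', B'', C'')" using na p p2 by (simp add: unrepair_def ABC)
      have "A'' \<noteq> {}" using Q(3) gt' P(4) by auto
      moreover have "finite A''" using standardD(1)[OF Q(1)] .
      ultimately have "Max A'' < Max A'" using Q(8) Max_in by blast
      then have ad: "admissible (A'', B'', C'')" using Q(6,9) by (simp add: admissible.simps)
      have "(A'', B'', C'') \<in> triples N" using Q(1,2) tr' by (simp add: triples_def)
      moreover have "\<not> same_parity (A'', B'', C'')"
      proof -
        have "card A = Suc (Suc (card A''))" using P(3) Q(3) by simp
        then show ?thesis using par Q(4) P(4) by (auto simp: same_parity_def)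
      qed
      moreover have "repair N (A'', B'', C'') = T"
      proof -
        have "push1 (A'', B'', C'') = (A', B', C')" "push2 (A', B', C') = T" using P(7) Q(7) ABC by simp_all
        then show ?thesis using par Q(5,9) P(4,5) B'ne by (auto simp: repair_def)
      qed
      ultimately show ?thesis using ad u by simp
    qed
  qed
qed

text \<open>
  \<open>Psi\<close> maps admissible tableaux of unequal parity bijectively to inadmissible ones of equal parity, and tableaux
  with both properties stay.
\<close>

lemma repair_bij:
  "bij_betw (\<lambda>T. if same_parity T then T else repair N T)
     {T \<in> triples N. admissible T} {T \<in> triples N. same_parity T}"
  (is "bij_betw ?f ?X ?Y")
proof (rule bij_betw_byWitness)
  let ?g = "\<lambda>T. if admissible T then T else unrepair T"
  have "?g (?f T) = T \<and> ?f T \<in> ?Y" if "T \<in> ?X" for T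
    using repair_step[of T N] that by (cases "same_parity T") simp_all
  then show "\<forall>T\<in>?X. ?g (?f T) = T" "?f ` ?X \<subseteq> ?Y" by blast+
  have "?f (?g T) = T \<and> ?g T \<in> ?X" if "T \<in> ?Y" for T
    using unrepair_step[of T N] that by (cases "admissible T") simp_all
  then show "\<forall>T\<in>?Y. ?f (?g T) = T" "?g ` ?Y \<subseteq> ?X" by blast+
qed

lemma equal_parity_tableau_of:
  assumes "standard T"
  shows "equal_parity (tableau_of T) \<longleftrightarrow> same_parity T"
proof -
  obtain A B C where T: "T = (A, B, C)" by (cases T)
  show ?thesis
    using assms row_len_tableau_of[of A B C] unfolding T equal_parity_def same_parity_def
    by (simp add: mod2_eq_if)
qed

lemma sorted_list_of_set_last:
  assumes "finite (A :: nat set)" "A \<noteq> {}"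
  shows "last (sorted_list_of_set A) = Max A" "butlast (sorted_list_of_set A) = sorted_list_of_set (A - {Max A})"
proof -
  have "a < Max A" if "a \<in> A - {Max A}" for a
    using Max_ge[OF assms(1), of a] that by (intro le_neq_implies_less) blast+
  then have "sorted_list_of_set (insert (Max A) (A - {Max A})) = sorted_list_of_set (A - {Max A}) @ [Max A]"
    using assms(1) by (intro sorted_list_of_set_insert_Max) auto
  moreover have "insert (Max A) (A - {Max A}) = A" using assms Max_in by blast
  ultimately have "sorted_list_of_set A = sorted_list_of_set (A - {Max A}) @ [Max A]" by simp
  then show "last (sorted_list_of_set A) = Max A" "butlast (sorted_list_of_set A) = sorted_list_of_set (A - {Max A})"
    by simp_all
qed

lemma move1_three_rows:
  "move1 [r, s, t] = (let y = last t; x = Max {z \<in> set s. z < y} in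
     drop_empty [r @ [x], map (\<lambda>z. if z = x then y else z) s, butlast t])"
  by (simp add: move1_def Let_def numeral_2_eq_2)

lemma move1_tableau_of:
  assumes st: "standard (A, B, C)" and ne: "C \<noteq> {}" and x: "\<And>a. a \<in> A \<Longrightarrow> a < link B C"
  shows "move1 (tableau_of (A, B, C)) = tableau_of (push1 (A, B, C))"
proof -
  let ?x = "link B C" and ?y = "Max C"
  note d = standardD[OF st] and l = link_props[OF st ne]
  have ne': "B \<noteq> {}" "A \<noteq> {}" using ne standard_empty[OF st] by auto
  have T: "tableau_of (A, B, C) = [sorted_list_of_set A, sorted_list_of_set B, sorted_list_of_set C]"
    using ne ne' by (simp add: tableau_of_cases[OF st])
  have lst: "last (sorted_list_of_set C) = ?y" "butlast (sorted_list_of_set C) = sorted_list_of_set (C - {?y})"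
    using sorted_list_of_set_last[OF d(3) ne] by auto
  have mx: "Max {z \<in> set (sorted_list_of_set B). z < ?y} = ?x" using d(2) by (simp add: link_def)
  let ?f = "\<lambda>z. if z = ?x then ?y else z"
  have yB: "?y \<notin> B" using d(3,6) ne Max_in by blast
  have mono: "?f z < ?f z'" if "z \<in> B" "z' \<in> B" "z < z'" for z z'
  proof -
    have "z' \<noteq> ?y" using yB that by auto
    then show ?thesis using l(2) l(3)[of z'] that by (cases "z' < ?y") auto
  qed
  have "sorted_wrt (<) (map ?f (sorted_list_of_set B))"
    unfolding sorted_wrt_map
    by (rule sorted_wrt_mono_rel[of "sorted_list_of_set B" "(<)"]) (use d(2) mono in simp_all)
  moreover have "set (map ?f (sorted_list_of_set B)) = insert ?y (B - {?x})"
    using d(2) l(1) by auto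
  ultimately have mp: "map ?f (sorted_list_of_set B) = sorted_list_of_set (insert ?y (B - {?x}))"
    by (metis sorted_list_of_set_eqI)
  have A: "sorted_list_of_set A @ [?x] = sorted_list_of_set (insert ?x A)"
    using sorted_list_of_set_insert_Max[OF d(1), of ?x] x by simp
  show ?thesis
    unfolding T move1_three_rows[of "sorted_list_of_set A" "sorted_list_of_set B" "sorted_list_of_set C",
        unfolded lst Let_def mx mp A]
    by (simp add: push1.simps tableau_of_def)
qed

lemma move2_tableau_of:
  assumes st: "standard (A, B, C)" and ne: "B \<noteq> {}" and e: "\<And>a. a \<in> A \<Longrightarrow> a < Max B"
  shows "move2 (tableau_of (A, B, C)) = tableau_of (push2 (A, B, C))"
proof -
  note d = standardD[OF st]
  have ne': "A \<noteq> {}" using ne standard_empty[OF st] by auto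
  have A: "sorted_list_of_set (insert (Max B) A) = sorted_list_of_set A @ [Max B]"
    using sorted_list_of_set_insert_Max[OF d(1), of "Max B"] e by simp
  have "move2 (sorted_list_of_set A # sorted_list_of_set B # ts) =
      drop_empty (sorted_list_of_set (insert (Max B) A) # sorted_list_of_set (B - {Max B}) # ts)" for ts
    using sorted_list_of_set_last[OF d(2) ne] A by (simp add: move2_def)
  then show ?thesis
    unfolding push2.simps tableau_of_cases[OF st] using ne ne'
    by (simp add: tableau_of_def drop_empty_def)
qed

lemma defective_tableau_of:
  assumes st: "standard (A, B, C)"
  shows "defective N (tableau_of (A, B, C)) 2 \<longleftrightarrow> C \<noteq> {} \<and> odd (card C + N)"
    "defective N (tableau_of (A, B, C)) 1 \<longleftrightarrow> B \<noteq> {} \<and> odd (card B + N)"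
  using standardD(2,3)[OF st] row_len_tableau_of[OF st]
  by (auto simp: defective_def mod2_eq_if card_gt_0_iff)

lemma Psi_tableau_of:
  assumes T: "T \<in> triples N" "admissible T" "\<not> same_parity T"
  shows "Psi N (tableau_of T) = tableau_of (repair N T)"
proof -
  obtain A B C where ABC: "T = (A, B, C)" by (cases T)
  have tr: "(A, B, C) \<in> triples N" and ad: "admissible (A, B, C)" and np: "\<not> same_parity (A, B, C)"
    using T by (simp_all add: ABC)
  have st: "standard (A, B, C)" using tr by (simp add: triples_def)
  note def = defective_tableau_of[OF st, of N]
  show ?thesis
  proof (cases "C \<noteq> {} \<and> odd (card C + N)")
    case False
    note E = row2_defective[OF tr ad np False]
    then have "B \<noteq> {}" by auto
    then show ?thesis
      using False def E move2_tableau_of[OF st _ E(3)]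
      by (simp add: ABC Psi_def repair_def Let_def)
  next
    case True
    then have C: "C \<noteq> {}" "odd (card C + N)" by auto
    note X = row3_defective[OF tr ad C]
    obtain A' B' C' where p: "push1 (A, B, C) = (A', B', C')" by (cases "push1 (A, B, C)")
    note P = push1_props[OF st C(1) X(2) p]
    note def' = defective_tableau_of[OF P(1), of N]
    have m: "move1 (tableau_of (A, B, C)) = tableau_of (A', B', C')"
      using move1_tableau_of[OF st C(1) X(2)] p by simp
    show ?thesis
      using C def m p def' move2_tableau_of[OF P(1) _ P(9)]
      by (simp add: ABC Psi_def repair_def Let_def)
  qed
qed

section \<open>Assembling the bijection\<close>

lemma tableau_of_same_parity_bij:
  "bij_betw tableau_of {T \<in> triples N. same_parity T} (SYT3_eq N)"
  "bij_betw tableau_of {T \<in> triples N. \<not> same_parity T} (SYT3 N - SYT3_eq N)"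
proof -
  have im: "tableau_of ` triples N = SYT3 N" and inj: "inj_on tableau_of (triples N)"
    using tableau_of_bij[of N] by (auto simp: bij_betw_def)
  have par: "equal_parity (tableau_of T) \<longleftrightarrow> same_parity T" if "T \<in> triples N" for T
    using that equal_parity_tableau_of by (simp add: triples_def)
  have filter: "tableau_of ` {T \<in> triples N. P T} = {T \<in> SYT3 N. Q T}"
    if "\<And>T. T \<in> triples N \<Longrightarrow> Q (tableau_of T) \<longleftrightarrow> P T" for P Q
    unfolding im[symmetric] using that by auto
  have "tableau_of ` {T \<in> triples N. same_parity T} = SYT3_eq N"
    unfolding SYT3_eq_def by (rule filter) (rule par)
  moreover have "tableau_of ` {T \<in> triples N. \<not> same_parity T} = {T \<in> SYT3 N. \<not> equal_parity T}"
    by (rule filter) (simp add: par)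
  then have "tableau_of ` {T \<in> triples N. \<not> same_parity T} = SYT3 N - SYT3_eq N"
    by (simp add: SYT3_eq_def set_diff_eq cong: conj_cong)
  moreover have "inj_on tableau_of {T \<in> triples N. same_parity T}"
    "inj_on tableau_of {T \<in> triples N. \<not> same_parity T}"
    by (rule inj_on_subset[OF inj], simp)+
  ultimately show "bij_betw tableau_of {T \<in> triples N. same_parity T} (SYT3_eq N)"
    "bij_betw tableau_of {T \<in> triples N. \<not> same_parity T} (SYT3 N - SYT3_eq N)"
    by (simp_all add: bij_betw_def)
qed

lemma Phi_bij: "bij_betw Phi (riordan_perms N) (SYT3_eq N)"
proof -
  let ?f = "tableau_of \<circ> ((\<lambda>T. if same_parity T then T else repair N T) \<circ>
    (insert_rest N \<circ> ((\<lambda>(U, D). (block_ends N D U, D)) \<circ> (\<lambda>\<pi>. (Uset \<pi>, Dset \<pi>)))))"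
  have "bij_betw ?f (riordan_perms N) (SYT3_eq N)"
    using bij_betw_trans[OF bij_betw_trans[OF bij_betw_trans[OF bij_betw_trans[OF
          riordan_perms_bij block_ends_bij] insert_rest_bij] repair_bij] tableau_of_same_parity_bij(1)] .
  moreover have eq: "?f \<pi> = Phi \<pi>" if p: "\<pi> \<in> riordan_perms N" for \<pi>
  proof -
    let ?T = "insert_rest N (block_ends N (Dset \<pi>) (Uset \<pi>), Dset \<pi>)"
    have len: "length \<pi> = N" using p motzkin_perms_woven(2) by (auto simp: riordan_perms_def)
    have "(Uset \<pi>, Dset \<pi>) \<in> riordan_pairs N" using riordan_perms_bij[of N] p by (auto simp: bij_betw_def)
    then have "(block_ends N (Dset \<pi>) (Uset \<pi>), Dset \<pi>) \<in> row_pairs N" by (rule block_ends_row_pairs)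
    then have T: "?T \<in> triples N" "admissible ?T"
      using bij_betw_apply[OF insert_rest_bij] by blast+
    then show ?thesis
      using equal_parity_tableau_of[of ?T] Psi_tableau_of[OF T]
      by (simp add: Phi_def P_tab_theta[OF p] len Let_def triples_def)
  qed
  ultimately show ?thesis using bij_betw_cong[of "riordan_perms N" ?f Phi] eq by blast
qed

text \<open>
  Deleting an entry from a triple, wherever it is.
\<close>

definition remove_from :: "nat \<Rightarrow> triple \<Rightarrow> triple" where
  "remove_from v = (\<lambda>(A, B, C). (A - {v}, B - {v}, C - {v}))"

text \<open>
  Puts \<open>v\<close> into the row whose parity differs from the parity of the other two.
\<close>

definition add_restoring :: "nat \<Rightarrow> triple \<Rightarrow> triple" where
  "add_restoring v = (\<lambda>(A, B, C).
     if even (card B + card C) then (insert v A, B, C)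
     else if even (card A + card C) then (A, insert v B, C) else (A, B, insert v C))"

lemma cnt_remove_top:
  assumes "X \<subseteq> {1..Suc n}"
  shows "cnt (X - {Suc n}) v = cnt X (min v n)"
  unfolding cnt_def by (rule arg_cong[of _ _ card]) (use assms in \<open>auto simp: le_Suc_eq\<close>)

lemma triples_disjoint:
  assumes "(A, B, C) \<in> triples n"
  shows "A \<union> B \<union> C = {1..n}" "A \<subseteq> {1..n}" "B \<subseteq> {1..n}" "C \<subseteq> {1..n}" "standard (A, B, C)"
  using assms by (auto simp: triples_def content_def)

lemma remove_from_triples:
  assumes "T \<in> triples (Suc n)" "same_parity T"
  shows "remove_from (Suc n) T \<in> triples n" "\<not> same_parity (remove_from (Suc n) T)"
    "add_restoring (Suc n) (remove_from (Suc n) T) = T"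
proof -
  let ?N = "Suc n"
  obtain A B C where T: "T = (A, B, C)" by (cases T)
  have tr: "(A, B, C) \<in> triples ?N" using assms T by simp
  note t = triples_disjoint[OF tr] and d = standardD[OF triples_disjoint(5)[OF tr]]
  have par: "even (card A + card B)" "even (card B + card C)" using assms(2) T by (auto simp: same_parity_def)
  have "cnt (B - {?N}) v \<le> cnt (A - {?N}) v" "cnt (C - {?N}) v \<le> cnt (B - {?N}) v" for v
    using d(7,8) cnt_remove_top t(2-4) by simp_all
  then have "standard (A - {?N}, B - {?N}, C - {?N})"
    using d(1-6) unfolding standard_def ballot_def by auto
  moreover have "content (A - {?N}, B - {?N}, C - {?N}) = {1..n}"
  proof -
    have "content (A - {?N}, B - {?N}, C - {?N}) = (A \<union> B \<union> C) - {?N}"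
      unfolding content_def by blast
    also have "\<dots> = {1..n}" unfolding t(1) by auto
    finally show ?thesis .
  qed
  ultimately show "remove_from ?N T \<in> triples n"
    by (simp add: triples_def remove_from_def T)
  have "?N \<in> A \<union> B \<union> C" using t(1) by auto
  then consider "?N \<in> A" "?N \<notin> B" "?N \<notin> C" | "?N \<in> B" "?N \<notin> A" "?N \<notin> C" | "?N \<in> C" "?N \<notin> A" "?N \<notin> B"
    using d(4-6) by blast
  then have "\<not> same_parity (remove_from ?N T) \<and> add_restoring ?N (remove_from ?N T) = T"
  proof cases
    case 1
    then have r: "remove_from ?N T = (A - {?N}, B, C)"
      by (simp add: T remove_from_def)
    have "card A = Suc (card (A - {?N}))" using 1(1) d(1) by (metis card.remove)
    then have "odd (card (A - {?N}) + card B)" "odd (card (A - {?N}) + card C)" "even (card B + card C)"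
      using par by auto
    then show ?thesis using 1(1) unfolding r
      by (auto simp: T add_restoring_def same_parity_def insert_absorb)
  next
    case 2
    then have r: "remove_from ?N T = (A, B - {?N}, C)"
      by (simp add: T remove_from_def)
    have "card B = Suc (card (B - {?N}))" using 2(1) d(2) by (metis card.remove)
    then have "odd (card (B - {?N}) + card A)" "odd (card (B - {?N}) + card C)" "even (card A + card C)"
      using par by auto
    then show ?thesis using 2(1) unfolding r
      by (auto simp: T add_restoring_def same_parity_def insert_absorb)
  next
    case 3
    then have r: "remove_from ?N T = (A, B, C - {?N})"
      by (simp add: T remove_from_def)
    have "card C = Suc (card (C - {?N}))" using 3(1) d(3) by (metis card.remove)
    then have "odd (card (C - {?N}) + card A)" "odd (card (C - {?N}) + card B)" "even (card A + card B)"
      using par by auto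
    then show ?thesis using 3(1) unfolding r
      by (auto simp: T add_restoring_def same_parity_def insert_absorb)
  qed
  then show "\<not> same_parity (remove_from ?N T)" "add_restoring ?N (remove_from ?N T) = T" by blast+
qed

lemma cnt_insert_top:
  assumes "X \<subseteq> {1..n}"
  shows "cnt (insert (Suc n) X) v = (if v \<le> n then cnt X v else Suc (card X))"
proof -
  have fin: "finite X" "Suc n \<notin> X" using assms finite_subset by auto
  show ?thesis
  proof (cases "v \<le> n")
    case False
    then have "cnt X v = card X" using assms by (intro cnt_all) auto
    then show ?thesis using False fin by (simp add: cnt_insert)
  qed (use fin in \<open>simp add: cnt_insert\<close>)
qed

text \<open>
  A row of exceptional parity differs in length from the row above it, so it is strictly shorter and there is room for a new cell.
\<close>

lemma add_restoring_triples:
  assumes "T \<in> triples n" "\<not> same_parity T"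
  shows "add_restoring (Suc n) T \<in> triples (Suc n)" "same_parity (add_restoring (Suc n) T)"
    "remove_from (Suc n) (add_restoring (Suc n) T) = T"
proof -
  let ?N = "Suc n"
  obtain A B C where T: "T = (A, B, C)" by (cases T)
  have tr: "(A, B, C) \<in> triples n" using assms T by simp
  note t = triples_disjoint[OF tr] and d = standardD[OF triples_disjoint(5)[OF tr]]
  have N: "?N \<notin> A" "?N \<notin> B" "?N \<notin> C" using t(2-4) by auto
  have c: "cnt X v = card X" if "X \<subseteq> {1..n}" "\<not> v \<le> n" for X v
    using that by (intro cnt_all) auto
  have un: "insert ?N (A \<union> B \<union> C) = {1..?N}" unfolding t(1) by auto
  show "remove_from ?N (add_restoring ?N T) = T"
    using N by (auto simp: T remove_from_def add_restoring_def)
  show "same_parity (add_restoring ?N T)"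
    using assms(2) N d(1-3) by (auto simp: T add_restoring_def same_parity_def)
  consider "even (card B + card C)" | "odd (card B + card C)" "even (card A + card C)"
    | "odd (card B + card C)" "odd (card A + card C)" by blast
  then show "add_restoring ?N T \<in> triples ?N"
  proof cases
    case 1
    have "standard (insert ?N A, B, C)"
      using d N unfolding standard_def ballot_def
      by (auto simp: cnt_insert le_SucI)
    then show ?thesis using 1 un by (simp add: T add_restoring_def triples_def content_def)
  next
    case 2
    then have lt: "card B < card A" using d(9) by (cases "card B = card A") auto
    have "cnt (insert ?N B) v \<le> cnt A v" "cnt C v \<le> cnt (insert ?N B) v" for v
      using d(7,8)[of v] lt c[OF t(2), of v] cnt_le_card[OF d(2), of v]
      by (auto simp: cnt_insert_top[OF t(3)])
    then have "standard (A, insert ?N B, C)"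
      using d(1-6) N unfolding standard_def ballot_def by auto
    then show ?thesis using 2 un by (simp add: T add_restoring_def triples_def content_def)
  next
    case 3
    then have lt: "card C < card B" using d(10) by (cases "card B = card C") auto
    have "cnt (insert ?N C) v \<le> cnt B v" for v
      using d(8)[of v] lt c[OF t(3), of v] by (auto simp: cnt_insert_top[OF t(4)])
    then have "standard (A, B, insert ?N C)"
      using d(1-7) N unfolding standard_def ballot_def by auto
    then show ?thesis using 3 un by (simp add: T add_restoring_def triples_def content_def)
  qed
qed

lemma remove_from_bij:
  "bij_betw (remove_from (Suc n)) {T \<in> triples (Suc n). same_parity T} {T \<in> triples n. \<not> same_parity T}"
  by (rule bij_betw_byWitness[where f' = "add_restoring (Suc n)"])
    (use remove_from_triples add_restoring_triples in auto)

lemma removeAll_sorted_list_of_set: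
  "finite A \<Longrightarrow> removeAll v (sorted_list_of_set A) = sorted_list_of_set (A - {v})"
  by (metis distinct_remove1_removeAll distinct_sorted_list_of_set sorted_list_of_set_remove)

lemma remove_entry_tableau_of:
  assumes "standard T"
  shows "remove_entry v (tableau_of T) = tableau_of (remove_from v T)"
proof -
  obtain A B C where T: "T = (A, B, C)" by (cases T)
  have "finite A" "finite B" "finite C" using assms by (auto simp: T standard_def)
  moreover have "filter (\<lambda>r. r \<noteq> []) (map (removeAll v) (filter (\<lambda>r. r \<noteq> []) xs)) =
      filter (\<lambda>r. r \<noteq> []) (map (removeAll v) xs)" for xs :: "nat list list"
    by (induction xs) auto
  ultimately show ?thesis
    by (simp only: T remove_entry_def tableau_of_def drop_empty_def remove_from_def prod.case
        list.map removeAll_sorted_list_of_set)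
qed

lemma remove_entry_bij:
  "bij_betw (remove_entry (Suc n)) (SYT3_eq (Suc n)) (SYT3 n - SYT3_eq n)"
proof -
  have "bij_betw (tableau_of \<circ> remove_from (Suc n)) {T \<in> triples (Suc n). same_parity T} (SYT3 n - SYT3_eq n)"
    by (rule bij_betw_trans[OF remove_from_bij tableau_of_same_parity_bij(2)])
  then have "bij_betw (remove_entry (Suc n) \<circ> tableau_of) {T \<in> triples (Suc n). same_parity T} (SYT3 n - SYT3_eq n)"
    by (rule bij_betw_cong[THEN iffD1, rotated]) (simp add: remove_entry_tableau_of triples_def)
  then show ?thesis
    using bij_betw_comp_iff[OF tableau_of_same_parity_bij(1)] by blast
qed

theorem theorem4p1:
  fixes n :: nat
  shows "bij_betw (Phi_tilde n \<circ> alpha_inv n) (motzkin_paths n) (SYT3 n) \<and>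
         bij_betw (Phi_tilde n \<circ> alpha_inv n) (riordan_paths n) (SYT3_eq n)"
proof -
  have sub: "riordan_perms n \<subseteq> motzkin_perms n" "SYT3_eq n \<subseteq> SYT3 n"
    by (auto simp: riordan_perms_def SYT3_eq_def)
  have R: "bij_betw (Phi_tilde n) (riordan_perms n) (SYT3_eq n)"
    using Phi_bij[of n] by (rule bij_betw_cong[THEN iffD1, rotated]) (simp add: Phi_tilde_def)
  have "bij_betw (gamma_hat n) (motzkin_perms n - riordan_perms n) (riordan_perms (Suc n))"
    unfolding gamma_hat_def
    using bij_betw_trans[OF bij_betw_trans[OF alpha_inv_bij(3) gamma_bij] alpha_inv_bij(2)]
    by (simp only: comp_assoc)
  then have "bij_betw (remove_entry (Suc n) \<circ> (Phi \<circ> gamma_hat n))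
      (motzkin_perms n - riordan_perms n) (SYT3 n - SYT3_eq n)"
    by (rule bij_betw_trans[OF bij_betw_trans[OF _ Phi_bij] remove_entry_bij])
  then have "bij_betw (Phi_tilde n) (motzkin_perms n - riordan_perms n) (SYT3 n - SYT3_eq n)"
    by (rule bij_betw_cong[THEN iffD1, rotated]) (simp add: Phi_tilde_def)
  then have "bij_betw (Phi_tilde n) (riordan_perms n \<union> (motzkin_perms n - riordan_perms n))
      (SYT3_eq n \<union> (SYT3 n - SYT3_eq n))"
    by (rule bij_betw_combine[OF R]) blast
  then have M: "bij_betw (Phi_tilde n) (motzkin_perms n) (SYT3 n)"
    by (simp only: Un_Diff_cancel Un_absorb1[OF sub(1)] Un_absorb1[OF sub(2)])
  show ?thesis
    using bij_betw_trans[OF alpha_inv_bij(1) M] bij_betw_trans[OF alpha_inv_bij(2) R] by blast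
qed

end
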